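(* (Riemann Hypothesis) Let $q$ be any prime power, let $v=t$ as a prime of $\mathbb{F}_q[t]$, and let $y=(z,M)\in\mathbb{Z}/(q-1)\mathbb{Z}\times\mathbb{Z}_p$. Then all zeros $x\in\mathbb{C}_v$ of the Goss $v$-adic zeta function $\zeta_v(x,y)$ are simple and lie in $K_v=\mathbb{F}_q((t))$.
   Context: $p$ is the characteristic of $\mathbb{F}_q$, and $\mathbb{C}_v$ is the completion of an algebraic closure of $K_v=\mathbb{F}_q((t))$. For a monic $a=f_0+f_1t+\cdots+f_{d-1}t^{d-1}+t^d\in\mathbb{F}_q[t]$ with $f_0\ne0$ and $y=(z,M)$, set $a^y:=f_0^{z}\,(a/f_0)^{M}$; here $f_0^z$ is well defined since $f_0^{q-1}=1$, and $(a/f_0)^M$ is the $p$-adic power of the one-unit $a/f_0\in 1+t\mathbb{F}_q[[t]]$, which makes sense for $M\in\mathbb{Z}_p$. Let $$S_{d,v}(y)=\sum_{\substack{a\in\mathbb{F}_q[t]\text{ monic}\\ \deg a=d,\ a(0)\neq 0}} a^y,$$ and define the Goss $v$-adic zeta function as the entire power series in $x$ $$\zeta_v(x,y)=\sum_{d=0}^{\infty}S_{d,v}(y)\,x^d .$$ *)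

theory Defs
  imports
    "HOL-Analysis.Analysis"
    "HOL-Computational_Algebra.Computational_Algebra"
    "HOL-Algebra.Algebraic_Closure_Type"
begin

section \<open>The p-adic integers and p-adic powers of one-units\<close>

text \<open>
  The ring of p-adic integers is the inverse limit of the rings of integers modulo the powers
  of p; the n-th entry is the representative of the class modulo \<open>p ^ n\<close> in \<open>{0..<p ^ n}\<close>.
\<close>

definition padic_ints :: "nat \<Rightarrow> (nat \<Rightarrow> nat) set" where
  "padic_ints p = {M. \<forall>n. M n < p ^ n \<and> M (Suc n) mod p ^ n = M n}"

text \<open>
  The limit is taken in the t-adic topology of the ring of power series. It is meaningful for
  power series with constant coefficient 1 in characteristic p, see below.
\<close>

definition padic_power :: "'a::comm_ring_1 fps \<Rightarrow> (nat \<Rightarrow> nat) \<Rightarrow> 'a fps" where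
  "padic_power u M = lim (\<lambda>n. u ^ M n)"

lemma one_unit_power_CHAR_power_nth:
  fixes u :: "'a::finite_field fps"
  assumes "fps_nth u 0 = 1" "k < CHAR('a) ^ n"
  shows   "fps_nth (v * u ^ (CHAR('a) ^ n * j)) k = fps_nth v k"
proof -
  let ?N = "CHAR('a) ^ n"
  have prime: "Factorial_Ring.prime CHAR('a fps)"
    by (simp add: prime_CHAR_semidom finite_imp_CHAR_pos)
  have "u ^ ?N = (1 + (u - 1)) ^ ?N"
    by simp
  also have "\<dots> = 1 + (u - 1) ^ ?N"
    using freshmans_dream'[OF prime, of "CHAR('a) ^ n" n 1 "u - 1"] by simp
  finally have pow: "u ^ ?N = 1 + (u - 1) ^ ?N" .
  have "fps_X dvd u - 1"
  proof (cases "u = 1")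
    case False
    moreover have "subdegree (u - 1) \<noteq> 0"
      using assms(1) False by (simp add: subdegree_eq_0_iff)
    ultimately show ?thesis
      by (simp add: fps_dvd_iff)
  qed auto
  hence "fps_X ^ ?N dvd u ^ ?N - 1"
    unfolding pow by (simp add: dvd_power_same)
  also have "u ^ ?N - 1 dvd u ^ (?N * j) - 1"
    unfolding power_mult by (metis dvd_triv_left power_diff_1_eq)
  finally have "fps_X ^ ?N dvd v * (u ^ (?N * j) - 1)"
    by (rule dvd_mult)
  then obtain w where w: "v * (u ^ (?N * j) - 1) = fps_X ^ ?N * w"
    by (elim dvdE)
  have "v * u ^ (?N * j) = v + fps_X ^ ?N * w"
    unfolding w[symmetric] by (simp add: algebra_simps)
  thus ?thesis
    using assms(2) by (simp add: fps_X_power_mult_nth)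
qed

lemma padic_power_LIMSEQ:
  fixes u :: "'a::finite_field fps"
  assumes u: "fps_nth u 0 = 1" and M: "M \<in> padic_ints CHAR('a)"
  shows   "(\<lambda>n. u ^ M n) \<longlonglongrightarrow> padic_power u M"
proof -
  have "Factorial_Ring.prime CHAR('a)"
    by (simp add: prime_CHAR_semidom finite_imp_CHAR_pos)
  hence p: "CHAR('a) > 1"
    by (rule prime_gt_1_nat)
  have stable: "fps_nth (u ^ M (n + i)) n = fps_nth (u ^ M n) n" for n i
  proof (induction i)
    case (Suc i)
    have "M (Suc (n + i)) = M (n + i) + CHAR('a) ^ (n + i) * (M (Suc (n + i)) div CHAR('a) ^ (n + i))"
      using M mod_mult_div_eq[of "M (Suc (n + i))" "CHAR('a) ^ (n + i)"]
      by (simp add: padic_ints_def)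
    then obtain j where j: "M (Suc (n + i)) = M (n + i) + CHAR('a) ^ (n + i) * j"
      by blast
    have "n < CHAR('a) ^ n"
      using p by (intro power_gt_expt) simp
    also have "\<dots> \<le> CHAR('a) ^ (n + i)"
      using p by (intro power_increasing) auto
    finally show ?case
      using Suc one_unit_power_CHAR_power_nth[OF u, of n "n + i" "u ^ M (n + i)" j]
      by (simp add: j power_add)
  qed auto
  have "(\<lambda>n. u ^ M n) \<longlonglongrightarrow> Abs_fps (\<lambda>n. fps_nth (u ^ M n) n)"
  proof (rule tendsto_fpsI)
    fix k
    show "\<forall>\<^sub>F n in sequentially. fps_nth (u ^ M n) k = fps_nth (Abs_fps (\<lambda>n. fps_nth (u ^ M n) n)) k"
      using eventually_ge_at_top[of k]
    proof eventually_elim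
      case (elim n)
      thus ?case using stable[of k "n - k"] by simp
    qed
  qed
  thus ?thesis
    unfolding padic_power_def by (simp add: limI)
qed


section \<open>The power sums\<close>

text \<open>
  The exponent y is a pair \<open>(z, M)\<close>, where the integer z stands for its residue class modulo
  \<open>q - 1\<close>: the value depends only on that class, as \<open>c ^ (q - 1) = 1\<close> for every nonzero c in
  the field with q elements.
\<close>

definition goss_power :: "'a::finite_field poly \<Rightarrow> int \<times> (nat \<Rightarrow> nat) \<Rightarrow> 'a fps" where
  "goss_power a y =
     fps_const (Polynomial.coeff a 0 powi fst y) *
     padic_power (fps_of_poly (Polynomial.smult (inverse (Polynomial.coeff a 0)) a)) (snd y)"

definition goss_S :: "nat \<Rightarrow> int \<times> (nat \<Rightarrow> nat) \<Rightarrow> 'a::finite_field fps" where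
  "goss_S d y =
     (\<Sum>a | Polynomial.lead_coeff a = 1 \<and> Polynomial.degree a = d \<and> Polynomial.coeff a 0 \<noteq> 0.
        goss_power a y)"

lemma finite_goss_S_index:
  "finite {a :: 'a::finite_field poly.
     Polynomial.lead_coeff a = 1 \<and> Polynomial.degree a = d \<and> Polynomial.coeff a 0 \<noteq> 0}"
proof (rule finite_subset)
  show "{a :: 'a poly. Polynomial.lead_coeff a = 1 \<and> Polynomial.degree a = d \<and> Polynomial.coeff a 0 \<noteq> 0} \<subseteq>
          Poly ` {xs. set xs \<subseteq> UNIV \<and> length xs \<le> Suc d}"
  proof
    fix a :: "'a poly"
    assume "a \<in> {a. Polynomial.lead_coeff a = 1 \<and> Polynomial.degree a = d \<and> Polynomial.coeff a 0 \<noteq> 0}"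
    hence "length (coeffs a) \<le> Suc d"
      by (cases "a = 0") (auto simp: length_coeffs_degree)
    moreover have "a = Poly (coeffs a)"
      by simp
    ultimately show "a \<in> Poly ` {xs. set xs \<subseteq> UNIV \<and> length xs \<le> Suc d}"
      by blast
  qed
qed (intro finite_imageI finite_lists_length_le, simp)


section \<open>The completed algebraic closure\<close>

text \<open>
  A completion of the algebraic closure of the field of formal Laurent series: a complete
  non-archimedean valued field (with absolute value \<open>dist x 0\<close>) together with a dense embedding
  of the algebraic closure that extends the t-adic absolute value. The latter is the one that
  the library uses for the metric on formal Laurent series, normalised by \<open>\<bar>t\<bar> = 1/2\<close>. As the
  extension of the absolute value to the algebraic closure is unique, these conditions determine
  the field up to isometric isomorphism.
\<close>

locale completed_alg_closure =
  fixes emb :: "'a::finite_field fls alg_closure \<Rightarrow> 'c::{field, complete_space}"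
  assumes emb_1:    "emb 1 = 1"
    and emb_add:    "emb (x + y) = emb x + emb y"
    and emb_mult:   "emb (x * y) = emb x * emb y"
    and dist_diff:  "dist u v = dist (u - v :: 'c) 0"
    and abs_mult:   "dist (u * v :: 'c) 0 = dist u 0 * dist v 0"
    and abs_add:    "dist (u + v :: 'c) 0 \<le> max (dist u 0) (dist v 0)"
    and abs_emb:    "dist (emb (to_ac f)) 0 = dist f 0"
    and dense:      "closure (range emb) = UNIV"


section \<open>Entire power series and the zeta function\<close>

definition eval_series :: "'c::{field, metric_space} fps \<Rightarrow> 'c \<Rightarrow> 'c" where
  "eval_series F x = (\<Sum>n. fps_nth F n * x ^ n)"

definition entire_series :: "'c::{field, metric_space} fps \<Rightarrow> bool" where
  "entire_series F \<longleftrightarrow> (\<forall>x. summable (\<lambda>n. fps_nth F n * x ^ n))"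

definition has_zero_of_order :: "'c::{field, metric_space} fps \<Rightarrow> 'c \<Rightarrow> nat \<Rightarrow> bool" where
  "has_zero_of_order F x m \<longleftrightarrow>
     (\<exists>G. entire_series G \<and> F = (fps_X - fps_const x) ^ m * G \<and> eval_series G x \<noteq> 0)"

definition goss_zeta ::
  "('a::finite_field fls alg_closure \<Rightarrow> 'c::field) \<Rightarrow> int \<times> (nat \<Rightarrow> nat) \<Rightarrow> 'c fps" where
  "goss_zeta emb y = Abs_fps (\<lambda>d. emb (to_ac (fps_to_fls (goss_S d y))))"

end

theory Submission
  imports Defs "HOL-Number_Theory.Cong"
begin

text \<open>
  Dividing a monic polynomial of degree d by its constant term c gives \<open>1 + t B\<close> with B of degree
  \<open>d - 1\<close>. Expanding \<open>(1 + t B) ^ M\<close>, and then repeatedly the powers of B, by the binomial theorem and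
  summing over the coefficients writes the power sum as a signed sum, over the chains
  \<open>\<nu>\<^sub>0, \<dots>, \<nu>\<^sub>d\<^sub>-\<^sub>1, M\<close> that increase digitwise in base p (Lucas), strictly except possibly in the last step,
  with all \<open>\<nu>\<^sub>k\<close> congruent to z modulo \<open>q - 1\<close>, of nonzero multiples of \<open>t\<close> to the power
  \<open>\<nu>\<^sub>0 + ... + \<nu>\<^sub>d\<^sub>-\<^sub>1\<close>. Hence the valuation is the least such sum, provided that the minimal chain is unique.

  With \<open>q = p ^ f\<close>, a number is viewed as a multiset of letters \<open>p ^ e\<close> taken from the digits of M, where
  only the numbers of letters with exponents in each class modulo f matter for its residue. These
  numbers are encoded by a vector of f carries. The cheapest choice of letters
  defines a cost of vectors that is injective and submodular, chains of numbers become strictly increasing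
  chains of vectors, and the greedy choice (from the top, always the cheapest vector in its box) is the only
  optimal one. Replacing an optimal chain of length \<open>d + 2\<close> and one of length d by their
  joins and meets gives two chains of length \<open>d + 1\<close>, so the minimal costs are strictly convex in d.

  The Newton polygon of the zeta function thus has only segments of horizontal length one. At a zero
  exactly two consecutive terms are dominant. After rescaling by their quotient, the zero is the fixed point of
  a contraction preserving the integral elements of the base field, and the quotient of the series
  by the linear factor has a single dominant term at the zero.
\<close>

section \<open>Optimal chains of carry vectors\<close>

text \<open>The main obstacle is a residue field that is not prime. For \<open>f = 1\<close> a
  vector is a single integer, and numbers with the prescribed residue are governed by one letter
  count. For \<open>f > 1\<close> several counts are tied together by one congruence, and
  componentwise minima and maxima of counts leave the residue class. Carries are coordinates in
  which the congruence holds by itself: only the inequalities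
  \<open>i (pre j) \<le> p * i j + z j\<close> remain, and these survive joins and meets. Digitwise
  inclusion is forgotten in the passage to vectors and recovered afterwards, since the vectors of an
  optimal chain turn out to have nested letter counts.

  A second obstacle is that the exponent is a p-adic integer, whereas the combinatorics works with a
  finite digit string. Coefficients below \<open>t ^ (p ^ N)\<close> see the exponent only modulo
  \<open>p ^ N\<close>, and such a truncation may offer too few letters for long chains. An
  inexhaustible padded alphabet gives a convex cost for every length, which is trusted only below
  \<open>p ^ N\<close>.\<close>

text \<open>\<open>l j\<close> lists the exponents of the available letters of class j in increasing order; by the gap condition
  every exponent is available at most \<open>p - 1\<close> times.\<close>

locale letters =
  fixes p f :: nat and l :: "nat \<Rightarrow> nat \<Rightarrow> nat"
  assumes p2: "2 \<le> p" and f1: "1 \<le> f"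
    and l_mono: "\<And>j a b. j < f \<Longrightarrow> a \<le> b \<Longrightarrow> l j a \<le> l j b"
    and l_mod: "\<And>j a. j < f \<Longrightarrow> l j a mod f = j"
    and l_gap: "\<And>j a. j < f \<Longrightarrow> l j a + f \<le> l j (a + (p - 1))"
begin

section \<open>Geometric bounds for the cheapest letters of a class\<close>

definition q :: int where "q = int p ^ f"

definition lsum :: "nat \<Rightarrow> nat \<Rightarrow> int" where "lsum j a = (\<Sum>k<a. int p ^ l j k)"

lemma lsum_0 [simp]: "lsum j 0 = 0" by (simp add: lsum_def)

lemma lsum_Suc: "lsum j (Suc a) = lsum j a + int p ^ l j a" by (simp add: lsum_def)

lemma lsum_add: "lsum j (a + b) = lsum j a + (\<Sum>k<b. int p ^ l j (a + k))"
  by (induction b) (auto simp: lsum_Suc)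

lemma lsum_mono: "a \<le> b \<Longrightarrow> lsum j a \<le> lsum j b"
  unfolding lsum_def by (intro sum_mono2) auto

lemma lsum_nonneg: "0 \<le> lsum j a"
  unfolding lsum_def by (intro sum_nonneg) auto

lemma q_ge: "int p \<le> q"
  using p2 f1 unfolding q_def by (metis Suc_le_eq power_increasing power_one_right int_ops(2) of_nat_le_iff le_trans one_le_numeral)

lemma p_pow_mono: "a \<le> b \<Longrightarrow> int p ^ a \<le> int p ^ b"
  using p2 by (intro power_increasing) auto

text \<open>By the gap condition the letter \<open>p - 1\<close> places further up the list has an
  exponent larger by at least \<open>f\<close>, so it costs at least \<open>q\<close> times as
  much.\<close>

lemma lsum_shift:
  assumes j: "j < f"
  shows "q * lsum j (b - (p - 1)) \<le> lsum j b"
proof (cases "b \<le> p - 1")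
  case True
  thus ?thesis by (simp add: lsum_nonneg)
next
  case False
  define c where "c = b - (p - 1)"
  have b: "b = (p - 1) + c" using False by (simp add: c_def)
  have "q * lsum j c = (\<Sum>k<c. int p ^ (l j k + f))"
    by (simp add: lsum_def q_def sum_distrib_left power_add mult.commute)
  also have "... \<le> (\<Sum>k<c. int p ^ l j ((p - 1) + k))"
    using l_gap[OF j] by (intro sum_mono p_pow_mono) (simp add: add.commute)
  also have "... \<le> lsum j b"
    unfolding b lsum_add using lsum_nonneg by simp
  finally show ?thesis by (simp add: c_def)
qed

text \<open>Geometric series: counted down from the top letter, a block of \<open>p - 1\<close>
  letters costs at most \<open>p - 1\<close> times its top, and the top of the next block is at
  least \<open>q\<close> times cheaper. The factor \<open>q / (q - 1)\<close> is the sum of the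
  powers of \<open>1 / q\<close>.\<close>

lemma lsum_less:
  assumes j: "j < f"
  shows "(q - 1) * lsum j (Suc b) < (int p - 1) * q * int p ^ l j b"
proof (induction b rule: less_induct)
  case (less b)
  have q1: "1 < q" using q_ge p2 by linarith
  have top: "lsum j (Suc b) \<le> lsum j (Suc b - (p - 1)) + (int p - 1) * int p ^ l j b"
  proof (cases "p - 1 \<le> Suc b")
    case True
    define c where "c = Suc b - (p - 1)"
    have b: "Suc b = c + (p - 1)" using True by (simp add: c_def)
    have "(\<Sum>k<p-1. int p ^ l j (c + k)) \<le> (\<Sum>k<p-1. int p ^ l j b)"
      using b j by (intro sum_mono p_pow_mono l_mono) auto
    also have "... = (int p - 1) * int p ^ l j b" using p2 by (simp add: of_nat_diff)
    finally show ?thesis unfolding c_def[symmetric] unfolding b lsum_add by simp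
  next
    case False
    have "lsum j (Suc b) \<le> (\<Sum>k<Suc b. int p ^ l j b)"
      unfolding lsum_def using j by (intro sum_mono p_pow_mono l_mono) auto
    also have "... = int (Suc b) * int p ^ l j b" by simp
    also have "... \<le> (int p - 1) * int p ^ l j b" using False
      by (intro mult_right_mono) auto
    finally show ?thesis using lsum_nonneg[of j "Suc b - (p-1)"] by linarith
  qed
  have ppos: "0 < (int p - 1) * int p ^ l j b" using p2 by simp
  have rest: "(q - 1) * lsum j (Suc b - (p - 1)) < (int p - 1) * int p ^ l j b"
  proof (cases "Suc b - (p - 1)")
    case 0
    thus ?thesis using ppos by simp
  next
    case (Suc c)
    hence cb: "c < b" "b = c + (p - 1)" using p2 by auto
    have "(q - 1) * lsum j (Suc c) < (int p - 1) * q * int p ^ l j c" by (rule less) fact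
    also have "... = (int p - 1) * int p ^ (l j c + f)" by (simp add: q_def power_add)
    also have "... \<le> (int p - 1) * int p ^ l j b"
      using l_gap[OF j, of c] cb p2 by (intro mult_left_mono p_pow_mono) auto
    finally show ?thesis using Suc by simp
  qed
  have "(q - 1) * lsum j (Suc b) \<le> (q - 1) * (lsum j (Suc b - (p - 1)) + (int p - 1) * int p ^ l j b)"
    using top q1 by (intro mult_left_mono) auto
  also have "... < (int p - 1) * int p ^ l j b + (q - 1) * ((int p - 1) * int p ^ l j b)"
    using rest by (simp add: distrib_left)
  also have "... = (int p - 1) * q * int p ^ l j b" by (simp add: algebra_simps)
  finally show ?case .
qed

lemma lsum_less':
  assumes j: "j < f" and "0 < b"
  shows "(q - 1) * lsum j b < (int p - 1) * q * int p ^ l j (b - 1)"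
  using lsum_less[OF j, of "b - 1"] assms(2) by simp

text \<open>Seen from class \<open>je\<close>, class \<open>j\<close> lies \<open>t j\<close> places
  ahead on the cycle modulo \<open>f\<close>, with \<open>1 \<le> t j < f\<close>. A letter of class
  \<open>j\<close> below \<open>e\<close> thus has exponent at most \<open>e + t j - f\<close>. The
  geometric bounds of the single classes add up to
  \<open>(p - 1) * (p + ... + p ^ (f - 1)) = q - p\<close>.\<close>

lemma others_bound:
  assumes je: "je < f" "e mod f = je"
    and b: "\<And>j. j < f \<Longrightarrow> j \<noteq> je \<Longrightarrow> 0 < b j \<Longrightarrow> l j (b j - 1) < e"
  shows "(q - 1) * (\<Sum>j\<in>{..<f} - {je}. lsum j (b j)) \<le> (q - int p) * int p ^ e"
proof -
  define t where "t j = (j + f - je) mod f" for j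
  have one: "(q - 1) * lsum j (b j) \<le> (int p - 1) * int p ^ t j * int p ^ e" if j: "j < f" "j \<noteq> je" for j
  proof (cases "b j = 0")
    case True thus ?thesis using p2 by simp
  next
    case False
    define E where "E = l j (b j - 1)"
    have E: "E < e" "E mod f = j" using b[OF j] False l_mod j by (auto simp: E_def)
    have "(e + t j) mod f = j"
    proof -
      have "(e + t j) mod f = (je + (j + f - je)) mod f"
        unfolding t_def using je by (metis mod_add_eq mod_mod_trivial)
      thus ?thesis using je j by simp
    qed
    hence "(e + t j) mod f = E mod f" using E by simp
    hence "f dvd e + t j - E" using E by (metis mod_eq_dvd_iff_nat less_imp_le_nat trans_le_add1)
    moreover have "0 < e + t j - E" using E by simp
    ultimately have "f \<le> e + t j - E" by (rule dvd_imp_le)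
    hence "E + f \<le> e + t j" using E by simp
    hence *: "q * int p ^ E \<le> int p ^ t j * int p ^ e"
      using p_pow_mono[of "E + f" "e + t j"] by (simp add: q_def power_add mult.commute)
    have "(q - 1) * lsum j (b j) \<le> (int p - 1) * (q * int p ^ E)"
      using lsum_less'[OF j(1), of "b j"] False by (simp add: E_def mult.assoc)
    also have "... \<le> (int p - 1) * (int p ^ t j * int p ^ e)"
      using * p2 by (intro mult_left_mono) auto
    finally show ?thesis by (simp add: mult.assoc)
  qed
  have "(q - 1) * (\<Sum>j\<in>{..<f} - {je}. lsum j (b j)) = (\<Sum>j\<in>{..<f} - {je}. (q - 1) * lsum j (b j))"
    by (rule sum_distrib_left)
  also have "... \<le> (\<Sum>j\<in>{..<f} - {je}. (int p - 1) * int p ^ t j * int p ^ e)"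
    using one by (intro sum_mono) auto
  also have "... = (\<Sum>j\<in>{..<f} - {je}. int p ^ t j) * ((int p - 1) * int p ^ e)"
    unfolding sum_distrib_right by (intro sum.cong) (auto simp: mult_ac)
  also have "(\<Sum>j\<in>{..<f} - {je}. int p ^ t j) = (\<Sum>s\<in>{1..<f}. int p ^ s)"
  proof (rule sum.reindex_bij_witness[of _ "\<lambda>s. (je + s) mod f" t])
    fix j assume "j \<in> {..<f} - {je}"
    hence j: "j < f" "j \<noteq> je" by auto
    show "(je + t j) mod f = j" using je j unfolding t_def
      by (simp add: mod_add_right_eq)
    show "t j \<in> {1..<f}"
    proof -
      have "t j \<noteq> 0"
      proof
        assume "t j = 0"
        hence "(je + t j) mod f = je" using je by simp
        thus False using \<open>(je + t j) mod f = j\<close> j by simp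
      qed
      thus ?thesis using je by (auto simp: t_def)
    qed
  next
    fix s assume "s \<in> {1..<f}"
    hence s: "1 \<le> s" "s < f" by auto
    show "t ((je + s) mod f) = s"
    proof (cases "je + s < f")
      case True thus ?thesis using je s by (simp add: t_def)
    next
      case False
      hence "(je + s) mod f = je + s - f" using je s by (simp add: mod_if)
      thus ?thesis using je s False by (simp add: t_def)
    qed
    thus "(je + s) mod f \<in> {..<f} - {je}" using je s by (auto simp: t_def)
  qed simp
  also have "(\<Sum>s\<in>{1..<f}. int p ^ s) * ((int p - 1) * int p ^ e) = (q - int p) * int p ^ e"
  proof -
    have "(\<Sum>s\<in>{1..<f}. int p ^ s) * (int p - 1) = int p ^ f - int p ^ 1"
      using f1
    proof (induction f rule: dec_induct)
      case (step n)
      thus ?case by (simp add: algebra_simps)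
    qed simp
    thus ?thesis by (simp add: q_def mult.assoc[symmetric])
  qed
  finally show ?thesis .
qed

lemma others_less:
  assumes je: "je < f" "e mod f = je"
    and b: "\<And>j. j < f \<Longrightarrow> j \<noteq> je \<Longrightarrow> 0 < b j \<Longrightarrow> l j (b j - 1) < e"
  shows "(\<Sum>j\<in>{..<f} - {je}. lsum j (b j)) < int p ^ e"
proof -
  have q1: "1 < q" using q_ge p2 by linarith
  have "(q - 1) * (\<Sum>j\<in>{..<f} - {je}. lsum j (b j)) \<le> (q - int p) * int p ^ e"
    by (rule others_bound[OF assms])
  also have "... < (q - 1) * int p ^ e"
    using p2 by (intro mult_strict_right_mono) auto
  finally show ?thesis using q1 by (simp add: mult_less_cancel_left)
qed

text \<open>The two bounds fit exactly: \<open>q * (q - p)\<close> from the other classes and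
  \<open>(p - 1) * q - (q - 1)\<close> from class \<open>je\<close> add up to
  \<open>(q - 1) ^ 2\<close>; strictness comes from class \<open>je\<close>. The weight
  \<open>q\<close> is \<open>q - 1\<close> for what the top of a chain may lose to the other
  classes, plus 1 for the series of losses below the top.\<close>

lemma others_weighted_bound:
  assumes je: "je < f" "l je k = e" "b je \<le> k"
    and b: "\<And>j. j < f \<Longrightarrow> j \<noteq> je \<Longrightarrow> 0 < b j \<Longrightarrow> l j (b j - 1) < e"
  shows "q * (\<Sum>j\<in>{..<f} - {je}. lsum j (b j)) + lsum je (b je) < (q - 1) * int p ^ e"
proof -
  have q1: "1 < q" using q_ge p2 by linarith
  have "e mod f = je" using l_mod je by auto
  note 1 = others_bound[OF je(1) this b]
  have "q * ((q - 1) * (\<Sum>j\<in>{..<f} - {je}. lsum j (b j))) \<le> q * ((q - int p) * int p ^ e)"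
    using 1 q1 by (intro mult_left_mono) auto
  moreover have "(q - 1) * (lsum je (b je) + int p ^ e) < (int p - 1) * q * int p ^ e"
  proof -
    have "(q - 1) * (lsum je (b je) + int p ^ e) \<le> (q - 1) * lsum je (Suc k)"
      using lsum_mono[OF je(3), of je] q1 je(2) by (intro mult_left_mono) (auto simp: lsum_Suc)
    thus ?thesis using lsum_less[OF je(1), of k] je(2) by simp
  qed
  ultimately have "(q - 1) * (q * (\<Sum>j\<in>{..<f} - {je}. lsum j (b j)) + lsum je (b je)) < (q - 1) * ((q - 1) * int p ^ e)"
    by (simp add: algebra_simps)
  thus ?thesis using q1 by (simp add: mult_less_cancel_left)
qed

end

section \<open>Carry vectors: lattice structure, letter counts and submodular cost\<close>

definition vmax :: "(nat \<Rightarrow> int) \<Rightarrow> (nat \<Rightarrow> int) \<Rightarrow> nat \<Rightarrow> int" where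
  "vmax x y = (\<lambda>j. max (x j) (y j))"

definition vmin :: "(nat \<Rightarrow> int) \<Rightarrow> (nat \<Rightarrow> int) \<Rightarrow> nat \<Rightarrow> int" where
  "vmin x y = (\<lambda>j. min (x j) (y j))"

text \<open>The vector i consists of the carries that reduce \<open>cnt i j\<close> letters of class j, for every j, to the
  base p digits \<open>z j\<close> of a fixed residue modulo \<open>q - 1\<close>.\<close>

locale paths = letters +
  fixes z :: "nat \<Rightarrow> nat"
begin

definition pre :: "nat \<Rightarrow> nat" where "pre j = (j + f - 1) mod f"

definition P :: "(nat \<Rightarrow> int) set" where
  "P = {i. (\<forall>j\<ge>f. i j = 0) \<and> (\<forall>j<f. 0 \<le> i j \<and> i (pre j) \<le> int p * i j + int (z j))}"

text \<open>The sum of \<open>cnt i j * p ^ j\<close> telescopes around the cycle to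
  \<open>(q - 1) * i (f - 1)\<close> plus the number with the digits \<open>z j\<close>, so every
  vector in \<open>P\<close> yields the prescribed residue.\<close>

definition cnt :: "(nat \<Rightarrow> int) \<Rightarrow> nat \<Rightarrow> nat" where
  "cnt i j = nat (int p * i j + int (z j) - i (pre j))"

definition cost :: "(nat \<Rightarrow> int) \<Rightarrow> int" where
  "cost i = (\<Sum>j<f. lsum j (cnt i j))"

lemma pre_less [simp]: "pre j < f"
  using f1 by (simp add: pre_def)

lemma pre_inj: "j < f \<Longrightarrow> j' < f \<Longrightarrow> pre j = pre j' \<Longrightarrow> j = j'"
proof -
  have *: "pre j = (if j = 0 then f - 1 else j - 1)" if "j < f" for j
    using that by (auto simp: pre_def mod_if)
  assume "j < f" "j' < f" "pre j = pre j'"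
  thus ?thesis using * [of j] *[of j'] by (auto split: if_splits)
qed

lemma int_cnt: "i \<in> P \<Longrightarrow> j < f \<Longrightarrow> int (cnt i j) = int p * i j + int (z j) - i (pre j)"
  by (auto simp: P_def cnt_def)

lemma P_I:
  assumes "\<And>j. j \<ge> f \<Longrightarrow> i j = 0" "\<And>j. j < f \<Longrightarrow> 0 \<le> i j"
    "\<And>j. j < f \<Longrightarrow> i (pre j) \<le> int p * i j + int (z j)"
  shows "i \<in> P"
  using assms by (auto simp: P_def)

lemma P_D:
  assumes "i \<in> P"
  shows "j \<ge> f \<Longrightarrow> i j = 0" "0 \<le> i j" "j < f \<Longrightarrow> i (pre j) \<le> int p * i j + int (z j)"
  using assms by (cases "j < f"; auto simp: P_def)+

lemma P_eqI:
  assumes "x \<in> P" "y \<in> P" "\<And>j. j < f \<Longrightarrow> x j = y j"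
  shows "x = y"
proof
  fix j show "x j = y j" using assms P_D(1)[OF assms(1), of j] P_D(1)[OF assms(2), of j] by (cases "j < f") auto
qed

lemma p_mono: "a \<le> b \<Longrightarrow> int p * a \<le> int p * b"
  by (intro mult_left_mono) auto

lemma P_vmax: "x \<in> P \<Longrightarrow> y \<in> P \<Longrightarrow> vmax x y \<in> P"
proof (rule P_I)
  fix j assume *: "x \<in> P" "y \<in> P" "j < f"
  show "vmax x y (pre j) \<le> int p * vmax x y j + int (z j)"
    using P_D(3)[OF *(1,3)] P_D(3)[OF *(2,3)] p_mono[of "x j" "max (x j) (y j)"] p_mono[of "y j" "max (x j) (y j)"]
    by (simp add: vmax_def)
qed (auto simp: vmax_def P_D(1) P_D(2) le_max_iff_disj)

lemma P_vmin: "x \<in> P \<Longrightarrow> y \<in> P \<Longrightarrow> vmin x y \<in> P"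
proof (rule P_I)
  fix j assume *: "x \<in> P" "y \<in> P" "j < f"
  show "vmin x y (pre j) \<le> int p * vmin x y j + int (z j)"
    using P_D(3)[OF *(1,3)] P_D(3)[OF *(2,3)]
    by (cases "x j \<le> y j") (auto simp: vmin_def min_def)
qed (auto simp: vmin_def P_D(1) P_D(2))

lemma lsum_convex:
  assumes j: "j < f" and ab: "a + d = b + c" "a \<le> b" "a \<le> c"
  shows "lsum j b + lsum j c \<le> lsum j a + lsum j d"
proof -
  define s where "s = b - a"
  have s: "b = a + s" "d = c + s" using ab by (auto simp: s_def)
  have "(\<Sum>k<s. int p ^ l j (a + k)) \<le> (\<Sum>k<s. int p ^ l j (c + k))"
    using j ab by (intro sum_mono p_pow_mono l_mono) auto
  thus ?thesis unfolding s lsum_add by simp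
qed

lemma lsum_convex':
  assumes j: "j < f" and "int a + int d = int b + int c"
    "int a \<le> int b \<and> int b \<le> int d \<or> int d \<le> int b \<and> int b \<le> int a"
  shows "lsum j b + lsum j c \<le> lsum j a + lsum j d"
  using lsum_convex[OF j, of a d b c] lsum_convex[OF j, of d a b c] assms(2,3) by linarith

text \<open>Class by class, only the coordinates \<open>j\<close> and \<open>pre j\<close> matter.
  If x and y are ordered alike in both, meet and join merely permute the two counts. Otherwise the
  counts of meet and join have the same sum and lie between those of x and y, and convexity of
  \<open>lsum j\<close> applies.\<close>

lemma cost_submod:
  assumes x: "x \<in> P" and y: "y \<in> P"
  shows "cost (vmin x y) + cost (vmax x y) \<le> cost x + cost y"
proof -
  have "lsum j (cnt (vmin x y) j) + lsum j (cnt (vmax x y) j) \<le> lsum j (cnt x j) + lsum j (cnt y j)" if j: "j < f" for j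
  proof -
    define mn where "mn = vmin x y"
    define mx where "mx = vmax x y"
    have mn: "mn j = min (x j) (y j)" "mn (pre j) = min (x (pre j)) (y (pre j))"
      and mx: "mx j = max (x j) (y j)" "mx (pre j) = max (x (pre j)) (y (pre j))"
      by (auto simp: mn_def mx_def vmin_def vmax_def)
    note c = int_cnt[OF x j] int_cnt[OF y j] int_cnt[OF P_vmin[OF x y] j, folded mn_def] int_cnt[OF P_vmax[OF x y] j, folded mx_def]
    show ?thesis unfolding mn_def[symmetric] mx_def[symmetric]
    proof (cases "(x j \<le> y j) = (x (pre j) \<le> y (pre j))")
      case True
      hence "int (cnt mn j) = int (cnt x j) \<and> int (cnt mx j) = int (cnt y j) \<or> int (cnt mn j) = int (cnt y j) \<and> int (cnt mx j) = int (cnt x j)"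
        unfolding c mn mx by (auto simp: min_def max_def)
      thus "lsum j (cnt mn j) + lsum j (cnt mx j) \<le> lsum j (cnt x j) + lsum j (cnt y j)" by auto
    next
      case False
      show "lsum j (cnt mn j) + lsum j (cnt mx j) \<le> lsum j (cnt x j) + lsum j (cnt y j)"
      proof (rule lsum_convex'[OF j]; unfold c mn mx)
        show "int p * x j + int (z j) - x (pre j) + (int p * y j + int (z j) - y (pre j)) =
          int p * min (x j) (y j) + int (z j) - min (x (pre j)) (y (pre j)) +
          (int p * max (x j) (y j) + int (z j) - max (x (pre j)) (y (pre j)))"
          by (auto simp: min_def max_def)
      qed (use False p_mono[of "x j" "y j"] p_mono[of "y j" "x j"] in \<open>auto simp: min_def max_def\<close>)
    qed
  qed
  hence "(\<Sum>j<f. lsum j (cnt (vmin x y) j) + lsum j (cnt (vmax x y) j)) \<le> (\<Sum>j<f. lsum j (cnt x j) + lsum j (cnt y j))"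
    by (intro sum_mono) auto
  thus ?thesis by (simp add: cost_def sum.distrib)
qed

text \<open>At a coordinate where the vectors differ most, equal counts make the difference at
  \<open>pre j\<close> exactly \<open>p\<close> times as large, which is possible only if the
  difference is 0.\<close>

lemma cnt_inj:
  assumes x: "x \<in> P" and y: "y \<in> P" and eq: "\<And>j. j < f \<Longrightarrow> cnt x j = cnt y j"
  shows "x = y"
proof -
  define D where "D j = \<bar>x j - y j\<bar>" for j
  define m where "m = Max (D ` {..<f})"
  have fin: "finite (D ` {..<f})" "D ` {..<f} \<noteq> {}" using f1 by (auto simp: lessThan_empty_iff)
  obtain j where j: "j < f" "D j = m" using Max_in[OF fin] by (auto simp: m_def)
  have le: "D j' \<le> m" if "j' < f" for j' unfolding m_def using that fin by (intro Max_ge) auto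
  have "int p * (x j - y j) = x (pre j) - y (pre j)"
    using int_cnt[OF x j(1)] int_cnt[OF y j(1)] eq[OF j(1)] by (simp add: algebra_simps)
  hence "int p * D j = D (pre j)"
    unfolding D_def by (metis abs_mult abs_of_nat)
  hence "int p * m \<le> m" using le[of "pre j"] j by simp
  hence "2 * m \<le> m" if "m > 0" using that p2 mult_right_mono[of 2 "int p" m] by simp
  hence "m \<le> 0" by fastforce
  hence "D j \<le> 0" if "j < f" for j using le[OF that] by linarith
  thus ?thesis by (intro P_eqI[OF x y]) (auto simp: D_def)
qed

section \<open>Comparison of costs by a dominating letter, and exchange arguments\<close>

lemma cost_gain:
  assumes je: "je < f" and lt: "cnt x je < cnt y je"
  shows "int p ^ l je (cnt y je - 1) - (\<Sum>j\<in>{..<f} - {je}. lsum j (if cnt y j < cnt x j then cnt x j else 0)) \<le> cost y - cost x"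
proof -
  have "cost y - cost x = (\<Sum>j<f. lsum j (cnt y j) - lsum j (cnt x j))"
    by (simp add: cost_def sum_subtractf)
  also have "... = (lsum je (cnt y je) - lsum je (cnt x je)) + (\<Sum>j\<in>{..<f} - {je}. lsum j (cnt y j) - lsum j (cnt x j))"
    using je by (intro sum.remove) auto
  also have "(\<Sum>j\<in>{..<f} - {je}. lsum j (cnt y j) - lsum j (cnt x j)) \<ge> (\<Sum>j\<in>{..<f} - {je}. - lsum j (if cnt y j < cnt x j then cnt x j else 0))"
  proof (intro sum_mono)
    fix j show "- lsum j (if cnt y j < cnt x j then cnt x j else 0) \<le> lsum j (cnt y j) - lsum j (cnt x j)"
      using lsum_nonneg[of j "cnt y j"] lsum_mono[of "cnt x j" "cnt y j" j] by auto
  qed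
  moreover have "lsum je (cnt x je) + int p ^ l je (cnt y je - 1) \<le> lsum je (cnt y je)"
    using lsum_mono[of "cnt x je" "cnt y je - 1" je] lsum_Suc[of je "cnt y je - 1"] lt by simp
  ultimately show ?thesis by (simp add: sum_negf)
qed

text \<open>The most expensive letter in which two vectors differ decides which of them costs more.\<close>

definition top_at :: "(nat \<Rightarrow> int) \<Rightarrow> (nat \<Rightarrow> int) \<Rightarrow> nat \<Rightarrow> bool" where
  "top_at x y je \<longleftrightarrow> je < f \<and> cnt x je < cnt y je \<and>
     (\<forall>j<f. j \<noteq> je \<longrightarrow> cnt x j \<noteq> cnt y j \<longrightarrow> l j (max (cnt x j) (cnt y j) - 1) < l je (cnt y je - 1))"

lemma cost_lessI:
  assumes je: "je < f" "cnt x je < cnt y je"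
    and less: "\<And>j. j < f \<Longrightarrow> j \<noteq> je \<Longrightarrow> cnt y j < cnt x j \<Longrightarrow> l j (cnt x j - 1) < l je (cnt y je - 1)"
  shows "cost x < cost y"
proof -
  have "(\<Sum>j\<in>{..<f} - {je}. lsum j (if cnt y j < cnt x j then cnt x j else 0)) < int p ^ l je (cnt y je - 1)"
    by (rule others_less) (use je less in \<open>auto simp: l_mod split: if_splits\<close>)
  thus ?thesis using cost_gain[OF je] by linarith
qed

lemma top_at_less: "top_at x y je \<Longrightarrow> cost x < cost y"
  by (rule cost_lessI[of je]) (auto simp: top_at_def max_def)

text \<open>An exponent determines its class modulo \<open>f\<close>, so letters of different
  classes never have equal exponents, and the largest exponent in dispute belongs to one class
  only.\<close>

lemma top_at_cases:
  assumes x: "x \<in> P" and y: "y \<in> P" and "x \<noteq> y"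
  shows "\<exists>je. top_at x y je \<or> top_at y x je"
proof -
  define D where "D = {j. j < f \<and> cnt x j \<noteq> cnt y j}"
  define t where "t j = l j (max (cnt x j) (cnt y j) - 1)" for j
  have fin: "finite (t ` D)" "t ` D \<noteq> {}" using cnt_inj[OF x y] assms(3) by (auto simp: D_def)
  obtain je where je: "je \<in> D" "t je = Max (t ` D)" using Max_in[OF fin] by auto
  have "t j < t je" if "j \<in> D" "j \<noteq> je" for j
  proof -
    have "t j \<le> t je" using fin that je by auto
    moreover have "t j mod f = j" "t je mod f = je" using that je(1) by (auto simp: D_def t_def l_mod)
    ultimately show ?thesis using that(2) by (metis le_neq_implies_less)
  qed
  note less = this
  show ?thesis
  proof (cases "cnt x je < cnt y je")
    case True
    hence "max (cnt x je) (cnt y je) = cnt y je" by simp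
    hence "top_at x y je" using je(1) less True unfolding D_def t_def top_at_def by auto
    thus ?thesis by blast
  next
    case False
    hence "max (cnt x je) (cnt y je) = cnt x je" by simp
    hence "top_at y x je" using je(1) less False unfolding D_def t_def top_at_def by (auto simp: max.commute)
    thus ?thesis by blast
  qed
qed

lemma cost_inj: "x \<in> P \<Longrightarrow> y \<in> P \<Longrightarrow> cost x = cost y \<Longrightarrow> x = y"
  using top_at_cases top_at_less by fastforce

lemma cost_less_top: "x \<in> P \<Longrightarrow> y \<in> P \<Longrightarrow> cost x < cost y \<Longrightarrow> \<exists>je. top_at x y je"
  using top_at_cases[of x y] top_at_less[of y x] by fastforce

lemma cost_nonneg: "0 \<le> cost x"
  unfolding cost_def by (intro sum_nonneg lsum_nonneg)

text \<open>\<open>s\<close> is the greatest admissible vector below \<open>U - c\<close>, found as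
  the one closest to it. If \<open>s\<close> has a letter of class \<open>j\<close>, that letter
  could be spent to raise \<open>s (pre j)\<close> by one, so this entry must already meet its
  bound. Inserting this into \<open>cnt s j\<close> shows a saving of \<open>c * (p - 1)\<close>
  letters against \<open>U\<close>.\<close>

lemma floor_elt:
  assumes U: "U \<in> P" and c: "\<And>j. j < f \<Longrightarrow> int c \<le> U j"
  obtains s where "s \<in> P" "\<And>j. j < f \<Longrightarrow> s j \<le> U j - int c"
    "\<And>x j. x \<in> P \<Longrightarrow> (\<And>j. j < f \<Longrightarrow> x j \<le> U j - int c) \<Longrightarrow> j < f \<Longrightarrow> x j \<le> s j"
    "\<And>j. j < f \<Longrightarrow> cnt s j \<le> cnt U j - c * (p - 1)"
    "\<And>j. j < f \<Longrightarrow> 0 < cnt s j \<Longrightarrow> s (pre j) = U (pre j) - int c"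
proof -
  define A where "A = {x \<in> P. \<forall>j<f. x j \<le> U j - int c}"
  define m where "m x = nat (\<Sum>j<f. U j - int c - x j)" for x
  have "(\<lambda>_. 0) \<in> A" using c by (auto simp: A_def P_def)
  then obtain s where s: "s \<in> A" "\<And>x. x \<in> A \<Longrightarrow> m s \<le> m x"
    using ex_has_least_nat[of "\<lambda>x. x \<in> A" _ m] by blast
  have sP: "s \<in> P" and sU: "\<And>j. j < f \<Longrightarrow> s j \<le> U j - int c" using s(1) by (auto simp: A_def)
  have strict: False if "x \<in> A" "\<And>j. j < f \<Longrightarrow> s j \<le> x j" "j0 < f" "s j0 < x j0" for x j0
  proof -
    have "(\<Sum>j<f. U j - int c - x j) < (\<Sum>j<f. U j - int c - s j)"
      using that by (intro sum_strict_mono_ex1) auto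
    moreover have "0 \<le> (\<Sum>j<f. U j - int c - x j)" using that(1) by (intro sum_nonneg) (auto simp: A_def)
    ultimately have "m x < m s" by (simp add: m_def)
    thus False using s(2)[OF that(1)] by simp
  qed
  have great: "x j \<le> s j" if x: "x \<in> P" "\<And>j. j < f \<Longrightarrow> x j \<le> U j - int c" and j: "j < f" for x j
  proof (rule ccontr)
    assume "\<not> x j \<le> s j"
    moreover have "vmax s x \<in> A" using x sP sU by (auto simp: A_def P_vmax) (auto simp: vmax_def)
    ultimately show False using strict[of "vmax s x" j] j by (auto simp: vmax_def)
  qed
  have tight: "s (pre j) = U (pre j) - int c" if j: "j < f" "0 < cnt s j" for j
  proof (rule ccontr)
    assume "s (pre j) \<noteq> U (pre j) - int c"
    hence lt: "s (pre j) < U (pre j) - int c" using sU[of "pre j"] by simp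
    define x where "x = s(pre j := s (pre j) + 1)"
    have "x \<in> P"
    proof (rule P_I)
      fix k assume k: "k < f"
      have le: "s k \<le> x k" by (simp add: x_def)
      show "x (pre k) \<le> int p * x k + int (z k)"
      proof (cases "pre k = pre j")
        case True
        hence "k = j" using pre_inj k j by blast
        thus ?thesis using int_cnt[OF sP j(1)] j(2) p_mono[OF le] by (simp add: x_def)
      next
        case False
        thus ?thesis using P_D(3)[OF sP k] p_mono[OF le] by (simp add: x_def)
      qed
    next
      fix k assume "f \<le> k" thus "x k = 0"
        using P_D(1)[OF sP, of k] pre_less[of j] by (auto simp: x_def simp del: pre_less)
    qed (use P_D(2)[OF sP] in \<open>auto simp: x_def intro: add_nonneg_nonneg\<close>)
    hence "x \<in> A" using sU lt by (auto simp: A_def x_def)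
    thus False by (rule strict[of x "pre j"]) (auto simp: x_def)
  qed
  have low: "cnt s j \<le> cnt U j - c * (p - 1)" if j: "j < f" for j
  proof (cases "cnt s j = 0")
    case False
    have "int (cnt s j) \<le> int (cnt U j) - int c * (int p - 1)"
      using int_cnt[OF sP j] int_cnt[OF U j] tight[OF j] False p_mono[OF sU[OF j]]
      by (simp add: algebra_simps)
    also have "... = int (cnt U j) - int (c * (p - 1))" using p2 by (simp add: of_nat_diff)
    finally show ?thesis by linarith
  qed simp
  show ?thesis by (rule that[OF sP]) (use sU great low tight in blast)+
qed

text \<open>If \<open>U\<close> held a letter of class \<open>j\<close> above the dominating one,
  some vector \<open>V = U + \<kappa>\<close> between \<open>U\<close> and \<open>U'\<close> would
  use fewer letters of class \<open>j\<close> and elsewhere add only letters that \<open>U'\<close>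
  adds as well. These are no dearer than the dominating letter, so \<open>V\<close> would be cheaper
  than the minimal \<open>U\<close>.\<close>

lemma letters_below_top:
  assumes U: "U \<in> P" and U': "U' \<in> P" and le: "\<And>j. j < f \<Longrightarrow> U j \<le> U' j"
    and top: "top_at U U' je"
    and min: "\<And>x. x \<in> P \<Longrightarrow> (\<And>j. j < f \<Longrightarrow> U j \<le> x j \<and> x j \<le> U' j) \<Longrightarrow> cost U \<le> cost x"
    and j: "j < f" and lt: "U (pre j) < U' (pre j)" and pos: "0 < cnt U j"
  shows "l j (cnt U j - 1) \<le> l je (cnt U' je - 1)"
proof (rule ccontr)
  define E where "E = l je (cnt U' je - 1)"
  assume "\<not> l j (cnt U j - 1) \<le> l je (cnt U' je - 1)"
  hence gt: "E < l j (cnt U j - 1)" by (simp add: E_def)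
  have je: "je < f" "cnt U je < cnt U' je" using top by (auto simp: top_at_def)
  have diff: "l i (max (cnt U i) (cnt U' i) - 1) \<le> E" if "i < f" "cnt U i \<noteq> cnt U' i" for i
    using that top je unfolding top_at_def E_def by (cases "i = je") (auto simp: max_def less_imp_le)
  have eqj: "cnt U j = cnt U' j"
  proof (rule ccontr)
    assume "cnt U j \<noteq> cnt U' j"
    hence "l j (max (cnt U j) (cnt U' j) - 1) \<le> E" by (rule diff[OF j])
    moreover have "l j (cnt U j - 1) \<le> l j (max (cnt U j) (cnt U' j) - 1)"
      using j by (intro l_mono) auto
    ultimately show False using gt by simp
  qed
  define \<Delta> where "\<Delta> i = U' i - U i" for i
  define g where "g i = max 0 (int (cnt U' i) - int (cnt U i))" for i
  have \<Delta>0: "0 \<le> \<Delta> i" if "i < f" for i using le[OF that] by (simp add: \<Delta>_def)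
  have \<Delta>g: "int p * \<Delta> i - g i \<le> \<Delta> (pre i)" if "i < f" for i
    using int_cnt[OF U that] int_cnt[OF U' that] by (auto simp: g_def \<Delta>_def max_def algebra_simps)
  have \<Delta>j: "int p * \<Delta> j = \<Delta> (pre j)"
    using int_cnt[OF U j] int_cnt[OF U' j] eqj by (auto simp: \<Delta>_def algebra_simps)
  \<comment> \<open>The bounds demand at least one letter fewer in class \<open>j\<close> and at
    most \<open>g i\<close> new letters in any other class. That no class loses more letters than it
    has is not demanded: it follows for a member with least coordinate sum, because an entry that
    causes such a loss could be lowered by one.\<close>
  define K where "K = {\<kappa>. (\<forall>i\<ge>f. \<kappa> i = 0) \<and> (\<forall>i<f. 0 \<le> \<kappa> i \<and> \<kappa> i \<le> \<Delta> i) \<and>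
     int p * \<kappa> j + 1 \<le> \<kappa> (pre j) \<and> (\<forall>i<f. i \<noteq> j \<longrightarrow> int p * \<kappa> i - g i \<le> \<kappa> (pre i))}"
  \<comment> \<open>\<open>\<Delta>\<close> itself leaves the count of class \<open>j\<close>
    unchanged. Lowering its positive entries by one makes this count drop by
    \<open>p - 1 \<ge> 1\<close>.\<close>
  define \<kappa>0 where "\<kappa>0 i = (if i < f then max 0 (\<Delta> i - 1) else 0)" for i
  have "\<kappa>0 \<in> K"
  proof -
    have "1 \<le> \<Delta> (pre j)" using lt by (simp add: \<Delta>_def)
    hence "\<Delta> j \<noteq> 0" using \<Delta>j by auto
    hence dj: "1 \<le> \<Delta> j" using \<Delta>0[OF j] by simp
    hence "int p * \<kappa>0 j + 1 \<le> \<kappa>0 (pre j)"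
      using \<Delta>j j p2 by (simp add: \<kappa>0_def max_def algebra_simps)
    moreover have "int p * \<kappa>0 i - g i \<le> \<kappa>0 (pre i)" if "i < f" for i
    proof (cases "\<Delta> i = 0")
      case True thus ?thesis using that by (auto simp: \<kappa>0_def g_def)
    next
      case False
      hence "1 \<le> \<Delta> i" using \<Delta>0[OF that] by simp
      hence "int p * \<kappa>0 i = int p * \<Delta> i - int p" using that by (simp add: \<kappa>0_def algebra_simps)
      thus ?thesis using \<Delta>g[OF that] p2 by (simp add: \<kappa>0_def)
    qed
    ultimately show ?thesis using \<Delta>0 by (auto simp: K_def) (auto simp: \<kappa>0_def)
  qed
  define m where "m x = nat (\<Sum>i<f. x i)" for x :: "nat \<Rightarrow> int"
  obtain \<kappa> where \<kappa>: "\<kappa> \<in> K" "\<And>x. x \<in> K \<Longrightarrow> m \<kappa> \<le> m x"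
    using ex_has_least_nat[of "\<lambda>x. x \<in> K" _ m] \<open>\<kappa>0 \<in> K\<close> by blast
  note kK = \<kappa>(1)[unfolded K_def mem_Collect_eq]
  have low: "\<kappa> (pre i) \<le> int (cnt U i) + int p * \<kappa> i" if i: "i < f" for i
  proof (rule ccontr)
    assume neg: "\<not> \<kappa> (pre i) \<le> int (cnt U i) + int p * \<kappa> i"
    have ki: "0 \<le> int p * \<kappa> i" using kK i by auto
    define x where "x = \<kappa>(pre i := \<kappa> (pre i) - 1)"
    have "x \<in> K"
    proof -
      have le: "int p * x a \<le> int p * \<kappa> a" for a by (intro p_mono) (auto simp: x_def)
      have 1: "x a = 0" if "f \<le> a" for a
        using kK that pre_less[of i] by (auto simp: x_def simp del: pre_less)
      have 2: "0 \<le> x a \<and> x a \<le> \<Delta> a" if "a < f" for a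
      proof -
        have "0 \<le> \<kappa> a \<and> \<kappa> a \<le> \<Delta> a" using kK that by auto
        thus ?thesis using neg ki by (auto simp: x_def)
      qed
      have 3: "int p * x j + 1 \<le> x (pre j)"
      proof (cases "pre j = pre i")
        case True
        hence "i = j" using pre_inj i j by auto
        thus ?thesis using neg pos le[of j] by (auto simp: x_def)
      next
        case False
        thus ?thesis using kK le[of j] by (auto simp: x_def)
      qed
      have 4: "int p * x a - g a \<le> x (pre a)" if "a < f" "a \<noteq> j" for a
      proof (cases "pre a = pre i")
        case True
        hence "a = i" using pre_inj i that by auto
        moreover have "0 \<le> g i" by (simp add: g_def)
        ultimately show ?thesis using neg le[of a] by (auto simp: x_def)
      next
        case False
        have "int p * \<kappa> a - g a \<le> \<kappa> (pre a)" using kK that by blast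
        thus ?thesis using le[of a] False by (auto simp: x_def)
      qed
      show ?thesis unfolding K_def using 1 2 3 4 by blast
    qed
    moreover have "m x < m \<kappa>"
    proof -
      have "(\<Sum>a<f. x a) < (\<Sum>a<f. \<kappa> a)"
        by (intro sum_strict_mono_ex1) (auto simp: x_def intro!: bexI[of _ "pre i"])
      moreover have "0 \<le> (\<Sum>a<f. x a)" using \<open>x \<in> K\<close> by (intro sum_nonneg) (auto simp: K_def)
      ultimately show ?thesis by (simp add: m_def)
    qed
    ultimately show False using \<kappa>(2) by force
  qed
  define V where "V i = U i + \<kappa> i" for i
  have VP: "V \<in> P"
  proof (rule P_I)
    fix i assume "f \<le> i" thus "V i = 0" using kK P_D(1)[OF U] by (auto simp: V_def)
  next
    fix i assume i: "i < f"
    show "0 \<le> V i" using kK P_D(2)[OF U] i by (auto simp: V_def)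
    show "V (pre i) \<le> int p * V i + int (z i)"
      using low[OF i] int_cnt[OF U i] by (simp add: V_def algebra_simps)
  qed
  have cV: "int (cnt V i) = int (cnt U i) + int p * \<kappa> i - \<kappa> (pre i)" if "i < f" for i
    using int_cnt[OF U that] int_cnt[OF VP that] by (simp add: V_def algebra_simps)
  have "cnt V j < cnt U j" using cV[OF j] kK by linarith
  have "cost V < cost U"
  proof (rule cost_lessI[of j])
    show "j < f" "cnt V j < cnt U j" by fact+
    fix i assume i: "i < f" "i \<noteq> j" "cnt U i < cnt V i"
    have "int p * \<kappa> i - g i \<le> \<kappa> (pre i)" using kK i by auto
    hence "int (cnt V i) \<le> int (cnt U i) + g i" using cV[OF i(1)] by simp
    hence 1: "cnt V i \<le> cnt U' i" "cnt U i \<noteq> cnt U' i" using i(3) by (auto simp: g_def)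
    hence "l i (cnt V i - 1) \<le> l i (max (cnt U i) (cnt U' i) - 1)"
      using i by (intro l_mono) auto
    thus "l i (cnt V i - 1) < l j (cnt U j - 1)" using diff[OF i(1) 1(2)] gt by simp
  qed
  moreover have "cost U \<le> cost V" using kK VP by (intro min) (auto simp: V_def \<Delta>_def)
  ultimately show False by simp
qed

section \<open>Chains of vectors and the greedy choice of their tops\<close>

definition chain :: "nat \<Rightarrow> (nat \<Rightarrow> nat \<Rightarrow> int) \<Rightarrow> bool" where
  "chain d u \<longleftrightarrow> (\<forall>k<d. u k \<in> P) \<and> (\<forall>k j. Suc k < d \<longrightarrow> j < f \<longrightarrow> u k j < u (Suc k) j)"

definition ccost :: "nat \<Rightarrow> (nat \<Rightarrow> nat \<Rightarrow> int) \<Rightarrow> int" where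
  "ccost d u = (\<Sum>k<d. cost (u k))"

text \<open>The lower bound is the one that member \<open>n\<close> of a chain satisfies
  automatically: \<open>n\<close> strict integral steps precede it, starting from nonnegative
  entries.\<close>

definition box :: "nat \<Rightarrow> (nat \<Rightarrow> int) \<Rightarrow> (nat \<Rightarrow> int) set" where
  "box n B = {i \<in> P. \<forall>j<f. int n \<le> i j \<and> i j \<le> B j}"

lemma chain_gap:
  assumes "chain d u" "k \<le> k'" "k' < d" "j < f"
  shows "u k j + int (k' - k) \<le> u k' j"
  using assms(2,3)
proof (induction k' rule: dec_induct)
  case (step m)
  have "u m j < u (Suc m) j" using assms step by (auto simp: chain_def)
  thus ?case using step by (simp add: Suc_diff_le)
qed simp

lemma chain_P: "chain d u \<Longrightarrow> k < d \<Longrightarrow> u k \<in> P"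
  by (auto simp: chain_def)

lemma chain_ge: "chain d u \<Longrightarrow> k < d \<Longrightarrow> j < f \<Longrightarrow> int k \<le> u k j"
  using chain_gap[of d u 0 k j] P_D(2)[OF chain_P, of d u 0 j] by simp

text \<open>The powers \<open>1 / q ^ c\<close> with \<open>c \<ge> 1\<close> sum to
  \<open>1 / (q - 1)\<close>. The induction keeps the remainder after the last shift on the left,
  which is what lets the next shift be absorbed.\<close>

lemma lsum_shift_sum:
  assumes j: "j < f"
  shows "(q - 1) * (\<Sum>k<n. lsum j (b - (n - k) * (p - 1))) \<le> lsum j b"
proof -
  have "(q - 1) * (\<Sum>c<n. lsum j (b - Suc c * (p - 1))) + lsum j (b - n * (p - 1)) \<le> lsum j b"
  proof (induction n)
    case (Suc n)
    have "q * lsum j (b - n * (p - 1) - (p - 1)) \<le> lsum j (b - n * (p - 1))" by (rule lsum_shift[OF j])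
    moreover have "b - n * (p - 1) - (p - 1) = b - Suc n * (p - 1)" by simp
    ultimately show ?case using Suc by (simp add: algebra_simps)
  qed simp
  moreover have "(\<Sum>k<n. lsum j (b - (n - k) * (p - 1))) = (\<Sum>c<n. lsum j (b - Suc c * (p - 1)))"
    using sum.nat_diff_reindex[of "\<lambda>c. lsum j (b - Suc c * (p - 1))" n]
    by (simp add: Suc_diff_Suc)
  ultimately show ?thesis using lsum_nonneg[of j "b - n * (p - 1)"] by simp
qed

text \<open>Joining the top with \<open>U\<close> keeps the chain strict. The meet stays in the box
  and so costs at least as much as \<open>U\<close>; submodularity then bounds the cost of the join
  by that of the old top, and injectivity of the cost makes the gain strict.\<close>

lemma chain_improve_sup:
  assumes ch: "chain (Suc n) u" and bd: "\<And>j. j < f \<Longrightarrow> u n j \<le> B j"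
    and U: "U \<in> box n B" and min: "\<And>x. x \<in> box n B \<Longrightarrow> cost U \<le> cost x"
    and nle: "j0 < f" "u n j0 < U j0"
  shows "\<exists>v. chain (Suc n) v \<and> (\<forall>j<f. v n j \<le> B j) \<and> ccost (Suc n) v < ccost (Suc n) u"
proof (intro exI conjI allI impI)
  let ?v = "u(n := vmax U (u n))"
  have UP: "U \<in> P" using U by (simp add: box_def)
  have u: "u n \<in> P" using chain_P[OF ch] by simp
  show "chain (Suc n) ?v" using ch P_vmax[OF UP u] by (auto simp: chain_def vmax_def less_max_iff_disj)
  show "?v n j \<le> B j" if "j < f" for j using that bd U by (auto simp: box_def vmax_def)
  have "vmin U (u n) \<in> box n B" using U P_vmin[OF UP u] chain_ge[OF ch, of n]
    by (auto simp: box_def vmin_def min_le_iff_disj)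
  hence "cost (vmax U (u n)) \<le> cost (u n)" using min cost_submod[OF UP u] by force
  moreover have "vmax U (u n) \<noteq> u n" using nle by (auto simp: vmax_def fun_eq_iff max_def intro!: exI[of _ j0])
  ultimately have "cost (vmax U (u n)) < cost (u n)" using cost_inj[OF P_vmax[OF UP u] u] by linarith
  thus "ccost (Suc n) ?v < ccost (Suc n) u" by (simp add: ccost_def)
qed

text \<open>If the top of a chain lies above U, it is replaced by U, and the members below by their meets with the
  greatest vectors below \<open>U - (n - k)\<close>. Such a vector has at least \<open>(n - k) (p - 1)\<close> letters of each class
  fewer than U, and is thus cheaper by a factor of about \<open>q ^ (n - k)\<close>, so what the replacement adds below the top is
  a geometric series dominated by what it saves at the top.\<close>

lemma chain_improve:
  assumes ch: "chain (Suc n) u" and bd: "\<And>j. j < f \<Longrightarrow> u n j \<le> B j"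
    and U: "U \<in> box n B" and min: "\<And>x. x \<in> box n B \<Longrightarrow> cost U \<le> cost x"
    and ne: "u n \<noteq> U"
  shows "\<exists>v. chain (Suc n) v \<and> (\<forall>j<f. v n j \<le> B j) \<and> ccost (Suc n) v < ccost (Suc n) u"
proof (cases "\<forall>j<f. U j \<le> u n j")
  case False
  then obtain j0 where j0: "j0 < f" "u n j0 < U j0" by force
  show ?thesis using chain_improve_sup[OF ch _ U _ j0] bd min by blast
next
  case True
  define U' where "U' = u n"
  hence le: "U j \<le> U' j" if "j < f" for j using True that by simp
  have UP: "U \<in> P" and Un: "\<And>j. j < f \<Longrightarrow> int n \<le> U j" using U by (auto simp: box_def)
  have U'P: "U' \<in> P" using chain_P[OF ch] by (simp add: U'_def)
  have U'B: "U' j \<le> B j" if "j < f" for j using bd[OF that] by (simp add: U'_def)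
  have min': "cost U \<le> cost x" if "x \<in> P" "\<And>j. j < f \<Longrightarrow> U j \<le> x j \<and> x j \<le> U' j" for x
    by (rule min) (use that Un U'B in \<open>auto simp: box_def intro: order_trans\<close>)
  have "cost U \<noteq> cost U'" using cost_inj[OF UP U'P] ne by (auto simp: U'_def)
  hence "cost U < cost U'" using min'[OF U'P] le by fastforce
  then obtain je where top: "top_at U U' je" using cost_less_top[OF UP U'P] by blast
  define e where "e = l je (cnt U' je - 1)"
  have je: "je < f" "cnt U je < cnt U' je" using top by (auto simp: top_at_def)
  \<comment> \<open>Only a class \<open>j\<close> whose entry at \<open>pre j\<close> differs
    between \<open>U\<close> and \<open>U'\<close> can gain letters in the replacement, at the top
    as well as in the bound for the members below.\<close>
  define J where "J = {j. j < f \<and> U (pre j) < U' (pre j)}"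
  define b where "b j = (if j \<in> J then cnt U j else 0)" for j
  have J: "J \<subseteq> {..<f}" by (auto simp: J_def)
  have "\<exists>s. s \<in> P \<and> (\<forall>j<f. s j \<le> U j - int (n - k)) \<and>
      (\<forall>x j. x \<in> P \<longrightarrow> (\<forall>j<f. x j \<le> U j - int (n - k)) \<longrightarrow> j < f \<longrightarrow> x j \<le> s j) \<and>
      (\<forall>j<f. cnt s j \<le> cnt U j - (n - k) * (p - 1)) \<and>
      (\<forall>j<f. 0 < cnt s j \<longrightarrow> s (pre j) = U (pre j) - int (n - k))" for k
  proof -
    have "int (n - k) \<le> U j" if "j < f" for j using Un[OF that] by linarith
    from floor_elt[OF UP this] show ?thesis by (metis (no_types, lifting))
  qed
  then obtain s where s: "\<And>k. s k \<in> P" "\<And>k j. j < f \<Longrightarrow> s k j \<le> U j - int (n - k)"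
      "\<And>k x j. x \<in> P \<Longrightarrow> (\<And>j. j < f \<Longrightarrow> x j \<le> U j - int (n - k)) \<Longrightarrow> j < f \<Longrightarrow> x j \<le> s k j"
      "\<And>k j. j < f \<Longrightarrow> cnt (s k) j \<le> cnt U j - (n - k) * (p - 1)"
      "\<And>k j. j < f \<Longrightarrow> 0 < cnt (s k) j \<Longrightarrow> s k (pre j) = U (pre j) - int (n - k)"
    by metis
  \<comment> \<open>Raising every entry of \<open>s k\<close> by one keeps it admissible, and the
    bound has moved up by one as well.\<close>
  have s_step: "s k j < s (Suc k) j" if k: "k < n" and j: "j < f" for k j
  proof -
    define x where "x i = (if i < f then s k i + 1 else 0)" for i
    have "x \<in> P"
    proof (rule P_I)
      fix i assume i: "i < f"
      show "0 \<le> x i" using P_D(2)[OF s(1), of k i] by (simp add: x_def)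
      show "x (pre i) \<le> int p * x i + int (z i)" using P_D(3)[OF s(1) i, of k] i p2 by (simp add: x_def algebra_simps)
    qed (simp add: x_def)
    moreover have "x i \<le> U i - int (n - Suc k)" if "i < f" for i
      using s(2)[OF that, of k] k that by (simp add: x_def of_nat_diff)
    ultimately have "x j \<le> s (Suc k) j" using s(3) j by blast
    thus ?thesis using j by (simp add: x_def)
  qed
  define v where "v k = (if k < n then vmin (u k) (s k) else U)" for k
  have "chain (Suc n) v"
    unfolding chain_def
  proof (intro conjI allI impI)
    fix k assume "k < Suc n" thus "v k \<in> P" using UP chain_P[OF ch] s(1) by (auto simp: v_def P_vmin)
  next
    fix k j assume k: "Suc k < Suc n" and j: "j < f"
    have "u k j < u (Suc k) j" using ch k j by (auto simp: chain_def)
    moreover have "s k j < U j" using s(2)[OF j, of k] k by simp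
    ultimately show "v k j < v (Suc k) j" using s_step[of k j] k j
      by (cases "Suc k < n") (auto simp: v_def vmin_def)
  qed
  moreover have "\<forall>j<f. v n j \<le> B j" using U by (auto simp: v_def box_def)
  moreover have "ccost (Suc n) v < ccost (Suc n) u"
  proof -
    \<comment> \<open>Submodularity trades the meet \<open>v k\<close> for the join \<open>w\<close>
      of \<open>u k\<close> and \<open>s k\<close>. What \<open>s k\<close> costs beyond
      \<open>w\<close> comes from classes in \<open>J\<close>: there \<open>u k\<close> exceeds
      \<open>s k\<close> at \<open>pre j\<close>, and the \<open>n - k\<close> strict steps above
      \<open>u k\<close> carry this excess up to the top.\<close>
    have loss: "cost (v k) - cost (u k) \<le> (\<Sum>j<f. lsum j (b j - (n - k) * (p - 1)))" if k: "k < n" for k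
    proof -
      define w where "w = vmax (u k) (s k)"
      have uP: "u k \<in> P" using chain_P[OF ch] k by simp
      have wP: "w \<in> P" unfolding w_def using uP s(1) by (rule P_vmax)
      have "cost (v k) + cost w \<le> cost (u k) + cost (s k)"
        using cost_submod[OF uP s(1)[of k]] k by (simp add: v_def w_def)
      moreover have "cost (s k) - cost w \<le> (\<Sum>j<f. lsum j (b j - (n - k) * (p - 1)))"
        unfolding cost_def sum_subtractf[symmetric]
      proof (rule sum_mono)
        fix j assume "j \<in> {..<f}"
        hence j: "j < f" by simp
        show "lsum j (cnt (s k) j) - lsum j (cnt w j) \<le> lsum j (b j - (n - k) * (p - 1))"
        proof (cases "cnt (s k) j \<le> cnt w j")
          case True
          thus ?thesis using lsum_mono[OF True, of j] lsum_nonneg[of j "b j - (n - k) * (p - 1)"] by linarith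
        next
          case False
          hence eq: "s k (pre j) = U (pre j) - int (n - k)" using s(5)[OF j, of k] by simp
          have "int p * w j - w (pre j) < int p * s k j - s k (pre j)"
            using False int_cnt[OF s(1) j, of k] int_cnt[OF wP j] by linarith
          moreover have "int p * s k j \<le> int p * w j" by (rule p_mono) (simp add: w_def vmax_def)
          ultimately have "s k (pre j) < u k (pre j)" by (simp add: w_def vmax_def)
          moreover have "u k (pre j) + int (n - k) \<le> U' (pre j)"
            using chain_gap[OF ch, of k n "pre j"] k by (simp add: U'_def)
          ultimately have "j \<in> J" using eq j by (simp add: J_def)
          hence "cnt (s k) j \<le> b j - (n - k) * (p - 1)" using s(4)[OF j, of k] by (simp add: b_def)
          thus ?thesis using lsum_mono lsum_nonneg[of j "cnt w j"] by (meson diff_left_mono diff_le_eq le_add_same_cancel1 order_trans)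
        qed
      qed
      ultimately show ?thesis by linarith
    qed
    have gain: "int p ^ e - (\<Sum>j\<in>{..<f} - {je}. lsum j (b j)) \<le> cost U' - cost U"
    proof -
      have "(\<Sum>j\<in>{..<f} - {je}. lsum j (if cnt U' j < cnt U j then cnt U j else 0)) \<le> (\<Sum>j\<in>{..<f} - {je}. lsum j (b j))"
      proof (rule sum_mono)
        fix j assume "j \<in> {..<f} - {je}"
        hence j: "j < f" by simp
        show "lsum j (if cnt U' j < cnt U j then cnt U j else 0) \<le> lsum j (b j)"
        proof (cases "cnt U' j < cnt U j")
          case True
          hence "int p * U' j - U' (pre j) < int p * U j - U (pre j)"
            using int_cnt[OF UP j] int_cnt[OF U'P j] by linarith
          hence "j \<in> J" using j p_mono[OF le[OF j]] by (simp add: J_def)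
          thus ?thesis using True by (simp add: b_def)
        qed (simp add: lsum_nonneg)
      qed
      thus ?thesis using cost_gain[OF je] by (simp add: e_def)
    qed
    have "(q - 1) * (\<Sum>k<n. cost (v k) - cost (u k)) \<le> (\<Sum>j<f. lsum j (b j))"
    proof -
      have q1: "1 < q" using q_ge p2 by linarith
      have "(\<Sum>k<n. cost (v k) - cost (u k)) \<le> (\<Sum>k<n. \<Sum>j<f. lsum j (b j - (n - k) * (p - 1)))"
        using loss by (intro sum_mono) auto
      also have "... = (\<Sum>j<f. \<Sum>k<n. lsum j (b j - (n - k) * (p - 1)))" by (rule sum.swap)
      finally have "(q - 1) * (\<Sum>k<n. cost (v k) - cost (u k)) \<le> (q - 1) * (\<Sum>j<f. \<Sum>k<n. lsum j (b j - (n - k) * (p - 1)))"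
        using q1 by (intro mult_left_mono) auto
      also have "... \<le> (\<Sum>j<f. lsum j (b j))"
        unfolding sum_distrib_left[of _ _ "{..<f}"] using lsum_shift_sum by (intro sum_mono) auto
      finally show ?thesis .
    qed
    also have "(\<Sum>j<f. lsum j (b j)) = lsum je (b je) + (\<Sum>j\<in>{..<f} - {je}. lsum j (b j))"
      using je by (intro sum.remove) auto
    finally have 1: "(q - 1) * (\<Sum>k<n. cost (v k) - cost (u k)) \<le> lsum je (b je) + (\<Sum>j\<in>{..<f} - {je}. lsum j (b j))" .
    \<comment> \<open>The replacement at the top saves at least \<open>p ^ e\<close> minus the other
      classes. That this exceeds the losses below amounts to the present inequality after
      multiplication by \<open>q - 1\<close>.\<close>
    have 2: "q * (\<Sum>j\<in>{..<f} - {je}. lsum j (b j)) + lsum je (b je) < (q - 1) * int p ^ e"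
    proof (rule others_weighted_bound[OF je(1)])
      show "l je (cnt U' je - 1) = e" by (simp add: e_def)
      show "b je \<le> cnt U' je - 1" using je by (auto simp: b_def)
      fix j assume j: "j < f" "j \<noteq> je" "0 < b j"
      hence "j \<in> J" "0 < cnt U j" "b j = cnt U j" by (auto simp: b_def split: if_splits)
      note jJ = this
      have "l j (cnt U j - 1) \<le> l je (cnt U' je - 1)"
      proof (rule letters_below_top[OF UP U'P _ top _ j(1) _ jJ(2)])
        show "U (pre j) < U' (pre j)" using jJ(1) by (simp add: J_def)
      qed (fact le min')+
      hence "l j (b j - 1) \<le> e" by (simp only: jJ(3) e_def)
      moreover have "l j (b j - 1) \<noteq> e" using j je l_mod unfolding e_def by metis
      ultimately show "l j (b j - 1) < e" by simp
    qed
    have q1: "1 < q" using q_ge p2 by linarith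
    have "(q - 1) * (int p ^ e - (\<Sum>j\<in>{..<f} - {je}. lsum j (b j))) \<le> (q - 1) * (cost U' - cost U)"
      using gain q1 by (intro mult_left_mono) auto
    hence "(q - 1) * ((\<Sum>k<n. cost (v k) - cost (u k)) + (cost U - cost U')) < 0"
      using 1 2 by (simp add: algebra_simps)
    hence "(\<Sum>k<n. cost (v k) - cost (u k)) + (cost U - cost U') < 0"
      using q1 by (simp add: mult_less_0_iff)
    thus ?thesis by (simp add: ccost_def v_def U'_def sum_subtractf)
  qed
  ultimately show ?thesis by blast
qed

text \<open>The bound concerns the top of the chain only, and is void for \<open>d = 0\<close>.\<close>

definition bopt :: "nat \<Rightarrow> (nat \<Rightarrow> int) \<Rightarrow> (nat \<Rightarrow> nat \<Rightarrow> int) \<Rightarrow> bool" where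
  "bopt d B u \<longleftrightarrow> chain d u \<and> (\<forall>k j. Suc k = d \<longrightarrow> j < f \<longrightarrow> u k j \<le> B j) \<and>
     (\<forall>v. chain d v \<longrightarrow> (\<forall>k j. Suc k = d \<longrightarrow> j < f \<longrightarrow> v k j \<le> B j) \<longrightarrow> ccost d u \<le> ccost d v)"

text \<open>A chain whose top differs from a cheapest vector of its box could be improved. So the
  top is chosen greedily, whatever room this leaves to the members below.\<close>

lemma bopt_top:
  assumes u: "bopt (Suc n) B u"
  shows "u n \<in> box n B" and "x \<in> box n B \<Longrightarrow> cost (u n) \<le> cost x"
proof -
  have ch: "chain (Suc n) u" and bd: "\<And>j. j < f \<Longrightarrow> u n j \<le> B j" using u by (auto simp: bopt_def)
  show box: "u n \<in> box n B" using chain_P[OF ch] chain_ge[OF ch] bd by (auto simp: box_def)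
  obtain U where U: "U \<in> box n B" "\<And>x. x \<in> box n B \<Longrightarrow> nat (cost U) \<le> nat (cost x)"
    using ex_has_least_nat[of "\<lambda>x. x \<in> box n B" _ "\<lambda>x. nat (cost x)"] box by blast
  have U': "cost U \<le> cost x" if "x \<in> box n B" for x
    using U(2)[OF that] cost_nonneg[of x] cost_nonneg[of U] by linarith
  have "u n = U"
  proof (rule ccontr)
    assume "u n \<noteq> U"
    from chain_improve[OF ch bd U(1) U' this] obtain v where
      "chain (Suc n) v" "\<forall>j<f. v n j \<le> B j" "ccost (Suc n) v < ccost (Suc n) u" by blast
    thus False using u by (fastforce simp: bopt_def)
  qed
  thus "x \<in> box n B \<Longrightarrow> cost (u n) \<le> cost x" using U' by blast
qed

lemma bopt_restrict:
  assumes u: "bopt (Suc n) B u"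
  shows "bopt n (\<lambda>j. u n j - 1) u"
  unfolding bopt_def
proof (intro conjI allI impI)
  have ch: "chain (Suc n) u" using u by (auto simp: bopt_def)
  show "chain n u" using ch by (auto simp: chain_def)
  show "u k j \<le> u n j - 1" if "Suc k = n" "j < f" for k j
    using ch that by (force simp: chain_def)
  fix v assume v: "chain n v" "\<forall>k j. Suc k = n \<longrightarrow> j < f \<longrightarrow> v k j \<le> u n j - 1"
  let ?v = "v(n := u n)"
  have "chain (Suc n) ?v" using v chain_P[OF ch, of n] by (auto simp: chain_def)
  hence "ccost (Suc n) u \<le> ccost (Suc n) ?v" using u by (auto simp: bopt_def)
  thus "ccost n u \<le> ccost n v" by (simp add: ccost_def)
qed

lemma bopt_unique:
  assumes "bopt d B u" "bopt d B v" "k < d"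
  shows "u k = v k"
  using assms
proof (induction d arbitrary: B)
  case (Suc n)
  note u = bopt_top[OF Suc.prems(1)] and v = bopt_top[OF Suc.prems(2)]
  have "u n \<in> P" "v n \<in> P" using u(1) v(1) by (auto simp: box_def)
  moreover have "cost (u n) = cost (v n)" using u v by (meson order_antisym)
  ultimately have eq: "u n = v n" by (rule cost_inj)
  show ?case
  proof (cases "k = n")
    case False
    thus ?thesis using Suc.IH[OF bopt_restrict[OF Suc.prems(1)]] bopt_restrict[OF Suc.prems(2)] Suc.prems(3) eq
      by simp
  qed (simp add: eq)
qed simp

text \<open>This is what makes the resulting numbers digitwise increasing. A portion
  \<open>b\<close> of the gap \<open>w = U - x\<close> is exchanged: \<open>x + b\<close> stays in
  the box of \<open>U\<close>, and \<open>U - b\<close> in that of \<open>x\<close>. If all new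
  counts lie between the old ones, convexity and the minimality of \<open>x\<close> and
  \<open>U\<close> force \<open>U - b = x\<close>, that is \<open>b = w\<close>. For the least
  possible \<open>b\<close> this fails as soon as some count of \<open>x\<close> exceeds that of
  \<open>U\<close>.\<close>

lemma box_nested:
  assumes U: "U \<in> box (Suc n) B" and minU: "\<And>y. y \<in> box (Suc n) B \<Longrightarrow> cost U \<le> cost y"
    and x: "x \<in> box n (\<lambda>j. U j - 1)" and minx: "\<And>y. y \<in> box n (\<lambda>j. U j - 1) \<Longrightarrow> cost x \<le> cost y"
    and j: "j < f"
  shows "cnt x j \<le> cnt U j"
proof (rule ccontr)
  assume "\<not> cnt x j \<le> cnt U j"
  hence gt: "cnt U j < cnt x j" by simp
  have UP: "U \<in> P" and xP: "x \<in> P" using U x by (auto simp: box_def)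
  define w where "w i = U i - x i" for i
  define g where "g i = max 0 (int (cnt U i) - int (cnt x i))" for i
  have w1: "1 \<le> w i" if "i < f" for i using x that by (auto simp: w_def box_def)
  have wg: "int p * w i - w (pre i) = int (cnt U i) - int (cnt x i)" if "i < f" for i
    using int_cnt[OF UP that] int_cnt[OF xP that] by (simp add: w_def algebra_simps)
  \<comment> \<open>In class \<open>i\<close> the count of \<open>x\<close> may grow by at most
    \<open>g i\<close>; the bound \<open>1 \<le> b i\<close> keeps \<open>U - b\<close> below
    \<open>U - 1\<close>.\<close>
  define K where "K = {b. (\<forall>i\<ge>f. b i = 0) \<and> (\<forall>i<f. 1 \<le> b i \<and> b i \<le> w i \<and> int p * b i - g i \<le> b (pre i))}"
  define m where "m b = nat (\<Sum>i<f. b i)" for b :: "nat \<Rightarrow> int"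
  have wK: "w \<in> K"
  proof -
    have "int p * w i - g i \<le> w (pre i)" if "i < f" for i
      using wg[OF that] unfolding g_def by linarith
    moreover have "w i = 0" if "f \<le> i" for i using P_D(1)[OF UP that] P_D(1)[OF xP that] by (simp add: w_def)
    ultimately show ?thesis using w1 by (auto simp: K_def)
  qed
  obtain b where b: "b \<in> K" "\<And>y. y \<in> K \<Longrightarrow> m b \<le> m y"
    using ex_has_least_nat[of "\<lambda>x. x \<in> K" _ m] wK by blast
  have bD: "b i = 0" if "f \<le> i" for i using b that by (auto simp: K_def)
  have bD': "1 \<le> b i" "b i \<le> w i" "int p * b i - g i \<le> b (pre i)" if "i < f" for i using b that by (auto simp: K_def)
  have dec: False if i: "i < f" and c: "c \<in> K" "int p * c i - g i < c (pre i)" "1 < c (pre i)" and least: "\<And>y. y \<in> K \<Longrightarrow> m c \<le> m y" for i c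
  proof -
    define y where "y = c(pre i := c (pre i) - 1)"
    have cD: "1 \<le> c a \<and> c a \<le> w a \<and> int p * c a - g a \<le> c (pre a)" if "a < f" for a using c that by (auto simp: K_def)
    have le: "int p * y a \<le> int p * c a" for a by (intro p_mono) (auto simp: y_def)
    have "y a = 0" if "f \<le> a" for a
      using c that pre_less[of i] by (auto simp: y_def K_def simp del: pre_less)
    moreover have "1 \<le> y a \<and> y a \<le> w a" if "a < f" for a
      using cD[OF that] c(3) by (auto simp: y_def)
    moreover have "int p * y a - g a \<le> y (pre a)" if a: "a < f" for a
    proof (cases "pre a = pre i")
      case True
      hence "a = i" using pre_inj i a by auto
      thus ?thesis using c(2) le[of a] by (auto simp: y_def)
    next
      case False
      thus ?thesis using cD[OF a] le[of a] by (auto simp: y_def)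
    qed
    ultimately have "y \<in> K" by (auto simp: K_def)
    hence "m c \<le> m y" by (rule least)
    moreover have "m y < m c"
    proof -
      have "(\<Sum>a<f. y a) < (\<Sum>a<f. c a)"
        by (intro sum_strict_mono_ex1) (auto simp: y_def intro!: bexI[of _ "pre i"])
      moreover have "0 \<le> (\<Sum>a<f. y a)" using \<open>y \<in> K\<close> by (intro sum_nonneg) (force simp: K_def)
      ultimately show ?thesis by (simp add: m_def)
    qed
    ultimately show False by simp
  qed
  \<comment> \<open>An entry above 1 could be lowered unless its constraint is tight. Hence the
    counts do not move in classes where \<open>x\<close> has more letters, and move by an amount
    between 0 and \<open>g i\<close> elsewhere.\<close>
  have up: "b (pre i) \<le> max 1 (int p * b i - g i)" if "i < f" for i
  proof (rule ccontr)
    assume "\<not> ?thesis"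
    thus False by (intro dec[OF that b(1)]) (use b(2) in auto)
  qed
  define Z where "Z i = U i - b i" for i
  define Y where "Y i = x i + b i" for i
  have pb: "int p \<le> int p * b i" if "i < f" for i using p_mono[OF bD'(1)[OF that]] by simp
  have conf: "int (cnt x i) \<le> int (cnt x i) + (int p * b i - b (pre i)) \<and> int (cnt x i) + (int p * b i - b (pre i)) \<le> int (cnt U i) \<or>
     int (cnt U i) \<le> int (cnt x i) + (int p * b i - b (pre i)) \<and> int (cnt x i) + (int p * b i - b (pre i)) \<le> int (cnt x i)" if i: "i < f" for i
  proof (cases "cnt x i \<le> cnt U i")
    case True
    thus ?thesis using up[OF i] bD'(3)[OF i] pb[OF i] p2 unfolding g_def by linarith
  next
    case False
    have "b (pre i) = int p * b i" using up[OF i] bD'(3)[OF i] pb[OF i] p2 False unfolding g_def by linarith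
    thus ?thesis using False by simp
  qed
  have YP: "Y \<in> P"
  proof (rule P_I)
    fix i assume i: "i < f"
    show "0 \<le> Y i" using bD'(1)[OF i] P_D(2)[OF xP, of i] by (simp add: Y_def)
    show "Y (pre i) \<le> int p * Y i + int (z i)"
      using conf[OF i] int_cnt[OF xP i] by (auto simp: Y_def algebra_simps)
  qed (use bD P_D(1)[OF xP] in \<open>auto simp: Y_def\<close>)
  have XP: "Z \<in> P"
  proof (rule P_I)
    fix i assume i: "i < f"
    show "0 \<le> Z i" using bD'(2)[OF i] P_D(2)[OF xP, of i] by (simp add: Z_def w_def)
    show "Z (pre i) \<le> int p * Z i + int (z i)"
      using conf[OF i] int_cnt[OF UP i] by (auto simp: Z_def algebra_simps)
  qed (use bD P_D(1)[OF UP] in \<open>auto simp: Z_def\<close>)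
  have cY: "int (cnt Y i) = int (cnt x i) + (int p * b i - b (pre i))" if "i < f" for i
    using int_cnt[OF YP that] int_cnt[OF xP that] by (simp add: Y_def algebra_simps)
  have cX: "int (cnt Z i) = int (cnt U i) - (int p * b i - b (pre i))" if "i < f" for i
    using int_cnt[OF XP that] int_cnt[OF UP that] by (simp add: Z_def algebra_simps)
  have "cost Y + cost Z \<le> cost x + cost U"
    unfolding cost_def sum.distrib[symmetric]
  proof (rule sum_mono)
    fix i assume "i \<in> {..<f}"
    hence i: "i < f" by simp
    show "lsum i (cnt Y i) + lsum i (cnt Z i) \<le> lsum i (cnt x i) + lsum i (cnt U i)"
      by (rule lsum_convex'[OF i]) (use conf[OF i] cX[OF i] cY[OF i] in auto)
  qed
  moreover have "cost x \<le> cost Z"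
    by (rule minx) (use XP U x bD' in \<open>force simp: box_def Z_def w_def\<close>)
  moreover have "cost U \<le> cost Y"
    by (rule minU) (use YP U x bD' in \<open>force simp: box_def Y_def w_def\<close>)
  ultimately have "cost Z = cost x" by simp
  hence "Z = x" by (rule cost_inj[OF XP xP])
  hence bw: "b i = w i" for i unfolding Z_def w_def fun_eq_iff by (smt (verit))
  \<comment> \<open>For \<open>b = w\<close> the constraint is slack in class \<open>j\<close>,
    where \<open>x\<close> has more letters, and \<open>w (pre j) > p * w j \<ge> 2\<close> leaves
    room to lower this entry.\<close>
  have "int p * b j - g j < b (pre j)" "1 < b (pre j)"
    using wg[OF j] gt pb[OF j] p2 unfolding g_def bw by linarith+
  thus False by (intro dec[OF j b(1)]) (use b(2) in auto)
qed

section \<open>Optimal chains: uniqueness, nested counts and convexity of the minimal cost\<close>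

definition opt :: "nat \<Rightarrow> (nat \<Rightarrow> nat \<Rightarrow> int) \<Rightarrow> bool" where
  "opt d u \<longleftrightarrow> chain d u \<and> (\<forall>v. chain d v \<longrightarrow> ccost d u \<le> ccost d v)"

lemma opt_bopt:
  assumes "opt d u" "\<And>k j. Suc k = d \<Longrightarrow> j < f \<Longrightarrow> u k j \<le> B j"
  shows "bopt d B u"
  using assms by (auto simp: opt_def bopt_def)

lemma opt_unique:
  assumes "opt d u" "opt d v" "k < d"
  shows "u k = v k"
proof -
  define B where "B = vmax (u (d - 1)) (v (d - 1))"
  have "bopt d B u" "bopt d B v" using assms by (auto intro!: opt_bopt simp: B_def vmax_def)
  thus ?thesis using bopt_unique assms(3) by blast
qed

lemma bopt_nested: "bopt d B u \<Longrightarrow> Suc k < d \<Longrightarrow> j < f \<Longrightarrow> cnt (u k) j \<le> cnt (u (Suc k)) j"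
proof (induction d arbitrary: B)
  case (Suc n)
  show ?case
  proof (cases "n = Suc k")
    case False
    thus ?thesis using Suc.IH[OF bopt_restrict[OF Suc.prems(1)]] Suc.prems by simp
  next
    case True
    note r = bopt_restrict[OF Suc.prems(1), unfolded True]
    show ?thesis using box_nested[OF bopt_top[OF Suc.prems(1)[unfolded True]] bopt_top[OF r] Suc.prems(3)] by simp
  qed
qed simp

lemma opt_nested:
  assumes "opt d u" "Suc k < d" "j < f"
  shows "cnt (u k) j \<le> cnt (u (Suc k)) j"
proof -
  have "bopt d (u (d - 1)) u" by (rule opt_bopt[OF assms(1)]) auto
  thus ?thesis using bopt_nested assms by blast
qed

lemma ccost_nonneg: "0 \<le> ccost d u"
  unfolding ccost_def by (intro sum_nonneg cost_nonneg)

lemma opt_exists: "\<exists>u. opt d u"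
proof -
  define c where "c k j = (if j < f then int k else 0)" for k j
  have "c k \<in> P" for k
    using p2 mult_right_mono[of 1 "int p" "int k"] by (intro P_I) (auto simp: c_def)
  hence "chain d c" by (auto simp: chain_def c_def)
  then obtain u where u: "chain d u" "\<And>v. chain d v \<Longrightarrow> nat (ccost d u) \<le> nat (ccost d v)"
    using ex_has_least_nat[of "chain d" _ "\<lambda>u. nat (ccost d u)"] by blast
  have "ccost d u \<le> ccost d v" if "chain d v" for v
    using u(2)[OF that] ccost_nonneg[of d u] ccost_nonneg[of d v] by linarith
  thus ?thesis using u(1) by (auto simp: opt_def)
qed

definition min_cost :: "nat \<Rightarrow> int" where "min_cost d = ccost d (SOME u. opt d u)"

lemma min_cost_eq: "opt d u \<Longrightarrow> min_cost d = ccost d u"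
  unfolding min_cost_def using someI[of "opt d" u] by (metis opt_def order_antisym)

lemma min_cost_le: "chain d u \<Longrightarrow> min_cost d \<le> ccost d u"
  using opt_exists[of d] min_cost_eq by (auto simp: opt_def)

lemma optI: "chain d u \<Longrightarrow> ccost d u \<le> min_cost d \<Longrightarrow> opt d u"
  using min_cost_le by (force simp: opt_def)

lemma min_cost_0 [simp]: "min_cost 0 = 0"
  by (simp add: min_cost_def ccost_def)

lemma min_cost_nonneg: "0 \<le> min_cost d"
  by (simp add: min_cost_def ccost_nonneg)

lemma min_cost_mono: "min_cost d \<le> min_cost (Suc d)"
proof -
  obtain u where u: "opt (Suc d) u" using opt_exists by blast
  have "chain d u" using u by (auto simp: opt_def chain_def)
  hence "min_cost d \<le> ccost d u" by (rule min_cost_le)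
  thus ?thesis using min_cost_eq[OF u] cost_nonneg[of "u d"] by (simp add: ccost_def)
qed

text \<open>If this failed, both chains v and w would be optimal, hence equal, which forces
  \<open>u d = u (Suc d)\<close> in the coordinate 0.\<close>

lemma min_cost_convex: "2 * min_cost (Suc d) < min_cost (Suc (Suc d)) + min_cost d"
proof (rule ccontr)
  assume neg: "\<not> ?thesis"
  obtain u u' where u: "opt (Suc (Suc d)) u" and u': "opt d u'" using opt_exists by meson
  have cu: "chain (Suc (Suc d)) u" and cu': "chain d u'" using u u' by (auto simp: opt_def)
  have uu: "u k j < u (Suc k) j" if "k \<le> d" "j < f" for k j using cu that by (auto simp: chain_def)
  have uu': "u' k j < u' (Suc k) j" if "Suc k < d" "j < f" for k j using cu' that by (auto simp: chain_def)
  \<comment> \<open>The short chain is shifted by one: \<open>u' (k - 1)\<close> is paired with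
    \<open>u k\<close>. Thus \<open>v\<close> starts at \<open>u 0\<close>, \<open>w\<close> ends at
    \<open>u (Suc d)\<close>, and every vector of both chains enters exactly one pair or is one of
    these two.\<close>
  define v where "v k = (if k = 0 then u 0 else vmax (u k) (u' (k - 1)))" for k
  define w where "w k = (if k < d then vmin (u (Suc k)) (u' k) else u (Suc k))" for k
  have v: "chain (Suc d) v"
    unfolding chain_def
  proof (intro conjI allI impI)
    fix k assume "k < Suc d"
    thus "v k \<in> P" using chain_P[OF cu] chain_P[OF cu'] by (cases k) (auto simp: v_def P_vmax)
  next
    fix k j assume "Suc k < Suc d" "j < f"
    thus "v k j < v (Suc k) j" using uu[of k j] uu'[of "k - 1" j]
      by (cases k) (auto simp: v_def vmax_def)
  qed
  have w: "chain (Suc d) w"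
    unfolding chain_def
  proof (intro conjI allI impI)
    fix k assume "k < Suc d"
    thus "w k \<in> P" using chain_P[OF cu] chain_P[OF cu'] by (auto simp: w_def P_vmin)
  next
    fix k j assume k: "Suc k < Suc d" "j < f"
    thus "w k j < w (Suc k) j" using uu[of "Suc k" j] uu'[of k j]
      by (cases "Suc k < d") (auto simp: w_def vmin_def)
  qed
  have "ccost (Suc d) v + ccost (Suc d) w = cost (u 0) + cost (u (Suc d)) + (\<Sum>k<d. cost (vmin (u (Suc k)) (u' k)) + cost (vmax (u (Suc k)) (u' k)))"
  proof -
    have "ccost (Suc d) v = cost (u 0) + (\<Sum>k<d. cost (vmax (u (Suc k)) (u' k)))"
      unfolding ccost_def sum.lessThan_Suc_shift by (simp add: v_def)
    moreover have "ccost (Suc d) w = (\<Sum>k<d. cost (vmin (u (Suc k)) (u' k))) + cost (u (Suc d))"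
      unfolding ccost_def by (simp add: w_def)
    ultimately show ?thesis by (simp add: sum.distrib)
  qed
  also have "... \<le> cost (u 0) + cost (u (Suc d)) + (\<Sum>k<d. cost (u (Suc k)) + cost (u' k))"
    using chain_P[OF cu] chain_P[OF cu'] by (intro add_left_mono sum_mono cost_submod) auto
  also have "... = min_cost (Suc (Suc d)) + min_cost d"
    unfolding min_cost_eq[OF u] min_cost_eq[OF u']
    using sum.lessThan_Suc_shift[of "\<lambda>k. cost (u k)" d] by (simp add: ccost_def sum.distrib)
  finally have "ccost (Suc d) v \<le> min_cost (Suc d)" "ccost (Suc d) w \<le> min_cost (Suc d)"
    using neg min_cost_le[OF v] min_cost_le[OF w] by auto
  hence eq: "v k = w k" if "k \<le> d" for k
    using opt_unique[OF optI[OF v] optI[OF w]] that by simp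
  \<comment> \<open>Since \<open>u (Suc k)\<close> lies strictly above \<open>u k\<close>, the
    minimum in \<open>w k\<close> can only be attained by \<open>u' k\<close>. So
    \<open>u' k = u k\<close>, and the join in \<open>v (Suc k)\<close> is \<open>u (Suc k)\<close>
    again.\<close>
  have "v k j = u k j" if "k \<le> d" "j < f" for k j
    using that
  proof (induction k arbitrary: j)
    case (Suc k)
    have "min (u (Suc k) j) (u' k j) = u k j" using eq[of k] Suc by (simp add: w_def vmin_def fun_eq_iff)
    hence "u' k j = u k j" using uu[of k j] Suc by (auto simp: min_def split: if_splits)
    thus ?case using uu[of k j] Suc by (simp add: v_def vmax_def)
  qed (simp add: v_def)
  moreover have "v d 0 = u (Suc d) 0" using eq[of d] by (simp add: w_def)
  ultimately show False using uu[of d 0] f1 by simp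
qed

end

section \<open>Digitwise increasing chains of numbers\<close>

definition dig_le :: "nat \<Rightarrow> nat \<Rightarrow> nat \<Rightarrow> bool" where
  "dig_le p k n \<longleftrightarrow> (\<forall>e. k div p ^ e mod p \<le> n div p ^ e mod p)"

lemma sum_digits: "(\<Sum>e<N. (n div p ^ e mod p) * p ^ e) = n mod p ^ N" for n p :: nat
proof (induction N)
  case (Suc N)
  have "n mod p ^ Suc N = p ^ N * (n div p ^ N mod p) + n mod p ^ N"
    by (simp add: mod_mult2_eq mult.commute[of p])
  thus ?case using Suc by simp
qed simp

lemma sum_digits_less:
  fixes c :: "nat \<Rightarrow> nat"
  assumes "\<And>e. e < N \<Longrightarrow> c e < p"
  shows "(\<Sum>e<N. c e * p ^ e) < p ^ N"
  using assms
proof (induction N)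
  case (Suc N)
  have "c N * p ^ N + p ^ N \<le> p * p ^ N"
    using Suc.prems[of N] mult_le_mono1[of "Suc (c N)" p "p ^ N"] by simp
  thus ?case using Suc by simp
qed simp

lemma digit_of_sum:
  fixes c :: "nat \<Rightarrow> nat"
  assumes "\<And>e. e < N \<Longrightarrow> c e < p" "e < N"
  shows "(\<Sum>e<N. c e * p ^ e) div p ^ e mod p = c e"
  using assms
proof (induction e arbitrary: c N)
  case 0
  then obtain N' where N: "N = Suc N'" by (cases N) auto
  have "(\<Sum>e<N. c e * p ^ e) = c 0 + p * (\<Sum>e<N'. c (Suc e) * p ^ e)"
    unfolding N sum.lessThan_Suc_shift by (simp add: sum_distrib_left mult_ac)
  thus ?case using 0 by simp
next
  case (Suc e)
  then obtain N' where N: "N = Suc N'" by (cases N) auto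
  have "(\<Sum>e<N. c e * p ^ e) = c 0 + p * (\<Sum>e<N'. c (Suc e) * p ^ e)"
    unfolding N sum.lessThan_Suc_shift by (simp add: sum_distrib_left mult_ac)
  hence "(\<Sum>e<N. c e * p ^ e) div p = (\<Sum>e<N'. c (Suc e) * p ^ e)"
    using Suc.prems(1)[of 0] N by simp
  hence "(\<Sum>e<N. c e * p ^ e) div p ^ Suc e mod p = (\<Sum>e<N'. c (Suc e) * p ^ e) div p ^ e mod p"
    by (simp add: div_mult2_eq)
  also have "... = c (Suc e)" using Suc.prems N by (intro Suc.IH) auto
  finally show ?case .
qed

lemma sum_mod_classes:
  fixes x :: "nat \<Rightarrow> 'a::comm_monoid_add"
  assumes "f \<ge> 1"
  shows "(\<Sum>e<N. x e) = (\<Sum>j<f. \<Sum>e<N. if e mod f = j then x e else 0)"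
proof -
  have "(\<Sum>j<f. \<Sum>e<N. if e mod f = j then x e else 0) = (\<Sum>e<N. \<Sum>j<f. if e mod f = j then x e else 0)"
    by (rule sum.swap)
  also have "... = (\<Sum>e<N. x e)" using assms by (intro sum.cong refl) (simp add: sum.delta')
  finally show ?thesis by simp
qed

lemma cong_pow_mod:
  fixes p f e :: nat
  assumes "p \<ge> 1"
  shows "[p ^ e = p ^ (e mod f)] (mod (p ^ f - 1))"
proof -
  have "[p ^ f = 1] (mod (p ^ f - 1))"
    using assms by (metis cong_def cong_diff_nat le_add_diff_inverse2 mod_add_self1 one_le_power)
  hence "[(p ^ f) ^ (e div f) = 1 ^ (e div f)] (mod (p ^ f - 1))" by (rule cong_pow)
  hence "[(p ^ f) ^ (e div f) * p ^ (e mod f) = 1 ^ (e div f) * p ^ (e mod f)] (mod (p ^ f - 1))"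
    by (rule cong_scalar_right)
  moreover have "(p ^ f) ^ (e div f) * p ^ (e mod f) = p ^ e"
    by (simp flip: power_mult power_add)
  ultimately show ?thesis by simp
qed

text \<open>Carrying p letters of a class to one letter of the next class changes no residue.\<close>

lemma carry_vector:
  fixes p f z :: nat and a :: "nat \<Rightarrow> nat"
  assumes p: "2 \<le> p" and f: "1 \<le> f" and z: "z < p ^ f - 1"
    and cong: "[(\<Sum>j<f. a j * p ^ j) = z] (mod (p ^ f - 1))"
  shows "\<exists>i :: nat \<Rightarrow> nat. \<forall>j<f. a j + i ((j + f - 1) mod f) = p * i j + z div p ^ j mod p"
  using cong
proof (induction "\<Sum>j<f. a j" arbitrary: a rule: less_induct)
  case less
  show ?case
  proof (cases "\<forall>j<f. a j < p")
    case True
    define S where "S = (\<Sum>j<f. a j * p ^ j)"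
    have S: "S < p ^ f" unfolding S_def using True by (intro sum_digits_less) auto
    have dig: "S div p ^ j mod p = a j" if "j < f" for j
      unfolding S_def using True that by (intro digit_of_sum) auto
    have "S mod (p ^ f - 1) = z" using less.prems z by (simp add: cong_def S_def)
    hence "S = z \<or> S = p ^ f - 1 \<and> z = 0"
    proof (cases "S < p ^ f - 1")
      case False
      hence "S = p ^ f - 1" using S by linarith
      thus ?thesis using \<open>S mod (p ^ f - 1) = z\<close> by simp
    qed simp
    thus ?thesis
    proof
      assume "S = z"
      thus ?thesis using dig by (intro exI[of _ "\<lambda>_. 0"]) auto
    next
      \<comment> \<open>The residue 0 has two representatives below \<open>p ^ f\<close>. If all
        digits are \<open>p - 1\<close>, a carry of one in every class turns them into
        zeros.\<close>
      assume *: "S = p ^ f - 1 \<and> z = 0"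
      have "a j = p - 1" if j: "j < f" for j
      proof -
        have "(\<Sum>j<f. (p - 1) * p ^ j) = p ^ f - 1"
        proof (induction f)
          case (Suc f)
          have "1 \<le> p ^ f" using p by simp
          thus ?case using Suc p by (simp add: diff_mult_distrib)
        qed simp
        hence "S div p ^ j mod p = p - 1" using digit_of_sum[of f "\<lambda>_. p - 1" p j] j p * by simp
        thus ?thesis using dig j by simp
      qed
      thus ?thesis using p * by (intro exI[of _ "\<lambda>_. 1"]) auto
    qed
  next
    case False
    then obtain j where j: "j < f" "p \<le> a j" by (auto simp: not_less)
    define s where "s = Suc j mod f"
    have s: "s < f" using f by (simp add: s_def)
    define a1 where "a1 = a(j := a j - p)"
    define a2 where "a2 = a1(s := a1 s + 1)"
    have sum1: "(\<Sum>i<f. a1 i * w i) + p * w j = (\<Sum>i<f. a i * w i)" for w :: "nat \<Rightarrow> nat"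
    proof -
      have "(\<Sum>i<f. a i * w i) = a j * w j + (\<Sum>i\<in>{..<f}-{j}. a i * w i)"
        using j by (intro sum.remove) auto
      moreover have "(\<Sum>i<f. a1 i * w i) = a1 j * w j + (\<Sum>i\<in>{..<f}-{j}. a1 i * w i)"
        using j by (intro sum.remove) auto
      moreover have "(\<Sum>i\<in>{..<f}-{j}. a1 i * w i) = (\<Sum>i\<in>{..<f}-{j}. a i * w i)"
        by (intro sum.cong) (auto simp: a1_def)
      moreover have "a1 j * w j + p * w j = a j * w j"
        using j by (simp add: a1_def flip: add_mult_distrib)
      ultimately show ?thesis by linarith
    qed
    have sum2: "(\<Sum>i<f. a2 i * w i) = (\<Sum>i<f. a1 i * w i) + w s" for w :: "nat \<Rightarrow> nat"
    proof -
      have "(\<Sum>i<f. a2 i * w i) = a2 s * w s + (\<Sum>i\<in>{..<f}-{s}. a2 i * w i)"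
        using s by (intro sum.remove) auto
      moreover have "(\<Sum>i<f. a1 i * w i) = a1 s * w s + (\<Sum>i\<in>{..<f}-{s}. a1 i * w i)"
        using s by (intro sum.remove) auto
      moreover have "(\<Sum>i\<in>{..<f}-{s}. a2 i * w i) = (\<Sum>i\<in>{..<f}-{s}. a1 i * w i)"
        by (intro sum.cong) (auto simp: a2_def)
      moreover have "a2 s * w s = a1 s * w s + w s" by (simp add: a2_def)
      ultimately show ?thesis by linarith
    qed
    have lt: "(\<Sum>i<f. a2 i) < (\<Sum>i<f. a i)" using sum1[of "\<lambda>_. 1"] sum2[of "\<lambda>_. 1"] p by simp
    have "[p ^ Suc j = p ^ s] (mod (p ^ f - 1))" unfolding s_def using p by (intro cong_pow_mod) simp
    hence "[(\<Sum>i<f. a1 i * p ^ i) + p ^ Suc j = (\<Sum>i<f. a1 i * p ^ i) + p ^ s] (mod (p ^ f - 1))"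
      by (intro cong_add) auto
    hence "[(\<Sum>i<f. a2 i * p ^ i) = (\<Sum>i<f. a i * p ^ i)] (mod (p ^ f - 1))"
      using sum1[of "\<lambda>i. p ^ i"] sum2[of "\<lambda>i. p ^ i"] by (simp add: cong_sym)
    hence "[(\<Sum>i<f. a2 i * p ^ i) = z] (mod (p ^ f - 1))" using less.prems cong_trans by blast
    from less.hyps[OF lt this] obtain i where
      i: "\<forall>j<f. a2 j + i ((j + f - 1) mod f) = p * i j + z div p ^ j mod p" by blast
    \<comment> \<open>One more unit in coordinate \<open>j\<close> accounts both for the
      \<open>p\<close> letters taken from class \<open>j\<close> and, through the predecessor term,
      for the letter added to class \<open>s\<close>.\<close>
    define i' where "i' = i(j := i j + 1)"
    have pre: "(k + f - 1) mod f = j \<longleftrightarrow> k = s" if "k < f" for k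
    proof -
      have *: "(k + f - 1) mod f = (if k = 0 then f - 1 else k - 1)" using that by (auto simp: mod_if)
      show ?thesis using that j unfolding * s_def by (auto simp: mod_if split: if_splits)
    qed
    have "a k + i' ((k + f - 1) mod f) = p * i' k + z div p ^ k mod p" if k: "k < f" for k
      using i[rule_format, OF k] pre[OF k] j p
      by (auto simp: i'_def a2_def a1_def split: if_splits)
    thus ?thesis by blast
  qed
qed

lemma dig_le_le:
  assumes "dig_le p k n" "2 \<le> p"
  shows "k \<le> n"
proof -
  define K where "K = k + n"
  have K: "k < p ^ K" "n < p ^ K"
  proof -
    have "K < p ^ K" using assms(2) by (intro power_gt_expt) simp
    thus "k < p ^ K" "n < p ^ K" by (simp_all add: K_def)
  qed
  have "(\<Sum>e<K. (k div p ^ e mod p) * p ^ e) \<le> (\<Sum>e<K. (n div p ^ e mod p) * p ^ e)"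
    using assms by (intro sum_mono mult_right_mono) (auto simp: dig_le_def)
  thus ?thesis unfolding sum_digits using K by simp
qed

section \<open>The letters given by the digits of a number\<close>

definition nchain :: "nat \<Rightarrow> nat \<Rightarrow> nat \<Rightarrow> nat \<Rightarrow> (nat \<Rightarrow> nat) \<Rightarrow> nat \<Rightarrow> bool" where
  "nchain p f z d \<nu> m \<longleftrightarrow> (\<forall>k<d. [\<nu> k = z] (mod (p ^ f - 1)) \<and> dig_le p (\<nu> k) m) \<and>
     (\<forall>k. Suc k < d \<longrightarrow> \<nu> k \<noteq> \<nu> (Suc k) \<and> dig_le p (\<nu> k) (\<nu> (Suc k)))"

locale digits =
  fixes p f N m z :: nat
  assumes p2: "2 \<le> p" and f1: "1 \<le> f" and m: "m < p ^ N" and z: "z < p ^ f - 1"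
begin

text \<open>Beyond the digits of m the multiset of letters is padded, so that no class runs out of letters.\<close>

definition M :: "nat \<Rightarrow> nat" where "M e = (if e < N then m div p ^ e mod p else p - 1)"

text \<open>This is the counting function of the letters of class \<open>j\<close>, and
  \<open>letter j\<close> is its generalised inverse, which lists each exponent \<open>e\<close> of
  the class with multiplicity \<open>M e\<close>.\<close>

definition cap :: "nat \<Rightarrow> nat \<Rightarrow> nat" where
  "cap j e = (\<Sum>e'<e. if e' mod f = j then M e' else 0)"

definition letter :: "nat \<Rightarrow> nat \<Rightarrow> nat" where "letter j k = (LEAST e. k < cap j (Suc e))"

lemma M_le: "M e \<le> p - 1"
  using p2 by (auto simp: M_def less_Suc_eq_le[symmetric])

lemma cap_Suc: "cap j (Suc e) = cap j e + (if e mod f = j then M e else 0)"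
  by (simp add: cap_def)

lemma cap_0 [simp]: "cap j 0 = 0" by (simp add: cap_def)

lemma cap_mono: "a \<le> b \<Longrightarrow> cap j a \<le> cap j b"
  unfolding cap_def by (intro sum_mono2) auto

lemma cap_unbounded: "j < f \<Longrightarrow> \<exists>e. k < cap j (Suc e)"
proof -
  assume j: "j < f"
  have "t < cap j (Suc (f * (N + t) + j))" for t
  proof (induction t)
    case 0
    have "N \<le> f * N" using f1 by simp
    hence "\<not> f * N + j < N" by linarith
    thus ?case using j p2 by (simp add: cap_Suc M_def)
  next
    case (Suc t)
    have "N \<le> f * (N + Suc t) + j" using f1 by (metis le_add1 le_trans mult_le_mono1 nat_mult_1 trans_le_add1)
    moreover have "(f * (N + Suc t) + j) mod f = j" using j by (simp only: mod_mult_self4 mod_less)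
    ultimately have "cap j (Suc (f * (N + Suc t) + j)) = cap j (f * (N + Suc t) + j) + (p - 1)"
      by (simp only: cap_Suc M_def not_less[symmetric] if_True if_False refl)
    moreover have "cap j (Suc (f * (N + t) + j)) \<le> cap j (f * (N + Suc t) + j)"
      using f1 by (intro cap_mono) simp
    ultimately show ?case using Suc p2 by simp
  qed
  thus ?thesis by blast
qed

lemma letter_less_iff: "j < f \<Longrightarrow> letter j k < e \<longleftrightarrow> k < cap j e"
proof
  assume j: "j < f"
  have k: "k < cap j (Suc (letter j k))" unfolding letter_def by (rule LeastI_ex) (rule cap_unbounded[OF j])
  show "k < cap j e" if "letter j k < e"
    using k cap_mono[of "Suc (letter j k)" e j] that by simp
  show "letter j k < e" if "k < cap j e"
  proof (cases e)
    case (Suc e')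
    thus ?thesis using that by (auto simp: letter_def less_Suc_eq_le intro: Least_le)
  qed (use that in simp)
qed

lemma letter_bounds:
  assumes "j < f"
  shows "cap j (letter j k) \<le> k" "k < cap j (Suc (letter j k))"
  using letter_less_iff[OF assms, of k "letter j k"] letter_less_iff[OF assms, of k "Suc (letter j k)"] by auto

lemma letter_mod: "j < f \<Longrightarrow> letter j k mod f = j"
  using letter_bounds[of j k] by (simp add: cap_Suc split: if_splits)

text \<open>Of the exponents from \<open>e\<close> to \<open>e + f - 1\<close> only the first lies
  in class \<open>j\<close>, and it supplies at most \<open>p - 1\<close> letters. This is the gap
  condition in terms of the counting function.\<close>

lemma cap_gap:
  assumes "e mod f = j"
  shows "cap j (e + f) \<le> cap j e + (p - 1)"
proof -
  have "cap j (e + Suc t) = cap j e + M e" if "Suc t \<le> f" for t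
    using that
  proof (induction t)
    case 0
    thus ?case using assms by (simp add: cap_Suc)
  next
    case (Suc t)
    have "(e + Suc t) mod f \<noteq> e mod f"
    proof
      assume "(e + Suc t) mod f = e mod f"
      hence "f dvd Suc t" by (simp add: mod_eq_dvd_iff_nat)
      thus False using Suc.prems by (auto dest: dvd_imp_le)
    qed
    thus ?case using Suc assms by (simp add: cap_Suc)
  qed
  from this[of "f - 1"] show ?thesis using f1 M_le[of e] by simp
qed

sublocale paths p f letter "\<lambda>j. z div p ^ j mod p"
proof
  show "letter j a \<le> letter j b" if "j < f" "a \<le> b" for j a b
    using letter_less_iff[OF that(1), of a "Suc (letter j b)"] letter_bounds(2)[OF that(1), of b] that(2) by simp
  show "letter j a + f \<le> letter j (a + (p - 1))" if "j < f" for j a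
    using letter_less_iff[OF that, of "a + (p - 1)" "letter j a + f"] cap_gap[OF letter_mod[OF that, of a]]
      letter_bounds(1)[OF that, of a] by linarith
qed (use p2 f1 letter_mod in auto)

lemma card_letter: "j < f \<Longrightarrow> card {k. k < a \<and> letter j k = e} \<le> M e"
proof -
  assume j: "j < f"
  have "{k. k < a \<and> letter j k = e} \<subseteq> {cap j e..<cap j (Suc e)}"
    using letter_bounds[OF j] by auto
  hence "card {k. k < a \<and> letter j k = e} \<le> card {cap j e..<cap j (Suc e)}" by (intro card_mono) auto
  also have "... \<le> M e" by (simp add: cap_Suc)
  finally show ?thesis .
qed

definition cls :: "nat \<Rightarrow> nat \<Rightarrow> nat" where
  "cls n j = (\<Sum>e<N. if e mod f = j then n div p ^ e mod p else 0)"

text \<open>Any choice of letters costs at least as much as the cheapest choice of the same size.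
  The bound by \<open>cap j E\<close> is carried through the induction because it guarantees that
  the next letters in the cheapest list still have exponent at most \<open>E\<close>.\<close>

lemma lsum_le:
  assumes j: "j < f" and d: "\<And>e. e < E \<Longrightarrow> d e \<le> M e"
  shows "(\<Sum>e<E. if e mod f = j then d e else 0) \<le> cap j E \<and>
    lsum j (\<Sum>e<E. if e mod f = j then d e else 0) \<le> (\<Sum>e<E. if e mod f = j then int (d e * p ^ e) else 0)"
  using d
proof (induction E)
  case (Suc E)
  define a where "a = (\<Sum>e<E. if e mod f = j then d e else 0)"
  have IH: "a \<le> cap j E" "lsum j a \<le> (\<Sum>e<E. if e mod f = j then int (d e * p ^ e) else 0)"
    using Suc by (auto simp: a_def)
  show ?case
  proof (cases "E mod f = j")
    case True
    have "int p ^ letter j (a + k) \<le> int p ^ E" if "k < d E" for k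
    proof -
      have "a + k < cap j (Suc E)" using that Suc.prems[of E] IH(1) True by (simp add: cap_Suc)
      thus ?thesis using letter_less_iff[OF j, of "a + k" "Suc E"] by (intro p_pow_mono) simp
    qed
    hence "(\<Sum>k<d E. int p ^ letter j (a + k)) \<le> (\<Sum>k<d E. int p ^ E)" by (intro sum_mono) auto
    hence "lsum j (a + d E) \<le> lsum j a + int (d E * p ^ E)" by (simp add: lsum_add)
    thus ?thesis using True IH Suc.prems[of E] by (simp add: a_def cap_Suc)
  next
    case False
    thus ?thesis using IH by (simp add: a_def cap_Suc)
  qed
qed simp

lemma dig_le_less: "dig_le p n m \<Longrightarrow> n < p ^ N"
  using dig_le_le[of p n m] p2 m by simp

lemma dig_le_M: "dig_le p n m \<Longrightarrow> e < N \<Longrightarrow> n div p ^ e mod p \<le> M e"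
  by (simp add: dig_le_def M_def)

text \<open>Collecting the digits of \<open>n\<close> by class gives letter counts with the residue
  of \<open>n\<close>, and reducing them to the digits of \<open>z\<close> produces the carries. The
  cost can be smaller than \<open>n\<close>, since it takes the cheapest letters for the same
  counts.\<close>

lemma vec_exists:
  assumes n: "dig_le p n m" "[n = z] (mod (p ^ f - 1))"
  shows "\<exists>i. i \<in> P \<and> (\<forall>j<f. cnt i j = cls n j) \<and> cost i \<le> int n"
proof -
  have dig: "n = (\<Sum>e<N. (n div p ^ e mod p) * p ^ e)" using sum_digits[of n p N] dig_le_less[OF n(1)] by simp
  have "[(\<Sum>e<N. (n div p ^ e mod p) * p ^ (e mod f)) = (\<Sum>e<N. (n div p ^ e mod p) * p ^ e)] (mod (p ^ f - 1))"
    using p2 by (intro cong_sum cong_mult cong_refl cong_sym[OF cong_pow_mod]) auto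
  moreover have "(\<Sum>e<N. (n div p ^ e mod p) * p ^ (e mod f)) = (\<Sum>j<f. cls n j * p ^ j)"
    unfolding sum_mod_classes[OF f1, of "\<lambda>e. (n div p ^ e mod p) * p ^ (e mod f)"] cls_def
    by (auto simp: sum_distrib_right intro!: sum.cong)
  ultimately have "[(\<Sum>j<f. cls n j * p ^ j) = z] (mod (p ^ f - 1))"
    using n(2) dig by (metis cong_trans)
  from carry_vector[OF p2 f1 z this] obtain i0 where
    i0: "\<forall>j<f. cls n j + i0 ((j + f - 1) mod f) = p * i0 j + z div p ^ j mod p" by blast
  define i where "i j = (if j < f then int (i0 j) else 0)" for j
  have eq: "int (cls n j) + i (pre j) = int p * i j + int (z div p ^ j mod p)" if "j < f" for j
  proof -
    have "int (cls n j + i0 (pre j)) = int (p * i0 j + z div p ^ j mod p)" using i0 that by (simp add: pre_def)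
    thus ?thesis using that by (simp add: i_def)
  qed
  have iP: "i \<in> P"
  proof (rule P_I)
    show "i (pre j) \<le> int p * i j + int (z div p ^ j mod p)" if "j < f" for j
      unfolding eq[OF that, symmetric] by simp
  qed (auto simp: i_def)
  have c: "cnt i j = cls n j" if "j < f" for j using int_cnt[OF iP that] eq[OF that] by simp
  have "cost i = (\<Sum>j<f. lsum j (cls n j))" by (simp add: cost_def c)
  also have "... \<le> (\<Sum>j<f. \<Sum>e<N. if e mod f = j then int ((n div p ^ e mod p) * p ^ e) else 0)"
    unfolding cls_def using lsum_le[of _ N "\<lambda>e. n div p ^ e mod p"] dig_le_M[OF n(1)] by (intro sum_mono) auto
  also have "... = (\<Sum>e<N. int ((n div p ^ e mod p) * p ^ e))" by (rule sum_mod_classes[OF f1, symmetric])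
  also have "... = int (\<Sum>e<N. (n div p ^ e mod p) * p ^ e)" by (rule of_nat_sum[symmetric])
  also have "... = int n" by (simp only: dig[symmetric])
  finally show ?thesis using iP c by blast
qed

text \<open>Digitwise growth gives \<open>\<delta> (pre k) \<le> p * \<delta> k\<close> for the
  differences. At a minimum this rules out negative values. A zero would spread to all predecessors
  around the cycle and make the vectors equal, although some letter count has grown.\<close>

lemma vec_strict:
  assumes i: "i \<in> P" "\<And>j. j < f \<Longrightarrow> cnt i j = cls n j" and i': "i' \<in> P" "\<And>j. j < f \<Longrightarrow> cnt i' j = cls n' j"
    and n: "dig_le p n n'" "n \<noteq> n'" "n < p ^ N" "n' < p ^ N" and j: "j < f"
  shows "i j < i' j"
proof -
  have le: "cls n j \<le> cls n' j" for j unfolding cls_def using n(1) by (intro sum_mono) (auto simp: dig_le_def)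
  have "\<exists>e<N. n div p ^ e mod p \<noteq> n' div p ^ e mod p"
  proof (rule ccontr)
    assume "\<not> ?thesis"
    hence "(\<Sum>e<N. (n div p ^ e mod p) * p ^ e) = (\<Sum>e<N. (n' div p ^ e mod p) * p ^ e)" by simp
    thus False using n unfolding sum_digits by simp
  qed
  then obtain e where e: "e < N" "n div p ^ e mod p < n' div p ^ e mod p"
    using n(1) by (force simp: dig_le_def less_le)
  have "cls n (e mod f) < cls n' (e mod f)" unfolding cls_def
    using n(1) e by (intro sum_strict_mono_ex1) (auto simp: dig_le_def)
  hence ne: "i \<noteq> i'" using i i' f1 by fastforce
  define \<delta> where "\<delta> k = i' k - i k" for k
  have step: "\<delta> (pre k) \<le> int p * \<delta> k" if "k < f" for k
    using int_cnt[OF i(1) that] int_cnt[OF i'(1) that] i(2)[OF that] i'(2)[OF that] le[of k]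
    by (simp add: \<delta>_def algebra_simps)
  have fin: "finite (\<delta> ` {..<f})" "\<delta> ` {..<f} \<noteq> {}" using f1 by (auto simp: lessThan_empty_iff)
  obtain a where a: "a < f" "\<delta> a = Min (\<delta> ` {..<f})" using Min_in[OF fin] by auto
  have min: "\<delta> a \<le> \<delta> k" if "k < f" for k using a(2) fin that by simp
  have nonneg: "0 \<le> \<delta> a"
  proof (rule ccontr)
    assume neg: "\<not> 0 \<le> \<delta> a"
    have "\<delta> a \<le> int p * \<delta> a" using step[OF a(1)] min[of "pre a"] by simp
    moreover have "int p * \<delta> a \<le> 2 * \<delta> a" using neg p2 by (intro mult_right_mono_neg) auto
    ultimately show False using neg by simp
  qed
  have "\<delta> j \<noteq> 0"
  proof
    assume "\<delta> j = 0"
    have zero: "\<delta> (pre k) = 0" if "k < f" "\<delta> k = 0" for k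
      using step[OF that(1)] min[of "pre k"] nonneg that by simp
    have down: "\<delta> (k - t) = 0" if "k < f" "\<delta> k = 0" "t \<le> k" for k t
      using that(3)
    proof (induction t)
      case (Suc t)
      have "pre (k - t) = k - Suc t" using Suc.prems that(1) by (simp add: pre_def mod_if)
      thus ?case using zero[of "k - t"] Suc that(1) by simp
    qed (use that in simp)
    have "\<delta> 0 = 0" using down[OF j \<open>\<delta> j = 0\<close>, of j] by simp
    hence "\<delta> (f - 1) = 0" using zero[of 0] f1 by (simp add: pre_def)
    hence "\<delta> k = 0" if "k < f" for k using down[of "f - 1" "f - 1 - k"] that by simp
    hence "i = i'" by (intro P_eqI[OF i(1) i'(1)]) (simp add: \<delta>_def)
    thus False using ne by simp
  qed
  thus ?thesis using min[OF j] nonneg by (simp add: \<delta>_def)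
qed

section \<open>From vectors back to numbers\<close>

definition num :: "(nat \<Rightarrow> int) \<Rightarrow> nat" where "num i = nat (cost i)"

lemma int_num: "int (num i) = cost i"
  by (simp add: num_def cost_nonneg)

text \<open>The bound on the cost keeps all letters below exponent \<open>N\<close>, so no padding
  letter occurs.\<close>

lemma num_expansion:
  assumes "cost i < int p ^ N"
  shows "num i = (\<Sum>e<N. card {k. k < cnt i (e mod f) \<and> letter (e mod f) k = e} * p ^ e)"
proof -
  define c where "c j e = card {k. k < cnt i j \<and> letter j k = e}" for j e
  have *: "lsum j (cnt i j) = (\<Sum>e<N. if e mod f = j then int (c (e mod f) e * p ^ e) else 0)" if j: "j < f" for j
  proof -
    have lt: "letter j k < N" if "k < cnt i j" for k
    proof -
      have "int p ^ letter j k \<le> lsum j (cnt i j)"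
        unfolding lsum_def using that by (intro member_le_sum[of k "{..<cnt i j}" "\<lambda>k. int p ^ letter j k"]) auto
      also have "... \<le> cost i" unfolding cost_def
        using j by (intro member_le_sum[of j "{..<f}" "\<lambda>j. lsum j (cnt i j)"]) (auto simp: lsum_nonneg)
      finally have "int p ^ letter j k < int p ^ N" using assms by simp
      thus ?thesis using p2 by (simp add: power_strict_increasing_iff)
    qed
    have "lsum j (cnt i j) = (\<Sum>e<N. \<Sum>k\<in>{k\<in>{..<cnt i j}. letter j k = e}. int p ^ letter j k)"
      unfolding lsum_def using lt by (intro sum.group[symmetric]) auto
    also have "... = (\<Sum>e<N. if e mod f = j then int (c (e mod f) e * p ^ e) else 0)"
    proof (rule sum.cong[OF refl])
      fix e
      have "(\<Sum>k\<in>{k\<in>{..<cnt i j}. letter j k = e}. int p ^ letter j k) = int (c j e * p ^ e)"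
        by (simp add: c_def)
      moreover have "c j e = 0" if "e mod f \<noteq> j" using that letter_mod[OF j] by (auto simp: c_def)
      ultimately show "(\<Sum>k\<in>{k\<in>{..<cnt i j}. letter j k = e}. int p ^ letter j k) = (if e mod f = j then int (c (e mod f) e * p ^ e) else 0)"
        by auto
    qed
    finally show ?thesis .
  qed
  have "int (num i) = (\<Sum>j<f. \<Sum>e<N. if e mod f = j then int (c (e mod f) e * p ^ e) else 0)"
    by (simp add: int_num cost_def *)
  also have "... = (\<Sum>e<N. int (c (e mod f) e * p ^ e))" by (rule sum_mod_classes[OF f1, symmetric])
  also have "... = int (\<Sum>e<N. c (e mod f) e * p ^ e)" by simp
  finally show ?thesis unfolding c_def of_nat_eq_iff .
qed

text \<open>Each exponent occurs at most \<open>p - 1\<close> times among the letters, so the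
  multiplicities are the digits, without any carry.\<close>

lemma num_digit:
  assumes i: "cost i < int p ^ N"
  shows "num i div p ^ e mod p = (if e < N then card {k. k < cnt i (e mod f) \<and> letter (e mod f) k = e} else 0)"
proof (cases "e < N")
  case True
  have "card {k. k < cnt i (e mod f) \<and> letter (e mod f) k = e} < p" for e
    using card_letter[of "e mod f" "cnt i (e mod f)" e] M_le[of e] f1 p2 by simp
  thus ?thesis using True unfolding num_expansion[OF i] by (subst digit_of_sum) auto
next
  case False
  have "num i < p ^ N" using i int_num[of i] by (metis of_nat_less_iff of_nat_power)
  also have "... \<le> p ^ e" using False p2 by (intro power_increasing) auto
  finally show ?thesis using False by simp
qed

lemma num_dig_le:
  assumes i: "cost i < int p ^ N"
  shows "dig_le p (num i) m"
  unfolding dig_le_def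
proof
  fix e
  show "num i div p ^ e mod p \<le> m div p ^ e mod p"
    using card_letter[of "e mod f" "cnt i (e mod f)" e] f1 by (auto simp: num_digit[OF i] M_def split: if_splits)
qed

text \<open>Larger counts take longer initial segments of the same lists of letters, so no
  multiplicity drops.\<close>

lemma num_dig_le_num:
  assumes "cost i < int p ^ N" "cost i' < int p ^ N" "\<And>j. j < f \<Longrightarrow> cnt i j \<le> cnt i' j"
  shows "dig_le p (num i) (num i')"
  unfolding dig_le_def
proof
  fix e
  have "cnt i (e mod f) \<le> cnt i' (e mod f)" using assms(3) f1 by simp
  hence "card {k. k < cnt i (e mod f) \<and> letter (e mod f) k = e} \<le> card {k. k < cnt i' (e mod f) \<and> letter (e mod f) k = e}"
    by (intro card_mono) auto
  thus "num i div p ^ e mod p \<le> num i' div p ^ e mod p" by (simp add: num_digit assms(1,2))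
qed

text \<open>Modulo \<open>p ^ f - 1\<close>, multiplication by \<open>p\<close> rotates the classes.
  The two carry terms in \<open>cnt\<close> therefore contribute congruent sums, and they
  cancel.\<close>

lemma num_cong:
  assumes i: "i \<in> P"
  shows "[num i = z] (mod (p ^ f - 1))"
proof -
  define i0 where "i0 j = nat (i j)" for j
  have i0: "cnt i j + i0 (pre j) = p * i0 j + z div p ^ j mod p" if "j < f" for j
  proof -
    have "int (i0 k) = i k" for k using P_D(2)[OF i, of k] by (simp add: i0_def)
    hence "int (cnt i j + i0 (pre j)) = int (p * i0 j + z div p ^ j mod p)"
      by (simp only: of_nat_add of_nat_mult int_cnt[OF i that] diff_add_cancel)
    thus ?thesis by (simp only: of_nat_eq_iff)
  qed
  have "int (num i) = int (\<Sum>j<f. \<Sum>k<cnt i j. p ^ letter j k)"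
    by (simp add: int_num cost_def lsum_def)
  hence num: "num i = (\<Sum>j<f. \<Sum>k<cnt i j. p ^ letter j k)" by linarith
  have "[(\<Sum>j<f. \<Sum>k<cnt i j. p ^ letter j k) = (\<Sum>j<f. \<Sum>k<cnt i j. p ^ j)] (mod (p ^ f - 1))"
  proof (intro cong_sum)
    fix j k assume "j \<in> {..<f}"
    thus "[p ^ letter j k = p ^ j] (mod (p ^ f - 1))"
      using cong_pow_mod[of p "letter j k" f] letter_mod[of j k] p2 by simp
  qed
  hence 1: "[num i = (\<Sum>j<f. cnt i j * p ^ j)] (mod (p ^ f - 1))"
    unfolding num by (simp only: sum_constant card_lessThan of_nat_id)
  have "(\<Sum>j<f. cnt i j * p ^ j) + (\<Sum>j<f. i0 (pre j) * p ^ j) = (\<Sum>j<f. (cnt i j + i0 (pre j)) * p ^ j)"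
    by (simp add: sum.distrib add_mult_distrib)
  also have "... = (\<Sum>j<f. (p * i0 j + z div p ^ j mod p) * p ^ j)"
    by (intro sum.cong) (auto simp: i0)
  also have "... = (\<Sum>j<f. i0 j * p ^ Suc j) + (\<Sum>j<f. (z div p ^ j mod p) * p ^ j)"
    unfolding sum.distrib[symmetric] by (intro sum.cong) (auto simp: algebra_simps)
  also have "(\<Sum>j<f. (z div p ^ j mod p) * p ^ j) = z"
    unfolding sum_digits using z by simp
  finally have 2: "(\<Sum>j<f. cnt i j * p ^ j) + (\<Sum>j<f. i0 (pre j) * p ^ j) = (\<Sum>j<f. i0 j * p ^ Suc j) + z" .
  have "(\<Sum>j<f. i0 (pre j) * p ^ j) = (\<Sum>j<f. i0 j * p ^ (Suc j mod f))"
  proof (rule sum.reindex_bij_witness[of _ "\<lambda>j. Suc j mod f" pre])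
    fix j assume "j \<in> {..<f}"
    hence j: "j < f" by simp
    show "Suc (pre j) mod f = j" using j by (cases j) (auto simp: pre_def mod_if)
    thus "i0 (pre j) * p ^ (Suc (pre j) mod f) = i0 (pre j) * p ^ j" by simp
    show "pre (Suc j mod f) = j" using j by (cases "Suc j = f") (auto simp: pre_def mod_if)
    show "Suc j mod f \<in> {..<f}" "pre j \<in> {..<f}" using j by auto
  qed
  moreover have "[(\<Sum>j<f. i0 j * p ^ Suc j) = (\<Sum>j<f. i0 j * p ^ (Suc j mod f))] (mod (p ^ f - 1))"
    using p2 by (intro cong_sum cong_mult cong_refl cong_pow_mod) auto
  ultimately have "[(\<Sum>j<f. i0 j * p ^ Suc j) + z = (\<Sum>j<f. i0 (pre j) * p ^ j) + z] (mod (p ^ f - 1))"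
    by (intro cong_add cong_refl) (simp only:)
  hence "[(\<Sum>j<f. cnt i j * p ^ j) + (\<Sum>j<f. i0 (pre j) * p ^ j) = z + (\<Sum>j<f. i0 (pre j) * p ^ j)] (mod (p ^ f - 1))"
    by (simp only: 2 add.commute[of z])
  hence "[(\<Sum>j<f. cnt i j * p ^ j) = z] (mod (p ^ f - 1))" by (simp only: cong_add_rcancel_nat)
  thus ?thesis by (rule cong_trans[OF 1])
qed

lemma nchain_chain:
  assumes \<nu>: "nchain p f z d \<nu> m"
  shows "\<exists>u. chain d u \<and> (\<forall>k<d. cost (u k) \<le> int (\<nu> k))"
proof -
  have "\<forall>k. \<exists>i. k < d \<longrightarrow> i \<in> P \<and> (\<forall>j<f. cnt i j = cls (\<nu> k) j) \<and> cost i \<le> int (\<nu> k)"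
    using \<nu> vec_exists by (simp add: nchain_def)
  from choice[OF this] obtain u where
    u: "\<And>k. k < d \<Longrightarrow> u k \<in> P" "\<And>k j. k < d \<Longrightarrow> j < f \<Longrightarrow> cnt (u k) j = cls (\<nu> k) j"
    "\<And>k. k < d \<Longrightarrow> cost (u k) \<le> int (\<nu> k)" by blast
  have "u k j < u (Suc k) j" if k: "Suc k < d" "j < f" for k j
  proof (rule vec_strict[of "u k" "\<nu> k" "u (Suc k)" "\<nu> (Suc k)"])
    have k': "k < d" using k by simp
    show "u k \<in> P" "u (Suc k) \<in> P" using u(1) k k' by blast+
    show "cnt (u k) j = cls (\<nu> k) j" "cnt (u (Suc k)) j = cls (\<nu> (Suc k)) j" if "j < f" for j
      using u(2) k k' that by blast+
    show "dig_le p (\<nu> k) (\<nu> (Suc k))" "\<nu> k \<noteq> \<nu> (Suc k)" using \<nu> k by (auto simp: nchain_def)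
    show "\<nu> k < p ^ N" "\<nu> (Suc k) < p ^ N" using \<nu> k k' by (auto simp: nchain_def intro: dig_le_less)
  qed (use k in simp)
  hence "chain d u" using u by (auto simp: chain_def)
  thus ?thesis using u(3) by blast
qed

lemma min_cost_le_nchain: "nchain p f z d \<nu> m \<Longrightarrow> min_cost d \<le> int (\<Sum>k<d. \<nu> k)"
proof -
  assume "nchain p f z d \<nu> m"
  from nchain_chain[OF this] obtain u where u: "chain d u" "\<forall>k<d. cost (u k) \<le> int (\<nu> k)" by blast
  have "min_cost d \<le> ccost d u" using u(1) by (rule min_cost_le)
  also have "... \<le> (\<Sum>k<d. int (\<nu> k))" unfolding ccost_def using u(2) by (intro sum_mono) auto
  finally show ?thesis by simp
qed

text \<open>The numbers come from the optimal chain of vectors, whose nested counts make them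
  digitwise increasing. Any chain of numbers with the same sum gives a chain of vectors that costs
  no more, hence the optimal one, and then no number can exceed the cost of its vector.\<close>

lemma nchain_opt:
  assumes "min_cost d < int p ^ N"
  shows "\<exists>\<nu>. nchain p f z d \<nu> m \<and> int (\<Sum>k<d. \<nu> k) = min_cost d \<and>
    (\<forall>\<nu>'. nchain p f z d \<nu>' m \<longrightarrow> int (\<Sum>k<d. \<nu>' k) = min_cost d \<longrightarrow> (\<forall>k<d. \<nu>' k = \<nu> k))"
proof -
  obtain u where u: "opt d u" using opt_exists by blast
  hence ch: "chain d u" by (simp add: opt_def)
  define \<nu> where "\<nu> k = num (u k)" for k
  have uP: "u k \<in> P" if "k < d" for k using chain_P[OF ch that] .
  have sum: "int (\<Sum>k<d. \<nu> k) = min_cost d" unfolding min_cost_eq[OF u] ccost_def by (simp add: \<nu>_def int_num)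
  have small: "cost (u k) < int p ^ N" if "k < d" for k
  proof -
    have "cost (u k) \<le> ccost d u" unfolding ccost_def
      using that by (intro member_le_sum[of k "{..<d}" "\<lambda>k. cost (u k)"]) (auto simp: cost_nonneg)
    thus ?thesis using assms min_cost_eq[OF u] by simp
  qed
  have "nchain p f z d \<nu> m"
    unfolding nchain_def
  proof (intro conjI allI impI)
    fix k assume k: "k < d"
    show "[\<nu> k = z] (mod (p ^ f - 1))" "dig_le p (\<nu> k) m" unfolding \<nu>_def
      using num_cong[OF uP[OF k]] num_dig_le[OF small[OF k]] by auto
  next
    fix k assume k: "Suc k < d"
    show "dig_le p (\<nu> k) (\<nu> (Suc k))" unfolding \<nu>_def
      using small opt_nested[OF u k] k by (intro num_dig_le_num) auto
    show "\<nu> k \<noteq> \<nu> (Suc k)"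
    proof
      assume "\<nu> k = \<nu> (Suc k)"
      hence "cost (u k) = cost (u (Suc k))" using int_num by (metis \<nu>_def)
      hence "u k = u (Suc k)" using uP k by (intro cost_inj) auto
      moreover have "u k 0 < u (Suc k) 0" using ch k f1 by (auto simp: chain_def)
      ultimately show False by simp
    qed
  qed
  moreover have "\<nu>' k = \<nu> k" if \<nu>': "nchain p f z d \<nu>' m" "int (\<Sum>k<d. \<nu>' k) = min_cost d" and k: "k < d" for \<nu>' k
  proof -
    obtain v where v: "chain d v" "\<forall>k<d. cost (v k) \<le> int (\<nu>' k)" using nchain_chain[OF \<nu>'(1)] by blast
    have le: "ccost d v \<le> min_cost d" unfolding \<nu>'(2)[symmetric] ccost_def using v(2) by (auto intro!: sum_mono)
    hence "opt d v" by (rule optI[OF v(1)])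
    hence eq: "v k = u k" using opt_unique u k by blast
    have "cost (v k) = int (\<nu>' k)"
    proof (rule ccontr)
      assume "cost (v k) \<noteq> int (\<nu>' k)"
      hence "cost (v k) < int (\<nu>' k)" using v(2) k by force
      hence "ccost d v < (\<Sum>k<d. int (\<nu>' k))" unfolding ccost_def
        using v(2) k by (intro sum_strict_mono_ex1) auto
      thus False using min_cost_le[OF v(1)] \<nu>'(2) by simp
    qed
    thus ?thesis using eq by (simp add: \<nu>_def num_def)
  qed
  ultimately show ?thesis using sum by blast
qed

end

text \<open>\<open>g\<close> is the minimal cost over the padded alphabet. It is thereby defined and
  strictly convex for every \<open>d\<close>, even if \<open>m\<close> admits no chain of that
  length; only values below \<open>p ^ N\<close> are claimed to be attained.\<close>

theorem min_chain_cost: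
  fixes p f N m z :: nat
  assumes "2 \<le> p" "1 \<le> f" "m < p ^ N" "z < p ^ f - 1"
  obtains g :: "nat \<Rightarrow> nat" where "g 0 = 0" "\<And>d. g d \<le> g (Suc d)"
    "\<And>d. 2 * g (Suc d) < g (Suc (Suc d)) + g d"
    "\<And>d \<nu>. nchain p f z d \<nu> m \<Longrightarrow> g d \<le> (\<Sum>k<d. \<nu> k)"
    "\<And>d. g d < p ^ N \<Longrightarrow> \<exists>\<nu>. nchain p f z d \<nu> m \<and> (\<Sum>k<d. \<nu> k) = g d \<and>
       (\<forall>\<nu>'. nchain p f z d \<nu>' m \<longrightarrow> (\<Sum>k<d. \<nu>' k) = g d \<longrightarrow> (\<forall>k<d. \<nu>' k = \<nu> k))"
proof -
  interpret digits p f N m z using assms by unfold_locales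
  define g where "g d = nat (min_cost d)" for d
  have g: "int (g d) = min_cost d" for d by (simp add: g_def min_cost_nonneg)
  show ?thesis
  proof (rule that[of g])
    show "g 0 = 0" by (simp add: g_def)
    show "g d \<le> g (Suc d)" for d using min_cost_mono[of d] by (simp add: g_def)
    show "2 * g (Suc d) < g (Suc (Suc d)) + g d" for d using min_cost_convex[of d] by (simp flip: g)
    show "g d \<le> (\<Sum>k<d. \<nu> k)" if "nchain p f z d \<nu> m" for d \<nu>
      using min_cost_le_nchain[OF that] by (simp flip: g of_nat_sum)
    fix d assume "g d < p ^ N"
    hence "min_cost d < int p ^ N" unfolding g[symmetric] by (metis of_nat_less_iff of_nat_power)
    from nchain_opt[OF this] show "\<exists>\<nu>. nchain p f z d \<nu> m \<and> (\<Sum>k<d. \<nu> k) = g d \<and>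
       (\<forall>\<nu>'. nchain p f z d \<nu>' m \<longrightarrow> (\<Sum>k<d. \<nu>' k) = g d \<longrightarrow> (\<forall>k<d. \<nu>' k = \<nu> k))"
      unfolding g[symmetric] of_nat_eq_iff .
  qed
qed

section \<open>Power sums over finite fields\<close>

lemma dig_le_0: "dig_le p 0 n" by (simp add: dig_le_def)

lemma dig_le_rec: "dig_le p k n \<longleftrightarrow> k mod p \<le> n mod p \<and> dig_le p (k div p) (n div p)"
proof -
  have "dig_le p k n \<longleftrightarrow> k div p ^ 0 mod p \<le> n div p ^ 0 mod p \<and> (\<forall>e. k div p ^ Suc e mod p \<le> n div p ^ Suc e mod p)"
    unfolding dig_le_def by (metis not0_implies_Suc)
  thus ?thesis unfolding dig_le_def by (simp add: div_mult2_eq)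
qed

section \<open>Lucas' criterion for binomial coefficients\<close>

lemma coeff_one_plus_X_power:
  "Polynomial.coeff ([:1, 1:] ^ n :: 'a::comm_ring_1 poly) i = of_nat (n choose i)"
proof (cases "i \<le> n")
  case False
  have "Polynomial.degree ([:1, 1:] ^ n :: 'a poly) \<le> 1 * n"
    by (rule order_trans[OF degree_power_le]) auto
  thus ?thesis using False by (simp add: coeff_eq_0 binomial_eq_0)
qed (simp add: coeff_linear_poly_power)

text \<open>Coefficients are compared in
  \<open>(1 + X) ^ n = (1 + X ^ p) ^ (n div p) * (1 + X) ^ (n mod p)\<close>. The last factor has
  degree below \<open>p\<close>, so a single term contributes to each coefficient.\<close>

lemma of_nat_binomial_rec:
  fixes n k :: nat
  assumes prime: "Factorial_Ring.prime CHAR('a::comm_ring_1)"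
  defines "p \<equiv> CHAR('a)"
  shows "(of_nat (n choose k) :: 'a) = of_nat ((n div p) choose (k div p)) * of_nat ((n mod p) choose (k mod p))"
proof -
  let ?Q = "[:1, 1:] ^ (n mod p) :: 'a poly"
  define a where "a = n div p"
  have p0: "0 < p" using prime by (simp add: p_def prime_gt_0_nat)
  have "[:1, 1:] ^ p = (Polynomial.monom 1 1 + 1 :: 'a poly) ^ p"
    by (simp add: monom_Suc monom_0 one_pCons)
  also have "... = Polynomial.monom 1 1 ^ p + 1 ^ p"
    by (rule freshmans_dream) (use prime in \<open>simp_all add: p_def\<close>)
  also have "... = Polynomial.monom 1 p + 1" by (simp add: monom_power)
  finally have fr: "[:1, 1:] ^ p = (Polynomial.monom 1 p + 1 :: 'a poly)" .
  have "[:1, 1:] ^ n = ([:1, 1:] ^ p) ^ a * (?Q :: 'a poly)"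
    by (simp add: a_def flip: power_mult power_add)
  also have "([:1, 1:] ^ p) ^ a = (\<Sum>i\<le>a. Polynomial.monom (of_nat (a choose i)) (p * i) :: 'a poly)"
    unfolding fr binomial_ring
    by (intro sum.cong refl) (simp add: monom_power of_nat_poly mult_monom flip: monom_0)
  also have "... * ?Q = (\<Sum>i\<le>a. Polynomial.monom (of_nat (a choose i)) (p * i) * ?Q)"
    by (rule sum_distrib_right)
  finally have "of_nat (n choose k) = (\<Sum>i\<le>a. Polynomial.coeff (Polynomial.monom (of_nat (a choose i)) (p * i) * ?Q) k)"
    by (metis (no_types, lifting) coeff_one_plus_X_power coeff_sum sum.cong)
  also have "... = (\<Sum>i\<le>a. if i = k div p then of_nat (a choose (k div p)) * of_nat ((n mod p) choose (k mod p)) else 0)"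
  proof (rule sum.cong[OF refl])
    fix i
    consider "k < p * i" | "i = k div p" | "p * i + p \<le> k"
    proof (cases i "k div p" rule: linorder_cases)
      case less
      hence "p * Suc i \<le> p * (k div p)" by (intro mult_le_mono2) simp
      also have "... \<le> k" by simp
      finally show ?thesis using that by simp
    next
      case greater
      thus ?thesis using p0 that by (simp add: div_less_iff_less_mult mult.commute)
    qed (use that in simp)
    thus "Polynomial.coeff (Polynomial.monom (of_nat (a choose i)) (p * i) * ?Q) k =
      (if i = k div p then of_nat (a choose (k div p)) * of_nat ((n mod p) choose (k mod p)) else 0)"
    proof cases
      case 1
      moreover have "p * (k div p) \<le> k" by simp
      ultimately have "i \<noteq> k div p" by (metis not_less)
      thus ?thesis using 1 by (simp add: coeff_monom_mult)
    next
      case 2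
      moreover have "\<not> k < p * (k div p)" by (simp add: not_less)
      ultimately show ?thesis by (simp add: coeff_monom_mult coeff_one_plus_X_power minus_mult_div_eq_mod)
    next
      case 3
      have "k < p * (k div p) + p" using dividend_less_times_div[OF p0] by (simp add: add.commute)
      hence "i \<noteq> k div p" using 3 by auto
      moreover have "n mod p < k - p * i" using 3 p0 mod_less_divisor[OF p0, of n] by linarith
      ultimately show ?thesis by (simp add: coeff_monom_mult coeff_one_plus_X_power binomial_eq_0)
    qed
  qed
  also have "... = of_nat (a choose (k div p)) * of_nat ((n mod p) choose (k mod p))"
    by (simp add: sum.delta' binomial_eq_0)
  finally show ?thesis by (simp add: a_def)
qed

lemma of_nat_binomial_nonzero_iff:
  assumes prime: "Factorial_Ring.prime CHAR('a::idom)"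
  shows "of_nat (n choose k) \<noteq> (0 :: 'a) \<longleftrightarrow> dig_le CHAR('a) k n"
proof (induction n arbitrary: k rule: less_induct)
  case (less n)
  let ?p = "CHAR('a)"
  have p1: "1 < ?p" using prime by (rule prime_gt_1_nat)
  have small: "of_nat ((n mod ?p) choose (k mod ?p)) \<noteq> (0 :: 'a) \<longleftrightarrow> k mod ?p \<le> n mod ?p"
  proof
    assume le: "k mod ?p \<le> n mod ?p"
    have "\<not> ?p dvd fact (n mod ?p)"
      using prime mod_less_divisor[of ?p n] p1 by (simp add: prime_dvd_fact_iff not_le)
    hence "\<not> ?p dvd (n mod ?p) choose (k mod ?p)"
      using binomial_fact_lemma[OF le] by (metis dvd_triv_right dvd_trans)
    thus "of_nat ((n mod ?p) choose (k mod ?p)) \<noteq> (0 :: 'a)" by (simp add: of_nat_eq_0_iff_char_dvd)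
  qed (auto intro: ccontr simp: binomial_eq_0)
  show ?case
  proof (cases "n = 0")
    case True
    show ?thesis
    proof (cases "k = 0")
      case False
      have "\<not> dig_le ?p k 0" using dig_le_le[of ?p k 0] False p1 by auto
      thus ?thesis using True False by (simp add: binomial_eq_0)
    qed (use True in \<open>simp add: dig_le_0\<close>)
  next
    case False
    hence "n div ?p < n" using p1 by simp
    from less.IH[OF this, of "k div ?p"] show ?thesis
      unfolding of_nat_binomial_rec[OF prime, of n k] dig_le_rec[of ?p k n] using small by auto
  qed
qed

section \<open>Cardinality and power sums of finite fields\<close>

lemma prime_CHAR_finite_field: "Factorial_Ring.prime CHAR('a::finite_field)"
  by (simp add: prime_CHAR_semidom finite_imp_CHAR_pos)

text \<open>Among the additive subgroups whose order is a power of \<open>p\<close>, one of largest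
  order is the whole field: adjoining the multiples of an element outside would give one
  \<open>p\<close> times as large.\<close>

lemma card_finite_field: "\<exists>f\<ge>1. CARD('a::finite_field) = CHAR('a) ^ f"
proof -
  let ?p = "CHAR('a)"
  have p1: "1 < ?p" using prime_CHAR_finite_field by (rule prime_gt_1_nat)
  define A where "A H k \<longleftrightarrow> (0 :: 'a) \<in> H \<and> (\<forall>x\<in>H. \<forall>y\<in>H. x - y \<in> H) \<and> card H = ?p ^ k" for H k
  have A0: "A {0} 0" by (simp add: A_def)
  have bound: "k \<le> CARD('a)" if "\<exists>H. A H k" for k
  proof -
    from that obtain H where "A H k" by blast
    hence "card H = ?p ^ k" by (simp add: A_def)
    hence "?p ^ k \<le> CARD('a)" using card_mono[of UNIV H] by simp
    thus ?thesis using power_gt_expt[of ?p k] p1 by simp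
  qed
  define K where "K = {k. \<exists>H. A H k}"
  have fin: "finite K" using bound by (intro finite_subset[of K "{..CARD('a)}"]) (auto simp: K_def)
  define k where "k = Max K"
  have "0 \<in> K" unfolding K_def using A0 by blast
  hence "k \<in> K" unfolding k_def using fin Max_in by blast
  then obtain H where H: "A H k" by (auto simp: K_def)
  have H0: "0 \<in> H" and Hd: "\<And>x y. x \<in> H \<Longrightarrow> y \<in> H \<Longrightarrow> x - y \<in> H" using H by (auto simp: A_def)
  have Hm: "- x \<in> H" if "x \<in> H" for x using Hd[OF H0 that] by simp
  have Ha: "x + y \<in> H" if "x \<in> H" "y \<in> H" for x y using Hd[OF that(1) Hm[OF that(2)]] by simp
  have Hn: "of_nat c * x \<in> H" if "x \<in> H" for x c
    by (induction c) (use H0 Ha that in \<open>auto simp: distrib_right\<close>)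
  have "H = UNIV"
  proof (rule ccontr)
    assume "H \<noteq> UNIV"
    then obtain x where x: "x \<notin> H" by blast
    define H' where "H' = (\<lambda>(h, c). h + of_nat c * x) ` (H \<times> {..<?p})"
    have step: "c = c'" if "h \<in> H" "h' \<in> H" "c \<le> c'" "c' < ?p" "h + of_nat c * x = h' + of_nat c' * x" for h h' c c'
    proof (rule ccontr)
      assume "c \<noteq> c'"
      hence lt: "0 < c' - c" "c' - c < ?p" using that by auto
      have "of_nat (c' - c) * x = h - h'" using that(3,5) by (simp add: of_nat_diff algebra_simps)
      hence "of_nat (c' - c) * x \<in> H" using Hd that by simp
      moreover have "\<not> ?p dvd (c' - c)" using lt by (auto dest: dvd_imp_le)
      hence "coprime ?p (c' - c)" by (rule prime_imp_coprime_nat[OF prime_CHAR_finite_field])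
      hence "coprime (c' - c) ?p" by (subst coprime_commute)
      then obtain b where "[(c' - c) * b = Suc 0] (mod ?p)" using cong_solve_coprime_nat by blast
      hence "of_nat ((c' - c) * b) = (1 :: 'a)"
        by (metis of_nat_1 of_nat_eq_iff_cong_CHAR One_nat_def)
      hence "of_nat b * (of_nat (c' - c) * x) = x"
        by (metis mult.assoc mult.commute mult_1 of_nat_mult)
      ultimately show False using Hn x by metis
    qed
    have inj: "inj_on (\<lambda>(h, c). h + of_nat c * x) (H \<times> {..<?p})"
    proof (rule inj_onI, clarify)
      fix h c h' c' assume *: "h \<in> H" "c < ?p" "h' \<in> H" "c' < ?p" "h + of_nat c * x = h' + of_nat c' * x"
      have "c = c'" using step[of h h' c c'] step[of h' h c' c] * by (cases "c \<le> c'") auto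
      thus "h = h' \<and> c = c'" using * by simp
    qed
    have "card H' = ?p ^ Suc k"
      unfolding H'_def using H card_image[OF inj] by (simp add: card_cartesian_product A_def)
    moreover have "0 \<in> H'" unfolding H'_def using H0 p1 by (auto intro!: image_eqI[of _ _ "(0, 0)"])
    moreover have "u - v \<in> H'" if uv: "u \<in> H'" "v \<in> H'" for u v
    proof -
      from uv obtain h c h' c' where *: "h \<in> H" "c < ?p" "u = h + of_nat c * x" "h' \<in> H" "c' < ?p" "v = h' + of_nat c' * x"
        by (auto simp: H'_def)
      define d where "d = (c + (?p - c')) mod ?p"
      have d: "of_nat d = (of_nat c - of_nat c' :: 'a)"
      proof -
        have "of_nat d = (of_nat (c + (?p - c')) :: 'a)"
          unfolding d_def of_nat_eq_iff_cong_CHAR by (simp add: cong_def)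
        thus ?thesis using * by (simp add: of_nat_diff)
      qed
      have "u - v = (h - h') + of_nat d * x" unfolding d *(3) *(6) by (simp add: algebra_simps)
      moreover have "d < ?p" unfolding d_def using p1 by (intro mod_less_divisor) simp
      ultimately show ?thesis unfolding H'_def using Hd * by (auto intro!: image_eqI[of _ _ "(h - h', d)"])
    qed
    ultimately have "A H' (Suc k)" by (simp add: A_def)
    hence "Suc k \<in> K" by (auto simp: K_def)
    hence "Suc k \<le> k" unfolding k_def using fin by (rule Max_ge[rotated])
    thus False by simp
  qed
  hence card: "CARD('a) = ?p ^ k" using H by (simp add: A_def)
  moreover have "k \<noteq> 0"
  proof
    assume "k = 0"
    hence "CARD('a) = 1" using card by simp
    then obtain y where "(UNIV :: 'a set) = {y}" by (rule card_1_singletonE)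
    hence "(0 :: 'a) = 1" by (metis UNIV_I singletonD)
    thus False by simp
  qed
  ultimately show ?thesis by (intro exI[of _ k]) auto
qed

lemma of_nat_card_finite_field: "of_nat (CARD('a::finite_field)) = (0 :: 'a)"
proof -
  obtain f where "f \<ge> 1" "CARD('a) = CHAR('a) ^ f" using card_finite_field by blast
  hence "CHAR('a) dvd CARD('a)" by (simp add: dvd_power)
  thus ?thesis by (simp add: of_nat_eq_0_iff_char_dvd)
qed

text \<open>If \<open>r\<close> does not divide \<open>e\<close>, some nonzero \<open>g\<close> has
  \<open>g ^ e \<noteq> 1\<close>, because \<open>X ^ s - 1\<close> with \<open>0 < s < r\<close>
  has too few roots. Replacing \<open>c\<close> by \<open>g * c\<close> then forces the sum to
  vanish.\<close>

lemma sum_powers_finite_field: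
  fixes e :: nat
  defines "r \<equiv> CARD('a::finite_field) - 1"
  shows "(\<Sum>c\<in>UNIV - {0 :: 'a}. c ^ e) = (if r dvd e then - 1 else 0)"
proof -
  have r: "CARD('a) = Suc r" using finite_UNIV_card_ge_0[where ?'a='a] by (simp add: r_def)
  have one: "c ^ r = 1" if "c \<noteq> 0" for c :: 'a
    using finite_field_power_card_eq_same[of c] that by (simp add: r)
  show ?thesis
  proof (cases "r dvd e")
    case True
    hence "c ^ e = 1" if "c \<noteq> 0" for c :: 'a using one[OF that] by (auto simp: power_mult)
    hence "(\<Sum>c\<in>UNIV - {0 :: 'a}. c ^ e) = of_nat (card (UNIV - {0 :: 'a}))" by simp
    also have "... = of_nat (CARD('a)) - 1" by (simp add: r card_Diff_singleton)
    also have "of_nat (CARD('a)) = (0 :: 'a)" by (rule of_nat_card_finite_field)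
    finally show ?thesis using True by simp
  next
    case False
    define s where "s = e mod r"
    have r0: "r \<noteq> 0"
    proof
      assume "r = 0"
      then obtain y where "(UNIV :: 'a set) = {y}" using r card_1_singletonE[of "UNIV :: 'a set"] by auto
      hence "(0 :: 'a) = 1" by (metis UNIV_I singletonD)
      thus False by simp
    qed
    have s: "0 < s" "s < r" using False r0 by (auto simp: s_def dvd_eq_mod_eq_0)
    have pow: "c ^ e = c ^ s" if "c \<noteq> 0" for c :: 'a
    proof -
      have "c ^ e = c ^ (r * (e div r) + s)" by (simp add: s_def)
      also have "... = c ^ s" using one[OF that] by (simp add: power_add power_mult)
      finally show ?thesis .
    qed
    have "\<exists>g :: 'a. g \<noteq> 0 \<and> g ^ s \<noteq> 1"
    proof (rule ccontr)
      assume "\<not> ?thesis"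
      hence all: "g ^ s = 1" if "g \<noteq> 0" for g :: 'a using that by blast
      define Q where "Q = Polynomial.monom (1 :: 'a) s - 1"
      have "Polynomial.coeff Q s = 1" using s by (simp add: Q_def)
      hence Q0: "Q \<noteq> 0" by auto
      have "Polynomial.degree Q \<le> s" unfolding Q_def by (intro degree_diff_le) (auto simp: degree_monom_le)
      moreover have "UNIV - {0} \<subseteq> {x. poly Q x = 0}" using all by (auto simp: Q_def poly_monom)
      hence "card (UNIV - {0 :: 'a}) \<le> card {x. poly Q x = 0}" by (intro card_mono poly_roots_finite Q0)
      ultimately show False using card_poly_roots_bound[OF Q0] s r by (simp add: card_Diff_singleton)
    qed
    then obtain g :: 'a where g: "g \<noteq> 0" "g ^ s \<noteq> 1" by blast
    have "(\<Sum>c\<in>UNIV - {0 :: 'a}. c ^ e) = (\<Sum>c\<in>UNIV - {0}. (g * c) ^ e)"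
      by (rule sum.reindex_bij_witness[of _ "\<lambda>c. g * c" "\<lambda>c. c / g"]) (use g in auto)
    also have "... = g ^ e * (\<Sum>c\<in>UNIV - {0 :: 'a}. c ^ e)" by (simp add: power_mult_distrib sum_distrib_left)
    finally have "(1 - g ^ e) * (\<Sum>c\<in>UNIV - {0 :: 'a}. c ^ e) = 0" by (simp add: algebra_simps)
    thus ?thesis using pow[OF g(1)] g(2) False by simp
  qed
qed

section \<open>Coefficients of power sums as sums over chains\<close>

lemma dig_le_trans: "dig_le p a b \<Longrightarrow> dig_le p b c \<Longrightarrow> dig_le p a c"
  by (auto simp: dig_le_def intro: order_trans)

text \<open>Unlike in \<open>nchain\<close>, the last step to n is strict here.\<close>

definition achain :: "nat \<Rightarrow> nat \<Rightarrow> nat \<Rightarrow> nat \<Rightarrow> nat \<Rightarrow> nat \<Rightarrow> (nat \<Rightarrow> nat) \<Rightarrow> bool" where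
  "achain p f z d n s \<nu> \<longleftrightarrow> nchain p f z d \<nu> n \<and> (\<forall>e. d = Suc e \<longrightarrow> \<nu> e \<noteq> n) \<and> (\<Sum>k<d. \<nu> k) = s"

lemma achain_extend:
  assumes "achain p f z d j s \<nu>" "[j = z] (mod (p ^ f - 1))" "dig_le p j n"
  shows "nchain p f z (Suc d) (\<nu>(d := j)) n" "(\<Sum>k<Suc d. (\<nu>(d := j)) k) = j + s"
proof -
  have d: "dig_le p (\<nu> k) j" if "k < d" for k using assms(1) that by (auto simp: achain_def nchain_def)
  show "nchain p f z (Suc d) (\<nu>(d := j)) n"
    unfolding nchain_def
  proof (intro conjI allI impI)
    fix k assume "k < Suc d"
    thus "[(\<nu>(d := j)) k = z] (mod (p ^ f - 1))" "dig_le p ((\<nu>(d := j)) k) n"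
      using assms dig_le_trans[OF d assms(3)] by (auto simp: achain_def nchain_def less_Suc_eq)
  next
    fix k assume k: "Suc k < Suc d"
    thus "(\<nu>(d := j)) k \<noteq> (\<nu>(d := j)) (Suc k)" "dig_le p ((\<nu>(d := j)) k) ((\<nu>(d := j)) (Suc k))"
      using assms(1) d[of k] by (cases "Suc k = d"; auto simp: achain_def nchain_def)+
  qed
  show "(\<Sum>k<Suc d. (\<nu>(d := j)) k) = j + s" using assms(1) by (simp add: achain_def)
qed

lemma achain_restrict:
  assumes "nchain p f z (Suc d) \<nu> n" "(\<Sum>k<Suc d. \<nu> k) = s"
  shows "achain p f z d (\<nu> d) (s - \<nu> d) \<nu>" "\<nu> d \<le> s"
proof -
  have "dig_le p (\<nu> k) (\<nu> d)" if "k < d" for k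
  proof -
    have "dig_le p (\<nu> k) (\<nu> d)" if "k \<le> d" for k
      using that
    proof (induction rule: inc_induct)
      case (step k)
      have "dig_le p (\<nu> k) (\<nu> (Suc k))" using assms(1) step.hyps by (simp add: nchain_def)
      thus ?case using step.IH by (rule dig_le_trans)
    qed (simp add: dig_le_def)
    thus ?thesis using that by simp
  qed
  thus "achain p f z d (\<nu> d) (s - \<nu> d) \<nu>" using assms by (auto simp: achain_def nchain_def)
  show "\<nu> d \<le> s" using assms(2) by auto
qed

text \<open>The common recursion step of the power sums: the index j is the new top of a chain.\<close>

lemma chain_sum_step:
  fixes n :: nat and V :: "nat \<Rightarrow> 'a::finite_field fps" and Q :: "nat \<Rightarrow> bool"
  assumes p: "p = CHAR('a)"
    and S: "\<And>s. S s = (\<Sum>j | j \<le> n \<and> Q j. of_nat (n choose j) * (if s < j then 0 else fps_nth (V j) (s - j)))"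
    and nz: "\<And>j s. fps_nth (V j) s \<noteq> 0 \<Longrightarrow> [j = z] (mod (p ^ f - 1)) \<and> (\<exists>\<nu>. achain p f z d j s \<nu>)"
    and uniq: "\<And>j s \<nu>. [j = z] (mod (p ^ f - 1)) \<Longrightarrow> achain p f z d j s \<nu> \<Longrightarrow>
       (\<And>\<nu>'. achain p f z d j s \<nu>' \<Longrightarrow> \<forall>k<d. \<nu>' k = \<nu> k) \<Longrightarrow> fps_nth (V j) s \<noteq> 0"
  shows "S s \<noteq> 0 \<Longrightarrow> \<exists>\<nu>. nchain p f z (Suc d) \<nu> n \<and> Q (\<nu> d) \<and> (\<Sum>k<Suc d. \<nu> k) = s"
    and "nchain p f z (Suc d) \<nu> n \<Longrightarrow> Q (\<nu> d) \<Longrightarrow> (\<Sum>k<Suc d. \<nu> k) = s \<Longrightarrow>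
      (\<And>\<nu>'. nchain p f z (Suc d) \<nu>' n \<Longrightarrow> Q (\<nu>' d) \<Longrightarrow> (\<Sum>k<Suc d. \<nu>' k) = s \<Longrightarrow> \<forall>k<Suc d. \<nu>' k = \<nu> k) \<Longrightarrow> S s \<noteq> 0"
proof -
  note bin = of_nat_binomial_nonzero_iff[OF prime_CHAR_finite_field[where ?'a='a], folded p]
  define t where "t j s = of_nat (n choose j) * (if s < j then 0 else fps_nth (V j) (s - j))" for j s
  have p2: "2 \<le> p" using prime_CHAR_finite_field[where ?'a='a] by (simp add: p prime_ge_2_nat)
  have ext: "\<exists>\<nu>. nchain p f z (Suc d) \<nu> n \<and> \<nu> d = j \<and> (\<Sum>k<Suc d. \<nu> k) = s" if "t j s \<noteq> 0" for j s
  proof -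
    have "j \<le> s" "dig_le p j n" "fps_nth (V j) (s - j) \<noteq> 0"
      using that bin[of n j] by (auto simp: t_def split: if_splits)
    moreover from nz[OF this(3)] obtain \<nu> where "[j = z] (mod (p ^ f - 1))" "achain p f z d j (s - j) \<nu>" by blast
    ultimately have "nchain p f z (Suc d) (\<nu>(d := j)) n" "(\<Sum>k<Suc d. (\<nu>(d := j)) k) = s"
      using achain_extend[of p f z d j "s - j" \<nu> n] by auto
    thus ?thesis by (intro exI[of _ "\<nu>(d := j)"]) simp
  qed
  show "\<exists>\<nu>. nchain p f z (Suc d) \<nu> n \<and> Q (\<nu> d) \<and> (\<Sum>k<Suc d. \<nu> k) = s" if "S s \<noteq> 0"
  proof -
    have "\<exists>j. Q j \<and> t j s \<noteq> 0"
    proof (rule ccontr)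
      assume "\<not> ?thesis"
      hence "S s = 0" unfolding S t_def[symmetric] by (intro sum.neutral) auto
      thus False using that by simp
    qed
    then obtain j where j: "Q j" "t j s \<noteq> 0" by blast
    from ext[OF j(2)] obtain \<nu> where "nchain p f z (Suc d) \<nu> n" "\<nu> d = j" "(\<Sum>k<Suc d. \<nu> k) = s"
      by (elim exE conjE) (rule that)
    thus ?thesis using j(1) by (intro exI[of _ \<nu>]) simp
  qed
  assume \<nu>: "nchain p f z (Suc d) \<nu> n" "Q (\<nu> d)" "(\<Sum>k<Suc d. \<nu> k) = s"
    and un: "\<And>\<nu>'. nchain p f z (Suc d) \<nu>' n \<Longrightarrow> Q (\<nu>' d) \<Longrightarrow> (\<Sum>k<Suc d. \<nu>' k) = s \<Longrightarrow> \<forall>k<Suc d. \<nu>' k = \<nu> k"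
  define j where "j = \<nu> d"
  have j: "dig_le p j n" "[j = z] (mod (p ^ f - 1))" using \<nu>(1) by (auto simp: nchain_def j_def)
  have ac: "achain p f z d j (s - j) \<nu>" "j \<le> s" using achain_restrict[OF \<nu>(1,3)] by (simp_all add: j_def)
  have "fps_nth (V j) (s - j) \<noteq> 0"
  proof (rule uniq[OF j(2) ac(1)])
    fix \<nu>' assume "achain p f z d j (s - j) \<nu>'"
    note e = achain_extend[OF this j(2,1)]
    have "\<forall>k<Suc d. (\<nu>'(d := j)) k = \<nu> k"
      by (rule un[OF e(1)]) (use \<nu>(2) e(2) ac(2) in \<open>simp_all add: j_def\<close>)
    thus "\<forall>k<d. \<nu>' k = \<nu> k" by (metis fun_upd_other less_Suc_eq nat_neq_iff)
  qed
  hence tj: "t j s \<noteq> 0" using ac(2) j(1) bin[of n j] by (simp add: t_def)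
  \<comment> \<open>A second nonzero term would supply a second chain with the same sum, so nothing
    is left to cancel the term \<open>j\<close>.\<close>
  have other: "t i s = 0" if "Q i" "i \<noteq> j" for i
  proof (rule ccontr)
    assume "t i s \<noteq> 0"
    from ext[OF this] obtain \<mu> where \<mu>: "nchain p f z (Suc d) \<mu> n" "\<mu> d = i" "(\<Sum>k<Suc d. \<mu> k) = s"
      by (elim exE conjE) (rule that)
    have "\<forall>k<Suc d. \<mu> k = \<nu> k" by (rule un[OF \<mu>(1) _ \<mu>(3)]) (simp add: \<mu>(2) \<open>Q i\<close>)
    hence "\<mu> d = \<nu> d" by simp
    thus False using \<open>i \<noteq> j\<close> \<mu>(2) by (simp add: j_def)
  qed
  have "S s = (\<Sum>i\<in>{j}. t i s)"
    unfolding S t_def[symmetric]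
  proof (rule sum.mono_neutral_right)
    show "{j} \<subseteq> {i. i \<le> n \<and> Q i}" using dig_le_le[OF j(1) p2] \<nu>(2) by (simp add: j_def)
    show "\<forall>i\<in>{i. i \<le> n \<and> Q i} - {j}. t i s = 0" using other by simp
  qed simp
  thus "S s \<noteq> 0" using tj by simp
qed

lemma fps_const_sum: "fps_const (\<Sum>x\<in>A. g x) = (\<Sum>x\<in>A. fps_const (g x))"
  by (induction A rule: infinite_finite_induct) (auto simp flip: fps_const_add)

definition polys :: "nat \<Rightarrow> 'a::finite_field poly set" where
  "polys d = {B. B \<noteq> 0 \<and> Polynomial.degree B = d}"

lemma polys_0: "polys 0 = (\<lambda>c. [:c:]) ` (UNIV - {0})"
  by (auto simp: polys_def elim!: degree_eq_zeroE)

lemma polys_Suc: "polys (Suc d) = (\<lambda>(c, B). pCons c B) ` (UNIV \<times> polys d)"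
proof (intro equalityI subsetI)
  fix A :: "'a poly" assume A: "A \<in> polys (Suc d)"
  obtain c B where cB: "A = pCons c B" by (cases A) auto
  have "B \<in> polys d" using A by (auto simp: polys_def cB split: if_splits)
  thus "A \<in> (\<lambda>(c, B). pCons c B) ` (UNIV \<times> polys d)" by (auto simp: cB)
qed (auto simp: polys_def)

text \<open>The exponent \<open>z'\<close> will be a residue of \<open>- z\<close>, because the
  leading coefficient of \<open>B\<close> will be the inverse of the constant term of the original
  polynomial.\<close>

definition lead_sum :: "nat \<Rightarrow> nat \<Rightarrow> nat \<Rightarrow> 'a::finite_field fps" where
  "lead_sum z' d n = (\<Sum>B\<in>polys d. fps_const (Polynomial.lead_coeff B ^ z') * fps_of_poly B ^ n)"

lemma lead_sum_0:
  "lead_sum z' 0 n = (if CARD('a) - 1 dvd n + z' then - 1 else 0 :: 'a::finite_field fps)"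
proof -
  have "lead_sum z' 0 n = (\<Sum>c\<in>UNIV - {0 :: 'a}. fps_const (c ^ (n + z')))"
    unfolding lead_sum_def polys_0
    by (subst sum.reindex) (auto simp: inj_on_def fps_of_poly_const fps_const_power power_add mult.commute)
  also have "... = fps_const (\<Sum>c\<in>UNIV - {0 :: 'a}. c ^ (n + z'))" by (simp add: fps_const_sum)
  finally show ?thesis by (simp add: sum_powers_finite_field fps_const_neg[symmetric] del: fps_const_neg)
qed

lemma sum_all_powers_finite_field:
  "(\<Sum>c\<in>(UNIV :: 'a::finite_field set). c ^ e) = (if 0 < e \<and> CARD('a) - 1 dvd e then - 1 else 0)"
proof -
  have "(\<Sum>c\<in>(UNIV :: 'a set). c ^ e) = 0 ^ e + (\<Sum>c\<in>UNIV - {0 :: 'a}. c ^ e)"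
    by (rule sum.remove) auto
  thus ?thesis by (cases "e = 0") (simp_all add: sum_powers_finite_field of_nat_card_finite_field)
qed

text \<open>With the constant term \<open>c\<close> split off and the power expanded, the sum over
  \<open>c\<close> selects the \<open>j\<close> for which \<open>n - j\<close> is a positive
  multiple of \<open>q - 1\<close>. The term \<open>j = n\<close> disappears because it counts the
  \<open>q\<close> values of \<open>c\<close>; this is why the chains increase strictly.\<close>

lemma lead_sum_Suc:
  fixes n :: nat
  defines "r \<equiv> CARD('a::finite_field) - 1"
  shows "(lead_sum z' (Suc d) n :: 'a fps) =
    - (\<Sum>j | j \<le> n \<and> (j < n \<and> r dvd n - j). of_nat (n choose j) * (fps_X ^ j * lead_sum z' d j))"
proof -
  define L where "L B = fps_const (Polynomial.lead_coeff B ^ z')" for B :: "'a poly"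
  have inj: "inj_on (\<lambda>(c, B). pCons c B) (UNIV \<times> polys d :: ('a \<times> 'a poly) set)" by (auto simp: inj_on_def)
  have "lead_sum z' (Suc d) n = (\<Sum>(c, B)\<in>UNIV \<times> polys d. L B * (fps_const c + fps_X * fps_of_poly B) ^ n)"
    unfolding lead_sum_def polys_Suc sum.reindex[OF inj]
    by (intro sum.cong) (auto simp: L_def polys_def fps_of_poly_pCons mult.commute)
  also have "... = (\<Sum>c\<in>UNIV. \<Sum>B\<in>polys d. L B * (fps_const c + fps_X * fps_of_poly B) ^ n)"
    by (rule sum.cartesian_product[symmetric])
  also have "... = (\<Sum>B\<in>polys d. \<Sum>c\<in>UNIV. \<Sum>j\<le>n. of_nat (n choose j) * (fps_X ^ j * (L B * fps_of_poly B ^ j)) * fps_const (c ^ (n - j)))"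
    by (subst sum.swap)
       (auto simp: add.commute[of "fps_const _"] binomial_ring sum_distrib_left power_mult_distrib fps_const_power mult_ac intro!: sum.cong)
  also have "... = (\<Sum>j\<le>n. of_nat (n choose j) * (fps_X ^ j * lead_sum z' d j) * fps_const (\<Sum>c\<in>(UNIV :: 'a set). c ^ (n - j)))"
  proof -
    have "(\<Sum>B\<in>polys d. \<Sum>c\<in>UNIV. \<Sum>j\<le>n. of_nat (n choose j) * (fps_X ^ j * (L B * fps_of_poly B ^ j)) * fps_const (c ^ (n - j))) =
      (\<Sum>B\<in>polys d. \<Sum>j\<le>n. of_nat (n choose j) * (fps_X ^ j * (L B * fps_of_poly B ^ j)) * fps_const (\<Sum>c\<in>(UNIV :: 'a set). c ^ (n - j)))"
      by (intro sum.cong refl, subst sum.swap) (simp add: sum_distrib_left fps_const_sum)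
    also have "... = (\<Sum>j\<le>n. \<Sum>B\<in>polys d. of_nat (n choose j) * (fps_X ^ j * (L B * fps_of_poly B ^ j)) * fps_const (\<Sum>c\<in>(UNIV :: 'a set). c ^ (n - j)))"
      by (rule sum.swap)
    also have "... = (\<Sum>j\<le>n. of_nat (n choose j) * (fps_X ^ j * lead_sum z' d j) * fps_const (\<Sum>c\<in>(UNIV :: 'a set). c ^ (n - j)))"
      unfolding lead_sum_def L_def by (simp add: sum_distrib_left sum_distrib_right)
    finally show ?thesis .
  qed
  also have "... = (\<Sum>j\<le>n. if j < n \<and> r dvd n - j then - (of_nat (n choose j) * (fps_X ^ j * lead_sum z' d j)) else 0)"
    unfolding sum_all_powers_finite_field r_def[symmetric]
    by (intro sum.cong) (auto simp: fps_const_neg[symmetric] simp del: fps_const_neg)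
  also have "... = (\<Sum>j | j \<le> n \<and> (j < n \<and> r dvd n - j). - (of_nat (n choose j) * (fps_X ^ j * lead_sum z' d j)))"
    by (intro sum.mono_neutral_cong_right) auto
  finally show ?thesis by (simp add: sum_negf)
qed

lemma fps_nth_of_nat_X_power_mult:
  "fps_nth (of_nat c * (fps_X ^ j * V)) s = of_nat c * (if s < j then 0 else fps_nth (V :: 'a::comm_ring_1 fps) (s - j))"
  by (simp add: fps_X_power_mult_nth flip: fps_of_nat)

text \<open>Each step of the degree contributes one member of the chain, and the sum over the
  constants in degree 0 fixes the residue \<open>z\<close>. Several chains with the same sum could
  cancel, so the converse is stated for a unique chain.\<close>

lemma lead_sum_nth:
  fixes p f z z' :: nat
  assumes p: "p = CHAR('a::finite_field)" and q: "CARD('a) = p ^ f"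
    and z: "[z + z' = 0] (mod (p ^ f - 1))"
  shows "fps_nth (lead_sum z' d n :: 'a fps) s \<noteq> 0 \<Longrightarrow> [n = z] (mod (p ^ f - 1)) \<and> (\<exists>\<nu>. achain p f z d n s \<nu>)"
    and "[n = z] (mod (p ^ f - 1)) \<Longrightarrow> achain p f z d n s \<nu> \<Longrightarrow>
      (\<And>\<nu>'. achain p f z d n s \<nu>' \<Longrightarrow> \<forall>k<d. \<nu>' k = \<nu> k) \<Longrightarrow> fps_nth (lead_sum z' d n :: 'a fps) s \<noteq> 0"
proof (induction d arbitrary: n s \<nu>)
  case 0
  have eq: "p ^ f - 1 dvd n + z' \<longleftrightarrow> [n = z] (mod (p ^ f - 1))" for n
  proof -
    have "p ^ f - 1 dvd n + z' \<longleftrightarrow> [n + z' = z + z'] (mod (p ^ f - 1))"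
      using z by (metis cong_0_iff cong_sym cong_trans)
    thus ?thesis by (simp only: cong_add_rcancel_nat)
  qed
  note eq = eq[unfolded One_nat_def]
  {
    case (1 n s)
    thus ?case by (auto simp: lead_sum_0 q eq achain_def nchain_def split: if_splits)
  next
    case (2 n s \<nu>)
    hence "s = 0" by (simp add: achain_def)
    thus ?case using 2 by (simp add: lead_sum_0 q eq)
  }
next
  case (Suc d)
  define Q where "Q n j \<longleftrightarrow> j < n \<and> p ^ f - 1 dvd n - j" for n j
  define S where "S n s = (\<Sum>j | j \<le> n \<and> Q n j. of_nat (n choose j) * (if s < j then 0 else fps_nth (lead_sum z' d j :: 'a fps) (s - j)))" for n s
  have S: "fps_nth (lead_sum z' (Suc d) n :: 'a fps) s = - S n s" for n s
    unfolding lead_sum_Suc q S_def Q_def by (simp only: fps_neg_nth fps_sum_nth fps_nth_of_nat_X_power_mult)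
  have p2: "2 \<le> p" using prime_CHAR_finite_field[where ?'a='a] p by (simp add: prime_ge_2_nat)
  have step1: "\<exists>\<nu>. nchain p f z (Suc d) \<nu> n \<and> Q n (\<nu> d) \<and> (\<Sum>k<Suc d. \<nu> k) = s" if "S n s \<noteq> 0" for n s
    by (rule chain_sum_step(1)[OF p S_def _ _ that]) (fact Suc.IH)+
  have step2: "S n s \<noteq> 0" if "nchain p f z (Suc d) \<nu> n" "Q n (\<nu> d)" "(\<Sum>k<Suc d. \<nu> k) = s"
    "\<And>\<nu>'. nchain p f z (Suc d) \<nu>' n \<Longrightarrow> Q n (\<nu>' d) \<Longrightarrow> (\<Sum>k<Suc d. \<nu>' k) = s \<Longrightarrow> \<forall>k<Suc d. \<nu>' k = \<nu> k" for n s \<nu>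
    by (rule chain_sum_step(2)[OF p S_def _ _ that(1,2,3)]) (fact Suc.IH that(4))+
  have Qn: "[n = j] (mod (p ^ f - 1))" if "Q n j" for n j
    using that unfolding Q_def by (simp add: cong_altdef_nat)
  have Qa: "Q n (\<nu> d) \<and> nchain p f z (Suc d) \<nu> n \<and> (\<Sum>k<Suc d. \<nu> k) = s \<longleftrightarrow> achain p f z (Suc d) n s \<nu>"
    if n: "[n = z] (mod (p ^ f - 1))" for n \<nu> s
  proof
    assume a: "achain p f z (Suc d) n s \<nu>"
    have *: "dig_le p (\<nu> d) n" "[\<nu> d = z] (mod (p ^ f - 1))" "\<nu> d \<noteq> n" using a by (auto simp: achain_def nchain_def)
    have "\<nu> d < n" using dig_le_le[OF *(1) p2] *(3) by simp
    moreover have "[n = \<nu> d] (mod (p ^ f - 1))" using n *(2) by (metis cong_sym cong_trans)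
    ultimately have "Q n (\<nu> d)" unfolding Q_def by (simp add: cong_altdef_nat)
    thus "Q n (\<nu> d) \<and> nchain p f z (Suc d) \<nu> n \<and> (\<Sum>k<Suc d. \<nu> k) = s" using a by (simp add: achain_def)
  qed (auto simp: achain_def Q_def)
  {
    case (1 n s)
    hence "S n s \<noteq> 0" by (simp add: S)
    from step1[OF this] obtain \<nu> where \<nu>: "nchain p f z (Suc d) \<nu> n" "Q n (\<nu> d)" "(\<Sum>k<Suc d. \<nu> k) = s"
      by (elim exE conjE) (rule that)
    have "[\<nu> d = z] (mod (p ^ f - 1))" using \<nu>(1) by (simp add: nchain_def)
    hence n: "[n = z] (mod (p ^ f - 1))" using Qn[OF \<nu>(2)] cong_trans by blast
    thus ?case using Qa[OF n] \<nu> by blast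
  next
    case (2 n s \<nu>)
    have "S n s \<noteq> 0"
    proof (rule step2)
      show "nchain p f z (Suc d) \<nu> n" "Q n (\<nu> d)" "(\<Sum>k<Suc d. \<nu> k) = s"
        using Qa[OF 2(1), of \<nu> s] 2(2) by auto
      fix \<nu>' assume "nchain p f z (Suc d) \<nu>' n" "Q n (\<nu>' d)" "(\<Sum>k<Suc d. \<nu>' k) = s"
      thus "\<forall>k<Suc d. \<nu>' k = \<nu> k" using Qa[OF 2(1), of \<nu>' s] 2(3) by blast
    qed
    thus ?case by (simp add: S)
  }
qed

text \<open>Here the constant term is fixed to 1 instead of being summed over, so the term
  \<open>j = m\<close> survives and the last step of a chain to \<open>m\<close> need not be
  strict.\<close>

definition unit_sum :: "nat \<Rightarrow> nat \<Rightarrow> nat \<Rightarrow> 'a::finite_field fps" where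
  "unit_sum z' d m = (\<Sum>B\<in>polys d. fps_const (Polynomial.lead_coeff B ^ z') * (1 + fps_X * fps_of_poly B) ^ m)"

lemma unit_sum_eq:
  "unit_sum z' d m = (\<Sum>j | j \<le> m \<and> True. of_nat (m choose j) * (fps_X ^ j * (lead_sum z' d j :: 'a::finite_field fps)))"
proof -
  have "unit_sum z' d m = (\<Sum>B\<in>polys d. \<Sum>j\<le>m. fps_const (Polynomial.lead_coeff B ^ z') * (of_nat (m choose j) * (fps_X ^ j * fps_of_poly B ^ j :: 'a fps)))"
    unfolding unit_sum_def
    by (simp add: add.commute[of 1] binomial_ring sum_distrib_left power_mult_distrib)
  also have "... = (\<Sum>j\<le>m. \<Sum>B\<in>polys d. fps_const (Polynomial.lead_coeff B ^ z') * (of_nat (m choose j) * (fps_X ^ j * fps_of_poly B ^ j :: 'a fps)))"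
    by (rule sum.swap)
  also have "... = (\<Sum>j\<le>m. of_nat (m choose j) * (fps_X ^ j * (lead_sum z' d j :: 'a fps)))"
    unfolding lead_sum_def by (intro sum.cong) (auto simp: sum_distrib_left mult_ac)
  finally show ?thesis by (simp add: atMost_def)
qed

lemma unit_sum_nth:
  fixes p f z z' :: nat
  assumes p: "p = CHAR('a::finite_field)" and q: "CARD('a) = p ^ f"
    and z: "[z + z' = 0] (mod (p ^ f - 1))"
  shows "fps_nth (unit_sum z' d m :: 'a fps) s \<noteq> 0 \<Longrightarrow> \<exists>\<nu>. nchain p f z (Suc d) \<nu> m \<and> (\<Sum>k<Suc d. \<nu> k) = s"
    and "nchain p f z (Suc d) \<nu> m \<Longrightarrow> (\<Sum>k<Suc d. \<nu> k) = s \<Longrightarrow>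
      (\<And>\<nu>'. nchain p f z (Suc d) \<nu>' m \<Longrightarrow> (\<Sum>k<Suc d. \<nu>' k) = s \<Longrightarrow> \<forall>k<Suc d. \<nu>' k = \<nu> k) \<Longrightarrow>
      fps_nth (unit_sum z' d m :: 'a fps) s \<noteq> 0"
proof -
  define Q :: "nat \<Rightarrow> bool" where "Q = (\<lambda>_. True)"
  define S where "S s = (\<Sum>j | j \<le> m \<and> Q j. of_nat (m choose j) * (if s < j then 0 else fps_nth (lead_sum z' d j :: 'a fps) (s - j)))" for s
  have S: "fps_nth (unit_sum z' d m :: 'a fps) s = S s" for s
    unfolding unit_sum_eq S_def Q_def by (simp only: fps_sum_nth fps_nth_of_nat_X_power_mult)
  show "\<exists>\<nu>. nchain p f z (Suc d) \<nu> m \<and> (\<Sum>k<Suc d. \<nu> k) = s" if "fps_nth (unit_sum z' d m :: 'a fps) s \<noteq> 0"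
  proof -
    have "\<exists>\<nu>. nchain p f z (Suc d) \<nu> m \<and> Q (\<nu> d) \<and> (\<Sum>k<Suc d. \<nu> k) = s"
      by (rule chain_sum_step(1)[OF p S_def _ _ that[unfolded S]]) (fact lead_sum_nth[OF p q z])+
    thus ?thesis by (simp add: Q_def)
  qed
  have Q: "Q j" for j by (simp add: Q_def)
  show "fps_nth (unit_sum z' d m :: 'a fps) s \<noteq> 0" if "nchain p f z (Suc d) \<nu> m" "(\<Sum>k<Suc d. \<nu> k) = s"
    "\<And>\<nu>'. nchain p f z (Suc d) \<nu>' m \<Longrightarrow> (\<Sum>k<Suc d. \<nu>' k) = s \<Longrightarrow> \<forall>k<Suc d. \<nu>' k = \<nu> k"
    unfolding S
    by (rule chain_sum_step(2)[OF p S_def _ _ that(1) Q that(2)], fact lead_sum_nth[OF p q z],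
      fact lead_sum_nth[OF p q z], rule that(3))
qed

section \<open>Truncating the p-adic exponent, and the valuations of the power sums\<close>

lemma padic_power_nth:
  fixes u :: "'a::finite_field fps"
  assumes u: "fps_nth u 0 = 1" and M: "M \<in> padic_ints CHAR('a)" and k: "k < CHAR('a) ^ n"
  shows "fps_nth (padic_power u M) k = fps_nth (u ^ M n) k"
proof -
  have stable: "fps_nth (u ^ M (n + i)) k = fps_nth (u ^ M n) k" for i
  proof (induction i)
    case (Suc i)
    have "M (Suc (n + i)) = M (n + i) + CHAR('a) ^ (n + i) * (M (Suc (n + i)) div CHAR('a) ^ (n + i))"
      using M mod_mult_div_eq[of "M (Suc (n + i))" "CHAR('a) ^ (n + i)"]
      by (simp add: padic_ints_def)
    then obtain j where j: "M (Suc (n + i)) = M (n + i) + CHAR('a) ^ (n + i) * j" by blast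
    have "CHAR('a) ^ n \<le> CHAR('a) ^ (n + i)"
      by (rule power_increasing) (use prime_ge_1_nat[OF prime_CHAR_finite_field[where ?'a='a]] in auto)
    hence "k < CHAR('a) ^ (n + i)" using k by simp
    thus ?case using Suc one_unit_power_CHAR_power_nth[OF u, of k "n + i" "u ^ M (n + i)" j]
      by (simp add: j power_add)
  qed simp
  from padic_power_LIMSEQ[OF u M] have "eventually (\<lambda>i. fps_nth (u ^ M i) k = fps_nth (padic_power u M) k) sequentially"
    by (simp add: tendsto_fps_iff)
  then obtain i0 where "\<And>i. i \<ge> i0 \<Longrightarrow> fps_nth (u ^ M i) k = fps_nth (padic_power u M) k"
    by (auto simp: eventually_sequentially)
  from this[of "n + i0"] stable[of i0] show ?thesis by simp
qed

lemma goss_S_0: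
  assumes M: "M \<in> padic_ints CHAR('a::finite_field)"
  shows "goss_S 0 (z, M) = (1 :: 'a fps)"
proof -
  have "{a :: 'a poly. Polynomial.lead_coeff a = 1 \<and> Polynomial.degree a = 0 \<and> Polynomial.coeff a 0 \<noteq> 0} = {1}"
    by (auto elim!: degree_eq_zeroE simp: one_pCons)
  moreover have "padic_power (1 :: 'a fps) M = 1"
    using padic_power_LIMSEQ[of 1 M] M by (simp add: LIMSEQ_const_iff)
  ultimately show ?thesis by (simp add: goss_S_def goss_power_def)
qed

lemma power_int_finite_field:
  fixes b :: "'a::finite_field"
  assumes "b \<noteq> 0" and "r = int (CARD('a) - 1)"
  shows "inverse b powi z = b ^ nat ((- z) mod r)"
proof -
  have "b ^ CARD('a) = b" by (rule finite_field_power_card_eq_same)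
  hence "b ^ (CARD('a) - 1) = 1"
    using assms(1) finite_UNIV_card_ge_0[where ?'a='a] by (cases "CARD('a)") auto
  hence 1: "b powi r = 1" by (simp only: assms(2) power_int_of_nat)
  have "inverse b powi z = b powi (- z)" by (simp add: power_int_inverse power_int_minus)
  also have "... = b powi (r * ((- z) div r) + (- z) mod r)" by (simp only: mult_div_mod_eq)
  also have "... = (b powi r) powi ((- z) div r) * b powi ((- z) mod r)"
    by (simp only: power_int_add[OF disjI1[OF assms(1)]] power_int_mult)
  also have "... = b powi ((- z) mod r)" by (simp only: 1 power_int_1_left mult_1)
  also have "... = b ^ nat ((- z) mod r)"
  proof -
    have "r > 0"
    proof -
      have "{0, 1 :: 'a} \<subseteq> UNIV" by simp
      hence "card {0, 1 :: 'a} \<le> CARD('a)" by (intro card_mono) auto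
      thus ?thesis by (simp add: assms(2))
    qed
    thus ?thesis by (simp add: power_int_def)
  qed
  finally show ?thesis .
qed

text \<open>Dividing a monic polynomial by its constant term gives \<open>1 + t B\<close>, where the leading
  coefficient of B is the inverse of the constant term.\<close>

lemma goss_S_Suc:
  assumes "r = int (CARD('a::finite_field) - 1)"
  shows "goss_S (Suc d) (z, M) =
    (\<Sum>B\<in>polys d. fps_const (Polynomial.lead_coeff B ^ nat ((- z) mod r)) * padic_power (1 + fps_X * fps_of_poly B :: 'a fps) M)"
proof -
  define mon where "mon B = Polynomial.smult (inverse (Polynomial.lead_coeff B)) (pCons 1 B)" for B :: "'a poly"
  let ?I = "{a :: 'a poly. Polynomial.lead_coeff a = 1 \<and> Polynomial.degree a = Suc d \<and> Polynomial.coeff a 0 \<noteq> 0}"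
  have "goss_S (Suc d) (z, M) = (\<Sum>a\<in>?I. goss_power a (z, M))" by (simp add: goss_S_def)
  also have "... = (\<Sum>B\<in>polys d. goss_power (mon B) (z, M))"
  proof (rule sum.reindex_bij_witness[of _ mon "\<lambda>a. poly_shift 1 (Polynomial.smult (inverse (Polynomial.coeff a 0)) a)"])
    fix B :: "'a poly" assume B: "B \<in> polys d"
    hence lc: "Polynomial.lead_coeff B \<noteq> 0" and deg: "B \<noteq> 0" "Polynomial.degree B = d" by (auto simp: polys_def)
    have s: "Polynomial.smult (inverse (Polynomial.coeff (mon B) 0)) (mon B) = pCons 1 B"
      using lc by (simp add: mon_def)
    show "poly_shift 1 (Polynomial.smult (inverse (Polynomial.coeff (mon B) 0)) (mon B)) = B"
      unfolding s by (simp add: poly_eq_iff coeff_poly_shift)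
    show "mon B \<in> ?I" using lc deg by (simp add: mon_def)
  next
    fix a assume a: "a \<in> ?I"
    define a0 where "a0 = Polynomial.coeff a 0"
    define B where "B = poly_shift 1 (Polynomial.smult (inverse a0) a)"
    have a0: "a0 \<noteq> 0" using a by (simp add: a0_def)
    have pc: "pCons 1 B = Polynomial.smult (inverse a0) a"
      using a0 by (intro poly_eqI) (auto simp: B_def coeff_poly_shift coeff_pCons a0_def split: nat.splits)
    have deg: "Polynomial.degree (pCons 1 B) = Suc d" unfolding pc using a a0 by simp
    hence B0: "B \<noteq> 0" by auto
    hence dB: "Polynomial.degree B = d" using deg by simp
    have "Polynomial.coeff a (Suc d) = 1" using a by (metis (mono_tags, lifting) mem_Collect_eq)
    hence "Polynomial.lead_coeff (pCons 1 B) = inverse a0" unfolding deg unfolding pc by simp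
    hence lB: "Polynomial.lead_coeff B = inverse a0" using B0 by simp
    show "poly_shift 1 (Polynomial.smult (inverse (Polynomial.coeff a 0)) a) \<in> polys d"
      using B0 dB by (simp add: polys_def B_def a0_def)
    show "mon (poly_shift 1 (Polynomial.smult (inverse (Polynomial.coeff a 0)) a)) = a"
      unfolding a0_def[symmetric] B_def[symmetric] mon_def pc lB using a0 by simp
    thus "goss_power (mon (poly_shift 1 (Polynomial.smult (inverse (Polynomial.coeff a 0)) a))) (z, M) = goss_power a (z, M)"
      by simp
  qed
  also have "... = (\<Sum>B\<in>polys d. fps_const (Polynomial.lead_coeff B ^ nat ((- z) mod r)) * padic_power (1 + fps_X * fps_of_poly B) M)"
  proof (rule sum.cong[OF refl])
    fix B :: "'a poly" assume "B \<in> polys d"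
    hence lc: "Polynomial.lead_coeff B \<noteq> 0" by (auto simp: polys_def)
    have "Polynomial.smult (inverse (Polynomial.coeff (mon B) 0)) (mon B) = pCons 1 B" "Polynomial.coeff (mon B) 0 = inverse (Polynomial.lead_coeff B)"
      using lc by (simp_all add: mon_def)
    thus "goss_power (mon B) (z, M) = fps_const (Polynomial.lead_coeff B ^ nat ((- z) mod r)) * padic_power (1 + fps_X * fps_of_poly B) M"
      unfolding goss_power_def by (simp add: power_int_finite_field[OF lc assms] fps_of_poly_pCons mult.commute)
  qed
  finally show ?thesis .
qed

lemma goss_S_nth:
  assumes M: "M \<in> padic_ints CHAR('a::finite_field)" and r: "r = int (CARD('a) - 1)"
    and k: "k < CHAR('a) ^ n"
  shows "fps_nth (goss_S (Suc d) (z, M) :: 'a fps) k = fps_nth (unit_sum (nat ((- z) mod r)) d (M n) :: 'a fps) k"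
  unfolding goss_S_Suc[OF r] unit_sum_def fps_sum_nth
  using k by (intro sum.cong refl) (simp add: padic_power_nth[OF _ M k])

text \<open>Below \<open>t ^ (p ^ N)\<close> the exponent can be replaced by the natural number
  \<open>M N\<close>, and \<open>g\<close> is the minimal chain cost for this number. It depends on
  \<open>N\<close>.\<close>

lemma goss_S_approx:
  assumes M: "M \<in> padic_ints CHAR('a::finite_field)"
  obtains g :: "nat \<Rightarrow> nat" where "g 0 = 0" "\<And>d. g d \<le> g (Suc d)" "\<And>d. 2 * g (Suc d) < g (Suc (Suc d)) + g d"
    "\<And>d s. s < g d \<Longrightarrow> s < CHAR('a) ^ N \<Longrightarrow> fps_nth (goss_S d (z, M) :: 'a fps) s = 0"
    "\<And>d. g d < CHAR('a) ^ N \<Longrightarrow> fps_nth (goss_S d (z, M) :: 'a fps) (g d) \<noteq> 0"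
proof -
  define p where "p = CHAR('a)"
  have p2: "2 \<le> p" using prime_CHAR_finite_field[where ?'a='a] by (simp add: p_def prime_ge_2_nat)
  obtain f where f: "1 \<le> f" "CARD('a) = p ^ f" using card_finite_field[where ?'a='a] by (auto simp: p_def)
  have "2 ^ 1 \<le> p ^ f" using p2 f(1) by (metis le_trans one_le_numeral order.refl power_increasing power_mono zero_le_numeral)
  hence r0: "0 < p ^ f - 1" by simp
  define r where "r = int (p ^ f - 1)"
  define z0 where "z0 = nat (z mod r)"
  define z' where "z' = nat ((- z) mod r)"
  have rpos: "0 < r" unfolding r_def using r0 by (simp only: of_nat_0_less_iff)
  have "int z0 < r" using pos_mod_bound[OF rpos] pos_mod_sign[OF rpos] by (simp add: z0_def)
  hence z0: "z0 < p ^ f - 1" unfolding r_def of_nat_less_iff .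
  have "int (z0 + z') mod r = (z mod r + (- z) mod r) mod r" using rpos by (simp add: z0_def z'_def)
  also have "... = 0" by (simp add: mod_add_eq)
  finally have "r dvd int (z0 + z')" by (simp add: dvd_eq_mod_eq_0)
  hence zz: "[z0 + z' = 0] (mod (p ^ f - 1))" unfolding r_def int_dvd_int_iff cong_0_iff .
  have Mn: "M N < p ^ N" using M by (simp add: padic_ints_def p_def)
  obtain g where g: "g 0 = 0" "\<And>d. g d \<le> g (Suc d)"
    "\<And>d. 2 * g (Suc d) < g (Suc (Suc d)) + g d"
    "\<And>d \<nu>. nchain p f z0 d \<nu> (M N) \<Longrightarrow> g d \<le> (\<Sum>k<d. \<nu> k)"
    "\<And>d. g d < p ^ N \<Longrightarrow> \<exists>\<nu>. nchain p f z0 d \<nu> (M N) \<and> (\<Sum>k<d. \<nu> k) = g d \<and>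
       (\<forall>\<nu>'. nchain p f z0 d \<nu>' (M N) \<longrightarrow> (\<Sum>k<d. \<nu>' k) = g d \<longrightarrow> (\<forall>k<d. \<nu>' k = \<nu> k))"
    by (rule min_chain_cost[OF p2 f(1) Mn z0]) (rule that)
  have nth: "fps_nth (goss_S (Suc d) (z, M) :: 'a fps) k = fps_nth (unit_sum z' d (M N) :: 'a fps) k" if "k < p ^ N" for d k
    unfolding z'_def by (rule goss_S_nth[OF M]) (use that f in \<open>simp_all add: r_def p_def\<close>)
  note us = unit_sum_nth[OF p_def f(2) zz]
  show ?thesis
  proof (rule that[of g])
    show "fps_nth (goss_S d (z, M) :: 'a fps) s = 0" if s: "s < g d" "s < CHAR('a) ^ N" for d s
    proof (cases d)
      case 0
      thus ?thesis using s g(1) by simp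
    next
      case (Suc e)
      show ?thesis
      proof (rule ccontr)
        assume "fps_nth (goss_S d (z, M) :: 'a fps) s \<noteq> 0"
        hence "fps_nth (unit_sum z' e (M N) :: 'a fps) s \<noteq> 0" using nth s(2) Suc by (simp add: p_def)
        from us(1)[OF this] obtain \<nu> where "nchain p f z0 (Suc e) \<nu> (M N)" "(\<Sum>k<Suc e. \<nu> k) = s"
          by (elim exE conjE) (rule that)
        thus False using g(4)[of "Suc e" \<nu>] s(1) Suc by simp
      qed
    qed
    show "fps_nth (goss_S d (z, M) :: 'a fps) (g d) \<noteq> 0" if s: "g d < CHAR('a) ^ N" for d
    proof (cases d)
      case 0
      thus ?thesis using g(1) goss_S_0[OF M] by simp
    next
      case (Suc e)
      have s': "g (Suc e) < p ^ N" using s Suc by (simp add: p_def)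
      from g(5)[OF s'] obtain \<nu> where \<nu>: "nchain p f z0 (Suc e) \<nu> (M N)" "(\<Sum>k<Suc e. \<nu> k) = g (Suc e)"
        "\<forall>\<nu>'. nchain p f z0 (Suc e) \<nu>' (M N) \<longrightarrow> (\<Sum>k<Suc e. \<nu>' k) = g (Suc e) \<longrightarrow> (\<forall>k<Suc e. \<nu>' k = \<nu> k)"
        by (elim exE conjE) (rule that)
      have "fps_nth (unit_sum z' e (M N) :: 'a fps) (g (Suc e)) \<noteq> 0"
        by (rule us(2)[OF \<nu>(1,2)]) (rule \<nu>(3)[THEN spec, THEN mp, THEN mp])
      thus ?thesis using nth s' Suc by simp
    qed
  qed (fact g(1) g(2) g(3))+
qed

text \<open>Since the cost function depends on the truncation, \<open>N\<close> is taken to be the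
  valuation of the term with the largest index. As \<open>N < p ^ N\<close> and the costs are
  monotone, a single truncation is then exact for all smaller indices as well.\<close>

theorem goss_S_valuation:
  fixes z :: int
  assumes M: "M \<in> padic_ints CHAR('a::finite_field)"
  defines "S \<equiv> \<lambda>d. goss_S d (z, M) :: 'a fps"
  shows "S (Suc d) \<noteq> 0 \<Longrightarrow> S d \<noteq> 0"
    and "S (Suc (Suc d)) \<noteq> 0 \<Longrightarrow> 2 * subdegree (S (Suc d)) < subdegree (S (Suc (Suc d))) + subdegree (S d)"
proof -
  have p1: "1 < CHAR('a)" using prime_CHAR_finite_field[where ?'a='a] by (rule prime_gt_1_nat)
  have *: "\<exists>g. (\<forall>d. g d \<le> g (Suc d)) \<and> (\<forall>d. 2 * g (Suc d) < g (Suc (Suc d)) + g d) \<and> g D = subdegree (S D) \<and>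
      (\<forall>d\<le>D. S d \<noteq> 0 \<and> subdegree (S d) = g d)" if D: "S D \<noteq> 0" for D
  proof -
    define N where "N = subdegree (S D)"
    have N: "N < CHAR('a) ^ N" using p1 by (intro power_gt_expt) simp
    have SS: "S d = goss_S d (z, M)" for d by (simp add: S_def)
    obtain g where g0: "g 0 = 0" "\<And>d. g d \<le> g (Suc d)" "\<And>d. 2 * g (Suc d) < g (Suc (Suc d)) + g d"
      "\<And>d s. s < g d \<Longrightarrow> s < CHAR('a) ^ N \<Longrightarrow> fps_nth (goss_S d (z, M) :: 'a fps) s = 0"
      "\<And>d. g d < CHAR('a) ^ N \<Longrightarrow> fps_nth (goss_S d (z, M) :: 'a fps) (g d) \<noteq> 0"
      by (rule goss_S_approx[OF M, of N z]) (rule that)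
    note g = g0[folded SS]
    have "g D \<le> N"
    proof (rule ccontr)
      assume "\<not> g D \<le> N"
      hence "fps_nth (S D) N = 0" using g(4) N by simp
      thus False using D by (simp add: N_def)
    qed
    have "S d \<noteq> 0 \<and> subdegree (S d) = g d" if "d \<le> D" for d
    proof -
      have "g d \<le> g D" by (rule lift_Suc_mono_le[of g, OF g(2) that])
      hence lt: "g d < CHAR('a) ^ N" using \<open>g D \<le> N\<close> N by simp
      have nz: "fps_nth (S d) (g d) \<noteq> 0" by (rule g(5)[OF lt])
      moreover have "subdegree (S d) = g d" by (rule subdegreeI[OF nz]) (use g(4) lt in auto)
      ultimately show ?thesis by auto
    qed
    thus ?thesis using g(2,3) by (intro exI[of _ g]) auto
  qed
  show "S d \<noteq> 0" if "S (Suc d) \<noteq> 0"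
    using *[OF that] by (meson le_SucI order_refl)
  show "2 * subdegree (S (Suc d)) < subdegree (S (Suc (Suc d))) + subdegree (S d)" if nz: "S (Suc (Suc d)) \<noteq> 0"
  proof -
    from *[OF nz] obtain g where g: "\<forall>d. 2 * g (Suc d) < g (Suc (Suc d)) + g d"
      "\<forall>e\<le>Suc (Suc d). S e \<noteq> 0 \<and> subdegree (S e) = g e" by blast
    have "subdegree (S (Suc (Suc d))) = g (Suc (Suc d))" "subdegree (S (Suc d)) = g (Suc d)" "subdegree (S d) = g d"
      using g(2) by auto
    thus ?thesis using g(1) by simp
  qed
qed

section \<open>The zeros of series with a strictly convex Newton polygon\<close>

lemma unique_max_or_tie:
  fixes c :: "nat \<Rightarrow> real"
  assumes nonneg: "\<And>d. 0 \<le> c d" and c0: "c 0 = 1"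
    and conv: "\<And>d. 2 * (c d * c (Suc (Suc d))) \<le> c (Suc d) ^ 2"
    and supp: "\<And>d. c d = 0 \<Longrightarrow> c (Suc d) = 0"
    and lim: "c \<longlonglongrightarrow> 0"
  obtains (unique) k B where "0 \<le> B" "B < c k" "\<And>d. d \<noteq> k \<Longrightarrow> c d \<le> B"
    | (tie) k where "0 < c k" "c (Suc k) = c k" "\<And>d. d \<noteq> k \<Longrightarrow> d \<noteq> Suc k \<Longrightarrow> c d \<le> c k / 2"
proof -
  obtain N where N: "\<And>d. d \<ge> N \<Longrightarrow> c d < 1"
    using order_tendstoD(2)[OF lim, of 1] by (auto simp: eventually_sequentially)
  define m where "m = Max (c ` {..N})"
  have m: "c d \<le> m" for d
  proof (cases "d \<le> N")
    case True thus ?thesis unfolding m_def by (intro Max_ge) auto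
  next
    case False
    have "c 0 \<le> m" unfolding m_def by (intro Max_ge) auto
    thus ?thesis using N[of d] False c0 by simp
  qed
  have "m \<in> c ` {..N}" unfolding m_def by (intro Max_in) auto
  hence ex: "\<exists>k. c k = m" by auto
  \<comment> \<open>\<open>k\<close> is the first place of the maximum. Quotients of consecutive
    terms at least halve, so a quotient 1 at \<open>k\<close> forces quotients at most
    \<open>1 / 2\<close> afterwards and at least 2 before. Without a tie, all other terms are
    bounded by the largest of \<open>c (Suc k)\<close> and the earlier terms, which lies below
    \<open>c k\<close>.\<close>
  define k where "k = (LEAST k. c k = m)"
  have k: "c k = m" unfolding k_def by (rule LeastI_ex[OF ex])
  have kl: "c d < m" if "d < k" for d
    using not_less_Least[of d "\<lambda>k. c k = m"] that m[of d] by (simp add: k_def)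
  have m1: "1 \<le> m" using m[of 0] c0 by simp
  have half: "c (Suc (Suc d)) \<le> c (Suc d) / 2" if "c (Suc d) \<le> c d" for d
  proof (cases "c d = 0")
    case True
    thus ?thesis using supp by simp
  next
    case False
    hence pos: "0 < c d" using nonneg[of d] by simp
    have "2 * (c d * c (Suc (Suc d))) \<le> c d * c (Suc d)"
      using conv[of d] mult_right_mono[OF that nonneg[of "Suc d"]] by (simp add: power2_eq_square)
    hence "c d * (2 * c (Suc (Suc d))) \<le> c d * c (Suc d)" by (simp add: mult_ac)
    thus ?thesis using pos by (simp add: mult_le_cancel_left)
  qed
  have dec: "c (Suc (Suc k + t)) \<le> c (Suc k) / 2 \<and> c (Suc (Suc k + t)) \<le> c (Suc k + t)" for t
  proof (induction t)
    case 0
    have "c (Suc (Suc k)) \<le> c (Suc k) / 2" using half[of k] m[of "Suc k"] k by simp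
    thus ?case using nonneg[of "Suc k"] by simp
  next
    case (Suc t)
    have "c (Suc (Suc (Suc k + t))) \<le> c (Suc (Suc k + t)) / 2" using half[of "Suc k + t"] Suc by blast
    thus ?case using Suc nonneg[of "Suc (Suc k + t)"] by simp
  qed
  have above: "c d \<le> c (Suc k) / 2" if "d > Suc k" for d
    using dec less_imp_Suc_add[OF that] by auto
  show ?thesis
  proof (cases "c (Suc k) = c k")
    case True
    have pos: "0 < c j" if "j \<le> k" for j
    proof -
      have "c j \<noteq> 0" using that
      proof (induction rule: inc_induct)
        case base
        show ?case using k m1 by simp
      next
        case (step j)
        thus ?case using supp by blast
      qed
      thus ?thesis using nonneg[of j] by simp
    qed
    have "c d \<le> c (Suc d) / 2" if "d < k" for d
      using that
    proof (induction rule: strict_inc_induct)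
      case (base d)
      thus ?case using conv[of d] True pos[of k] by (simp add: power2_eq_square mult_le_cancel_right flip: mult.assoc)
    next
      case (step d)
      have "2 * (c d * c (Suc (Suc d))) \<le> c (Suc d) * c (Suc (Suc d))"
        using conv[of d] mult_left_mono[of "c (Suc d)" "c (Suc (Suc d))" "c (Suc d)"] nonneg[of "Suc d"] step.IH
        by (simp add: power2_eq_square)
      hence "(2 * c d) * c (Suc (Suc d)) \<le> c (Suc d) * c (Suc (Suc d))" by (simp add: mult_ac)
      thus ?case using pos[of "Suc (Suc d)"] step.hyps by (simp add: mult_le_cancel_right)
    qed
    hence below: "c d \<le> c k / 2" if "d < k" for d
      using that m[of "Suc d"] k by fastforce
    show ?thesis
    proof (rule tie)
      show "0 < c k" using k m1 by simp
      show "c (Suc k) = c k" by fact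
      show "c d \<le> c k / 2" if "d \<noteq> k" "d \<noteq> Suc k" for d
        using that below[of d] above[of d] True by (cases "d < k") auto
    qed
  next
    case False
    define B where "B = Max (insert (c (Suc k)) (c ` {..<k}))"
    have B: "B \<in> insert (c (Suc k)) (c ` {..<k})" unfolding B_def by (intro Max_in) auto
    have Bge: "x \<le> B" if "x \<in> insert (c (Suc k)) (c ` {..<k})" for x unfolding B_def using that by (intro Max_ge) auto
    show ?thesis
    proof (rule unique[of B k])
      show "0 \<le> B" using Bge[of "c (Suc k)"] nonneg[of "Suc k"] by simp
      show "B < c k" using B kl m[of "Suc k"] False k by auto
      show "c d \<le> B" if "d \<noteq> k" for d
      proof (cases "d < k")
        case True thus ?thesis using Bge by simp
      next
        case False
        hence "c d \<le> c (Suc k)" using above[of d] that nonneg[of "Suc k"] by (cases "d = Suc k") auto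
        thus ?thesis using Bge[of "c (Suc k)"] by simp
      qed
    qed
  qed
qed

text \<open>Quotients of consecutive terms at least halve, so they eventually fall below any
  \<open>\<epsilon>\<close>; \<open>A\<close> takes care of the finitely many terms before
  that.\<close>

lemma superexponential_decay:
  fixes b :: "nat \<Rightarrow> real" and \<epsilon> :: real
  assumes nonneg: "\<And>d. 0 \<le> b d" and b0: "b 0 = 1"
    and conv: "\<And>d. 2 * (b d * b (Suc (Suc d))) \<le> b (Suc d) ^ 2"
    and supp: "\<And>d. b d = 0 \<Longrightarrow> b (Suc d) = 0"
    and eps: "0 < \<epsilon>"
  obtains A where "0 \<le> A" "\<And>d. b d \<le> A * \<epsilon> ^ d"
proof -
  have ratio: "b (Suc d) \<le> (1/2) ^ d * b 1 * b d" for d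
  proof (induction d)
    case (Suc d)
    show ?case
    proof (cases "b d = 0")
      case True
      thus ?thesis using supp by simp
    next
      case False
      hence pos: "0 < b d" using nonneg[of d] by simp
      have "2 * (b d * b (Suc (Suc d))) \<le> b (Suc d) * ((1/2) ^ d * b 1 * b d)"
        using conv[of d] mult_left_mono[OF Suc nonneg[of "Suc d"]] by (simp add: power2_eq_square)
      hence "b d * (2 * b (Suc (Suc d))) \<le> b d * ((1/2) ^ d * b 1 * b (Suc d))" by (simp add: mult_ac)
      hence "2 * b (Suc (Suc d)) \<le> (1/2) ^ d * b 1 * b (Suc d)" using pos by (simp add: mult_le_cancel_left)
      thus ?thesis by simp
    qed
  qed (simp add: b0)
  have "(\<lambda>d. (1/2) ^ d * b 1) \<longlonglongrightarrow> 0 * b 1" by (intro tendsto_mult LIMSEQ_power_zero tendsto_const) simp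
  hence "eventually (\<lambda>d. (1/2) ^ d * b 1 < \<epsilon>) sequentially" using eps by (intro order_tendstoD) auto
  then obtain D where D: "\<And>d. d \<ge> D \<Longrightarrow> (1/2) ^ d * b 1 < \<epsilon>" by (auto simp: eventually_sequentially)
  define A where "A = Max ((\<lambda>d. b d / \<epsilon> ^ d) ` {..D})"
  have A: "b d / \<epsilon> ^ d \<le> A" if "d \<le> D" for d unfolding A_def using that by (intro Max_ge) auto
  have le: "b d \<le> A * \<epsilon> ^ d" for d
  proof (induction d)
    case 0
    show ?case using A[of 0] by simp
  next
    case (Suc d)
    show ?case
    proof (cases "Suc d \<le> D")
      case True
      thus ?thesis using A[OF True] eps by (simp add: field_simps)
    next
      case False
      have "b (Suc d) \<le> \<epsilon> * b d"
        using ratio[of d] mult_right_mono[OF less_imp_le[OF D[of d]] nonneg[of d]] False by simp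
      also have "... \<le> \<epsilon> * (A * \<epsilon> ^ d)" using Suc eps by simp
      finally show ?thesis by (simp add: mult_ac)
    qed
  qed
  moreover have "0 \<le> A" using A[of 0] b0 by simp
  ultimately show ?thesis using that by blast
qed

section \<open>Ultrametric analysis in the completed closure\<close>

context completed_alg_closure
begin

definition nrm :: "'c \<Rightarrow> real" where "nrm u = dist u 0"

lemma dist_nrm: "dist u v = nrm (u - v)"
  unfolding nrm_def by (rule dist_diff)

lemma nrm_0 [simp]: "nrm 0 = 0" by (simp add: nrm_def)
lemma nrm_eq_0 [simp]: "nrm u = 0 \<longleftrightarrow> u = 0" by (simp add: nrm_def)
lemma nrm_nonneg [simp]: "0 \<le> nrm u" by (simp add: nrm_def)
lemma nrm_pos: "0 < nrm u \<longleftrightarrow> u \<noteq> 0" by (simp add: nrm_def)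
lemma nrm_mult: "nrm (u * v) = nrm u * nrm v" by (simp add: nrm_def abs_mult)
lemma nrm_add: "nrm (u + v) \<le> max (nrm u) (nrm v)" by (simp add: nrm_def abs_add)

lemma nrm_1 [simp]: "nrm 1 = 1"
  using nrm_mult[of 1 1] nrm_eq_0[of 1] by simp

lemma nrm_power: "nrm (u ^ n) = nrm u ^ n"
  by (induction n) (simp_all add: nrm_mult)

lemma nrm_minus [simp]: "nrm (- u) = nrm u"
proof -
  have "nrm (- 1) * nrm (- 1) = 1" using nrm_mult[of "- 1" "- 1"] by simp
  hence "nrm (- 1) = 1" using nrm_nonneg[of "- 1"] by (metis abs_of_nonneg real_sqrt_abs2 real_sqrt_one)
  thus ?thesis using nrm_mult[of "- 1" u] by simp
qed

lemma nrm_diff: "nrm (u - v) \<le> max (nrm u) (nrm v)"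
  using nrm_add[of u "- v"] by simp

lemma nrm_commute: "nrm (u - v) = nrm (v - u)"
  using nrm_minus[of "u - v"] by simp

lemma nrm_inverse: "nrm (inverse u) = inverse (nrm u)"
proof (cases "u = 0")
  case False
  hence "nrm u * nrm (inverse u) = 1" by (simp flip: nrm_mult)
  thus ?thesis by (simp add: inverse_unique)
qed simp

lemma nrm_divide: "nrm (u / v) = nrm u / nrm v"
  by (simp add: divide_inverse nrm_mult nrm_inverse)

text \<open>In an ultrametric triangle the two longest sides are equal.\<close>

lemma nrm_add_eq:
  assumes "nrm u < nrm v"
  shows "nrm (u + v) = nrm v"
  using nrm_add[of u v] nrm_diff[of "u + v" u] assms by (auto simp: max_def split: if_splits)

lemma nrm_sum_le:
  assumes "0 \<le> B" "\<And>i. i \<in> A \<Longrightarrow> nrm (g i) \<le> B"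
  shows "nrm (\<Sum>i\<in>A. g i) \<le> B"
  using assms(2)
proof (induction A rule: infinite_finite_induct)
  case (insert x F)
  thus ?case using nrm_add[of "g x" "sum g F"] by force
qed (use assms in auto)

lemma LIMSEQ_nrm: "xs \<longlonglongrightarrow> L \<longleftrightarrow> (\<lambda>n. nrm (xs n - L)) \<longlonglongrightarrow> 0"
  unfolding tendsto_dist_iff[of xs] dist_nrm ..

text \<open>The type carries only a field structure and a metric, so continuity of subtraction is
  derived from the ultrametric inequality.\<close>

lemma LIMSEQ_nrm_diff:
  fixes xs ys :: "nat \<Rightarrow> 'c"
  assumes "xs \<longlonglongrightarrow> L" "ys \<longlonglongrightarrow> K"
  shows "(\<lambda>n. xs n - ys n) \<longlonglongrightarrow> L - K"
proof -
  have "(\<lambda>n. nrm (xs n - L) + nrm (ys n - K)) \<longlonglongrightarrow> 0 + 0"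
    using assms[unfolded LIMSEQ_nrm] by (rule tendsto_add)
  hence lim: "(\<lambda>n. nrm (xs n - L) + nrm (ys n - K)) \<longlonglongrightarrow> 0" by simp
  have le: "norm (nrm (xs n - ys n - (L - K))) \<le> nrm (xs n - L) + nrm (ys n - K)" for n
  proof -
    have "xs n - ys n - (L - K) = (xs n - L) - (ys n - K)" by simp
    hence "nrm (xs n - ys n - (L - K)) \<le> max (nrm (xs n - L)) (nrm (ys n - K))" by (simp only: nrm_diff)
    thus ?thesis using nrm_nonneg[of "xs n - L"] nrm_nonneg[of "ys n - K"] nrm_nonneg[of "xs n - ys n - (L - K)"]
      unfolding real_norm_def by linarith
  qed
  show ?thesis unfolding LIMSEQ_nrm by (rule Lim_null_comparison[OF always_eventually lim]) (use le in blast)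
qed

lemma LIMSEQ_nrm_cmult:
  fixes xs :: "nat \<Rightarrow> 'c"
  assumes "xs \<longlonglongrightarrow> L"
  shows "(\<lambda>n. c * xs n) \<longlonglongrightarrow> c * L"
proof -
  have "(\<lambda>n. nrm c * nrm (xs n - L)) \<longlonglongrightarrow> nrm c * 0"
    by (rule tendsto_mult[OF tendsto_const assms[unfolded LIMSEQ_nrm]])
  moreover have "nrm (c * xs n - c * L) = nrm c * nrm (xs n - L)" for n by (simp flip: nrm_mult right_diff_distrib)
  ultimately show ?thesis unfolding LIMSEQ_nrm by simp
qed

lemma sums_nrm_diff: "g sums s \<Longrightarrow> h sums t \<Longrightarrow> (\<lambda>n. g n - h n :: 'c) sums (s - t)"
  unfolding sums_def sum_subtractf by (rule LIMSEQ_nrm_diff)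

lemma sums_nrm_cmult: "g sums s \<Longrightarrow> (\<lambda>n. c * g n :: 'c) sums (c * s)"
  unfolding sums_def sum_distrib_left[symmetric] by (rule LIMSEQ_nrm_cmult)

lemma sums_nrm_le:
  assumes "g sums s" "0 \<le> B" "\<And>n. nrm (g n) \<le> B"
  shows "nrm s \<le> B"
proof -
  have "(\<lambda>n. dist (\<Sum>i<n. g i) 0) \<longlonglongrightarrow> dist s 0"
    using assms(1) unfolding sums_def by (intro tendsto_dist tendsto_const)
  moreover have "dist (\<Sum>i<n. g i) 0 \<le> B" for n
    using nrm_sum_le[of B "{..<n}" g] assms by (simp add: nrm_def)
  ultimately have "dist s 0 \<le> B" by (intro LIMSEQ_le_const2) auto
  thus ?thesis by (simp add: nrm_def)
qed

lemma sums_nrm_tail: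
  assumes "g sums s" "0 \<le> B" "finite A" "\<And>n. n \<notin> A \<Longrightarrow> nrm (g n) \<le> B"
  shows "nrm (s - (\<Sum>n\<in>A. g n)) \<le> B"
proof (rule sums_nrm_le)
  show "(\<lambda>n. g n - (if n \<in> A then g n else 0)) sums (s - (\<Sum>n\<in>A. g n))"
    using assms by (intro sums_nrm_diff sums_If_finite_set)
  show "nrm (g n - (if n \<in> A then g n else 0)) \<le> B" for n using assms by auto
qed fact

text \<open>This serves twice: a vanishing series cannot have a single dominant term, and the
  cofactor of the linear factor does not vanish at the zero.\<close>

lemma sums_nrm_dominant:
  assumes "g sums s" "0 \<le> B" "B < nrm (g k)" "\<And>n. n \<noteq> k \<Longrightarrow> nrm (g n) \<le> B"
  shows "nrm s = nrm (g k)"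
proof -
  have "nrm (s - (\<Sum>n\<in>{k}. g n)) \<le> B" using assms by (intro sums_nrm_tail) auto
  hence "nrm ((s - g k) + g k) = nrm (g k)" using assms by (intro nrm_add_eq) auto
  thus ?thesis by simp
qed

lemma summable_nrm:
  assumes "(\<lambda>n. nrm (g n)) \<longlonglongrightarrow> 0"
  shows "summable g"
proof -
  have "Cauchy (\<lambda>n. \<Sum>i<n. g i)"
  proof (rule metric_CauchyI)
    fix e :: real assume e: "e > 0"
    then obtain N where N: "\<And>n. n \<ge> N \<Longrightarrow> nrm (g n) < e / 2"
      using order_tendstoD(2)[OF assms, of "e / 2"] by (auto simp: eventually_sequentially)
    have le: "nrm ((\<Sum>i<n. g i) - (\<Sum>i<m. g i)) \<le> e / 2" if "N \<le> m" "m \<le> n" for m n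
    proof -
      have "(\<Sum>i<n. g i) - (\<Sum>i<m. g i) = (\<Sum>i\<in>{m..<n}. g i)"
        using that(2) by (simp add: sum_diff_nat_ivl atLeast0LessThan[symmetric])
      moreover have "nrm (\<Sum>i\<in>{m..<n}. g i) \<le> e / 2"
        by (rule nrm_sum_le) (use N that(1) e in \<open>auto intro: less_imp_le\<close>)
      ultimately show ?thesis by simp
    qed
    have "dist (\<Sum>i<m. g i) (\<Sum>i<n. g i) < e" if "N \<le> m" "N \<le> n" for m n
      using le[of m n] le[of n m] that e unfolding dist_nrm
      by (cases "m \<le> n") (auto simp: nrm_commute[of "\<Sum>i<m. g i"])
    thus "\<exists>M. \<forall>m\<ge>M. \<forall>n\<ge>M. dist (\<Sum>i<m. g i) (\<Sum>i<n. g i) < e" by blast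
  qed
  then obtain L where "(\<lambda>n. \<Sum>i<n. g i) \<longlonglongrightarrow> L" using Cauchy_convergent convergent_def by blast
  thus ?thesis by (auto simp: summable_def sums_def)
qed

section \<open>Laurent series and their integral elements inside the completed closure\<close>

definition of_fls :: "'a fls \<Rightarrow> 'c" where "of_fls g = emb (to_ac g)"

lemma of_fls_add: "of_fls (g + h) = of_fls g + of_fls h" by (simp add: of_fls_def emb_add)
lemma of_fls_mult: "of_fls (g * h) = of_fls g * of_fls h" by (simp add: of_fls_def emb_mult)
lemma of_fls_1: "of_fls 1 = 1" by (simp add: of_fls_def emb_1)
lemma of_fls_0: "of_fls 0 = 0" using of_fls_add[of 0 0] by (metis add.right_neutral add_left_cancel)
lemma of_fls_minus: "of_fls (- g) = - of_fls g" using of_fls_add[of g "- g"] by (simp add: of_fls_0 eq_neg_iff_add_eq_0 add.commute)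
lemma of_fls_diff: "of_fls (g - h) = of_fls g - of_fls h" using of_fls_add[of g "- h"] by (simp add: of_fls_minus)
lemma of_fls_power: "of_fls (g ^ n) = of_fls g ^ n" by (induction n) (simp_all add: of_fls_1 of_fls_mult)
lemma nrm_of_fls: "nrm (of_fls g) = dist g 0" by (simp add: nrm_def of_fls_def abs_emb)

lemma of_fls_inverse: "of_fls (inverse g) = inverse (of_fls g)"
proof (cases "g = 0")
  case False
  hence "of_fls g * of_fls (inverse g) = 1" by (simp add: of_fls_1 flip: of_fls_mult)
  thus ?thesis by (simp add: inverse_unique)
qed (simp add: of_fls_0)

lemma of_fls_divide: "of_fls (g / h) = of_fls g / of_fls h"
  by (simp add: divide_inverse of_fls_mult of_fls_inverse)

lemma nrm_of_fls_fps: "nrm (of_fls (fps_to_fls S)) = (if S = 0 then 0 else (1 / 2) ^ subdegree S)"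
  by (simp add: nrm_of_fls dist_fls_def fls_subdegree_fls_to_fps power_one_over inverse_eq_divide)

text \<open>This is the valuation ring of the embedded base field.\<close>

definition \<O> :: "'c set" where "\<O> = range (\<lambda>h. of_fls (fps_to_fls h))"

lemma of_fls_in_\<O>: "nrm (of_fls g) \<le> 1 \<Longrightarrow> of_fls g \<in> \<O>"
proof -
  assume "nrm (of_fls g) \<le> 1"
  hence le: "dist g 0 \<le> 1" by (simp add: nrm_of_fls)
  have "0 \<le> fls_subdegree g"
  proof (rule ccontr)
    assume neg: "\<not> 0 \<le> fls_subdegree g"
    hence "dist g 0 = 2 ^ nat (- fls_subdegree g)" by (auto simp: dist_fls_def)
    moreover have "(2 :: real) ^ 1 \<le> 2 ^ nat (- fls_subdegree g)" using neg by (intro power_increasing) auto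
    ultimately show False using le by simp
  qed
  hence "g = fps_to_fls (fls_regpart g)" by simp
  thus "of_fls g \<in> \<O>" unfolding \<O>_def by (metis rangeI)
qed

lemma \<O>_add: assumes "u \<in> \<O>" "v \<in> \<O>" shows "u + v \<in> \<O>"
proof -
  obtain g h where "u = of_fls (fps_to_fls g)" "v = of_fls (fps_to_fls h)" using assms unfolding \<O>_def by blast
  hence "u + v = of_fls (fps_to_fls (g + h))" by (simp add: of_fls_add)
  thus ?thesis unfolding \<O>_def by blast
qed

lemma \<O>_mult: assumes "u \<in> \<O>" "v \<in> \<O>" shows "u * v \<in> \<O>"
proof -
  obtain g h where "u = of_fls (fps_to_fls g)" "v = of_fls (fps_to_fls h)" using assms unfolding \<O>_def by blast
  hence "u * v = of_fls (fps_to_fls (g * h))" by (simp add: of_fls_mult fls_times_fps_to_fls)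
  thus ?thesis unfolding \<O>_def by blast
qed

lemma \<O>_1: "1 \<in> \<O>"
  using of_fls_in_\<O>[of 1] by (simp add: of_fls_1)

lemma \<O>_0: "0 \<in> \<O>"
  using of_fls_in_\<O>[of 0] by (simp add: of_fls_0)

lemma \<O>_power: "u \<in> \<O> \<Longrightarrow> u ^ n \<in> \<O>"
  by (induction n) (simp_all add: \<O>_1 \<O>_mult)

lemma \<O>_sum: "(\<And>i. i \<in> A \<Longrightarrow> g i \<in> \<O>) \<Longrightarrow> (\<Sum>i\<in>A. g i) \<in> \<O>"
  by (induction A rule: infinite_finite_induct) (simp_all add: \<O>_0 \<O>_add)

text \<open>The norm of a difference is read off from its subdegree, so in a Cauchy sequence every
  coefficient is eventually constant, and the series of these constants is the limit.\<close>

lemma complete_\<O>: "complete \<O>"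
proof (rule completeI)
  fix g :: "nat \<Rightarrow> 'c" assume g: "\<forall>n. g n \<in> \<O>" "Cauchy g"
  then obtain h where h: "\<And>n. g n = of_fls (fps_to_fls (h n))" unfolding \<O>_def image_iff bex_UNIV by metis
  have dist: "dist (of_fls (fps_to_fls a)) (of_fls (fps_to_fls b)) = (if a = b then 0 else (1 / 2) ^ subdegree (a - b))" for a b :: "'a fps"
    unfolding dist_nrm by (simp add: nrm_of_fls_fps flip: of_fls_diff fps_to_fls_minus)
  have "\<exists>N. \<forall>m\<ge>N. fps_nth (h m) k = fps_nth (h N) k" for k
  proof -
    obtain N where N: "\<And>m n. m \<ge> N \<Longrightarrow> n \<ge> N \<Longrightarrow> dist (g m) (g n) < (1 / 2) ^ k"
      using metric_CauchyD[OF g(2), of "(1 / 2) ^ k"] by auto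
    have "fps_nth (h m) k = fps_nth (h N) k" if "m \<ge> N" for m
    proof (cases "h m = h N")
      case False
      hence "(1 / 2 :: real) ^ subdegree (h m - h N) < (1 / 2) ^ k" using N[OF that, of N] by (simp add: h dist)
      hence "k < subdegree (h m - h N)" by (simp add: power_strict_decreasing_iff)
      hence "fps_nth (h m - h N) k = 0" by (rule nth_less_subdegree_zero)
      thus ?thesis by simp
    qed simp
    thus ?thesis by blast
  qed
  then obtain N where N: "\<And>k m. m \<ge> N k \<Longrightarrow> fps_nth (h m) k = fps_nth (h (N k)) k" by metis
  define L where "L = Abs_fps (\<lambda>k. fps_nth (h (N k)) k)"
  have "h \<longlonglongrightarrow> L"
  proof (rule tendsto_fpsI)
    show "\<forall>\<^sub>F n in sequentially. fps_nth (h n) k = fps_nth L k" for k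
      using eventually_ge_at_top[of "N k"] by eventually_elim (unfold L_def fps_nth_Abs_fps, rule N)
  qed
  hence "(\<lambda>n. dist (h n) L) \<longlonglongrightarrow> 0" by (rule iffD1[OF tendsto_dist_iff])
  moreover have "dist (h n) L = dist (g n) (of_fls (fps_to_fls L))" for n
    by (simp add: h dist dist_fps_def power_one_over inverse_eq_divide)
  ultimately have "g \<longlonglongrightarrow> of_fls (fps_to_fls L)"
    by (subst tendsto_dist_iff) (simp only:)
  thus "\<exists>l\<in>\<O>. g \<longlonglongrightarrow> l" unfolding \<O>_def by blast
qed

lemma closed_\<O>: "closed \<O>"
  by (rule complete_imp_closed[OF complete_\<O>])

lemma sums_in_\<O>:
  assumes "g sums s" "\<And>n. g n \<in> \<O>"
  shows "s \<in> \<O>"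
  using closed_sequentially[OF closed_\<O>, of "\<lambda>n. \<Sum>i<n. g i" s] assms by (simp add: \<O>_sum sums_def)

text \<open>A series with dominating terms 1 and \<open>-w\<close> at two consecutive places has its zeros near 1
  as fixed points of a contraction, which preserves the integral elements of the base field.\<close>

lemma zero_near_1_in_\<O>:
  fixes e :: "nat \<Rightarrow> 'c"
  assumes e: "\<And>d. e d \<in> \<O>" and ek: "e k = 1" "e (Suc k) = - 1"
    and small: "\<And>d. d \<noteq> k \<Longrightarrow> d \<noteq> Suc k \<Longrightarrow> nrm (e d) \<le> 1 / 2"
    and lim: "(\<lambda>d. nrm (e d)) \<longlonglongrightarrow> 0"
    and u: "nrm u = 1" "(\<lambda>d. e d * u ^ d) sums 0"
  shows "u \<in> \<O>"
proof -
  define G where "G w = (\<Sum>d. e d * w ^ d)" for w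
  have G: "(\<lambda>d. e d * w ^ d) sums G w" if "nrm w \<le> 1" for w
  proof -
    have "(\<lambda>d. nrm (e d * w ^ d)) \<longlonglongrightarrow> 0"
    proof (rule Lim_null_comparison[OF always_eventually lim], rule allI)
      fix d
      have "nrm w ^ d \<le> 1" using that by (intro power_le_one) auto
      thus "norm (nrm (e d * w ^ d)) \<le> nrm (e d)"
        using mult_left_le[of "nrm w ^ d" "nrm (e d)"] by (simp add: nrm_mult nrm_power)
    qed
    thus ?thesis unfolding G_def by (intro summable_sums summable_nrm)
  qed
  define Bl where "Bl = cball (1 :: 'c) (1 / 2)"
  have Bl: "w \<in> Bl \<longleftrightarrow> nrm (w - 1) \<le> 1 / 2" for w
    by (simp add: Bl_def dist_nrm nrm_commute[of 1])
  have Bl1: "nrm w = 1" if "w \<in> Bl" for w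
    using nrm_add_eq[of "w - 1" 1] that by (simp add: Bl)
  have sum_split: "(\<Sum>n\<in>{k, Suc k}. g n) = g k + g (Suc k)" for g :: "nat \<Rightarrow> 'c" by simp
  \<comment> \<open>Near 1 the dominating part \<open>w ^ k - w ^ Suc k\<close> has derivative close
    to \<open>- 1\<close>, so adding \<open>w\<close> cancels the linear term and leaves a
    contraction with constant \<open>1 / 2\<close>.\<close>
  define \<Phi> where "\<Phi> w = w + G w" for w
  have contr: "nrm (\<Phi> w - \<Phi> v) \<le> 1 / 2 * nrm (w - v)" if "w \<in> Bl" "v \<in> Bl" for w v
  proof -
    have nw: "nrm w = 1" "nrm v = 1" using that Bl1 by auto
    define S where "S d = (\<Sum>i<d. v ^ (d - Suc i) * w ^ i)" for d
    have S: "w ^ d - v ^ d = (w - v) * S d" for d unfolding S_def by (rule power_diff_sumr2)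
    have S1: "nrm (S d) \<le> 1" for d unfolding S_def by (rule nrm_sum_le) (simp_all add: nrm_mult nrm_power nw)
    have SSuc: "S (Suc k) = v * S k + w ^ k"
    proof -
      have "S (Suc k) = (\<Sum>i<k. v ^ (Suc k - Suc i) * w ^ i) + w ^ k" by (simp add: S_def)
      also have "(\<Sum>i<k. v ^ (Suc k - Suc i) * w ^ i) = (\<Sum>i<k. v * (v ^ (k - Suc i) * w ^ i))"
        by (intro sum.cong refl) (simp add: Suc_diff_Suc mult.assoc flip: power_Suc)
      finally show ?thesis by (simp add: S_def sum_distrib_left)
    qed
    define T where "T d = e d * w ^ d - e d * v ^ d" for d
    have T: "T d = (w - v) * (e d * S d)" for d
      unfolding T_def right_diff_distrib[symmetric] S by (simp add: mult_ac)
    have "T sums (G w - G v)" unfolding T_def using G nw by (intro sums_nrm_diff) auto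
    hence "nrm (G w - G v - (\<Sum>n\<in>{k, Suc k}. T n)) \<le> 1 / 2 * nrm (w - v)"
    proof (rule sums_nrm_tail)
      fix d assume "d \<notin> {k, Suc k}"
      hence "nrm (e d * S d) \<le> 1 / 2 * 1" unfolding nrm_mult using small S1 by (intro mult_mono) auto
      thus "nrm (T d) \<le> 1 / 2 * nrm (w - v)"
        unfolding T using mult_left_mono[of "nrm (e d * S d)" "1 / 2" "nrm (w - v)"] by (simp add: nrm_mult mult.commute)
    qed auto
    hence 1: "nrm (G w - G v - (T k + T (Suc k))) \<le> 1 / 2 * nrm (w - v)" unfolding sum_split .
    have "(w - v) + (T k + T (Suc k)) = (w - v) * ((1 - v) * S k + (1 - w ^ k))"
      unfolding T ek SSuc by (simp add: algebra_simps)
    moreover have "nrm ((1 - v) * S k + (1 - w ^ k)) \<le> 1 / 2"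
    proof -
      have "nrm ((1 - v) * S k) \<le> 1 / 2 * 1"
        unfolding nrm_mult using that(2) S1[of k] by (intro mult_mono) (auto simp: Bl nrm_commute[of 1])
      moreover have "nrm (1 - w ^ k) \<le> 1 / 2"
      proof -
        have "w ^ k - 1 ^ k = (w - 1) * (\<Sum>i<k. 1 ^ (k - Suc i) * w ^ i)" by (rule power_diff_sumr2)
        moreover have "nrm (\<Sum>i<k. 1 ^ (k - Suc i) * w ^ i) \<le> 1"
          by (rule nrm_sum_le) (simp_all add: nrm_power nw)
        hence "nrm ((w - 1) * (\<Sum>i<k. 1 ^ (k - Suc i) * w ^ i)) \<le> 1 / 2 * 1"
          unfolding nrm_mult using that(1) by (intro mult_mono) (auto simp: Bl)
        ultimately have "nrm (w ^ k - 1) \<le> 1 / 2" by simp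
        thus ?thesis by (simp add: nrm_commute[of 1])
      qed
      ultimately show ?thesis using nrm_add[of "(1 - v) * S k" "1 - w ^ k"] by simp
    qed
    ultimately have 2: "nrm ((w - v) + (T k + T (Suc k))) \<le> 1 / 2 * nrm (w - v)"
      using mult_left_mono[of "nrm ((1 - v) * S k + (1 - w ^ k))" "1 / 2" "nrm (w - v)"] by (simp add: nrm_mult mult.commute)
    have "\<Phi> w - \<Phi> v = (G w - G v - (T k + T (Suc k))) + ((w - v) + (T k + T (Suc k)))"
      by (simp add: \<Phi>_def)
    also have "nrm ... \<le> max (nrm (G w - G v - (T k + T (Suc k)))) (nrm ((w - v) + (T k + T (Suc k))))" by (rule nrm_add)
    also have "... \<le> 1 / 2 * nrm (w - v)" using 1 2 by simp
    finally show ?thesis .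
  qed
  have tail: "nrm (s - (e k * w ^ k + e (Suc k) * w ^ Suc k)) \<le> 1 / 2" if "(\<lambda>d. e d * w ^ d) sums s" "nrm w = 1" for w s
  proof -
    have "nrm (s - (\<Sum>n\<in>{k, Suc k}. e n * w ^ n)) \<le> 1 / 2"
      using that small by (intro sums_nrm_tail) (auto simp: nrm_mult nrm_power)
    thus ?thesis unfolding sum_split .
  qed
  \<comment> \<open>In a vanishing sum the two dominating terms must nearly cancel, and since
    \<open>u ^ k\<close> has norm 1 this puts \<open>u\<close> within \<open>1 / 2\<close> of
    1.\<close>
  have uB: "u \<in> Bl"
  proof -
    have "0 - (e k * u ^ k + e (Suc k) * u ^ Suc k) = u ^ k * (u - 1)" using ek by (simp add: algebra_simps)
    hence "nrm (u ^ k * (u - 1)) \<le> 1 / 2" using tail[OF u(2,1)] by simp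
    thus ?thesis by (simp add: nrm_mult nrm_power u(1) Bl)
  qed
  have \<Phi>1: "nrm (\<Phi> 1 - 1) \<le> 1 / 2"
    using tail[OF G[of 1]] ek by (simp add: \<Phi>_def)
  have oneB: "1 \<in> Bl" by (simp add: Bl)
  have \<Phi>B: "\<Phi> w \<in> Bl" if "w \<in> Bl" for w
  proof -
    have "nrm (\<Phi> w - \<Phi> 1) \<le> 1 / 2" using contr[OF that oneB] that by (simp add: Bl)
    moreover have "\<Phi> w - 1 = (\<Phi> w - \<Phi> 1) + (\<Phi> 1 - 1)" by simp
    ultimately show ?thesis unfolding Bl using nrm_add[of "\<Phi> w - \<Phi> 1" "\<Phi> 1 - 1"] \<Phi>1 by simp
  qed
  have \<Phi>R: "\<Phi> w \<in> \<O>" if "w \<in> \<O>" "w \<in> Bl" for w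
  proof -
    have "(\<lambda>d. e d * w ^ d) sums G w" by (rule G) (simp add: Bl1[OF that(2)])
    hence "G w \<in> \<O>" by (rule sums_in_\<O>) (intro \<O>_mult \<O>_power e that(1))
    thus ?thesis unfolding \<Phi>_def by (rule \<O>_add[OF that(1)])
  qed
  have "\<exists>!w\<in>\<O> \<inter> Bl. \<Phi> w = w"
  proof (rule Banach_fix)
    show "complete (\<O> \<inter> Bl)" unfolding Bl_def by (rule complete_Int_closed[OF complete_\<O>]) simp
    show "\<O> \<inter> Bl \<noteq> {}" using \<O>_1 oneB by blast
    show "\<Phi> ` (\<O> \<inter> Bl) \<subseteq> \<O> \<inter> Bl" using \<Phi>R \<Phi>B by auto
    show "dist (\<Phi> w) (\<Phi> v) \<le> 1 / 2 * dist w v" if "w \<in> \<O> \<inter> Bl" "v \<in> \<O> \<inter> Bl" for w v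
      using contr[of w v] that by (simp add: dist_nrm)
  qed auto
  then obtain w where w: "w \<in> \<O>" "w \<in> Bl" "\<Phi> w = w" by blast
  have "\<Phi> u = u" using sums_unique[OF u(2)] by (simp add: \<Phi>_def G_def)
  \<comment> \<open>The map contracts the ball in the whole completed closure and not just its
    integral part, so \<open>u\<close> is the fixed point found there.\<close>
  hence "nrm (u - w) \<le> 1 / 2 * nrm (u - w)" using contr[OF uB w(2)] w(3) by simp
  hence "nrm (u - w) = 0" using nrm_nonneg[of "u - w"] by linarith
  thus ?thesis using w(1) by simp
qed

text \<open>Division by \<open>X - x\<close> produces coefficients built from the partial sums
  \<open>T n\<close>. As the whole sum is 0, \<open>T n\<close> is also minus a tail, and the decay
  of the tails makes the quotient entire. At \<open>x\<close> its terms have norm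
  \<open>nrm (T n) / nrm x\<close>. Only for \<open>n = k\<close> does the partial sum separate the
  two dominating terms, so this term prevails.\<close>

lemma has_zero_of_order_1I:
  fixes s :: "nat \<Rightarrow> 'c"
  assumes decay: "\<And>\<epsilon>. 0 < \<epsilon> \<Longrightarrow> \<exists>A\<ge>0. \<forall>d. nrm (s d) \<le> A * \<epsilon> ^ d"
    and x: "x \<noteq> 0" and zero: "(\<lambda>d. s d * x ^ d) sums 0"
    and k: "nrm (s k * x ^ k) = m" "0 < m"
    and small: "\<And>d. d \<noteq> k \<Longrightarrow> d \<noteq> Suc k \<Longrightarrow> nrm (s d * x ^ d) \<le> m / 2"
  shows "has_zero_of_order (Abs_fps s) x 1"
proof -
  define r where "r = nrm x"
  have r: "0 < r" using x by (simp add: r_def nrm_pos)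
  define T where "T n = (\<Sum>d\<le>n. s d * x ^ d)" for n
  define G where "G = Abs_fps (\<lambda>n. - T n / x ^ Suc n)"
  have Gn: "fps_nth G n = - T n / x ^ Suc n" for n by (simp add: G_def)
  have T_le: "nrm (T n) \<le> B" if "0 \<le> B" "\<And>d. d > n \<Longrightarrow> nrm (s d * x ^ d) \<le> B" for n B
  proof -
    have "nrm (0 - (\<Sum>d\<in>{..n}. s d * x ^ d)) \<le> B"
      by (rule sums_nrm_tail[OF zero that(1)]) (use that(2) in auto)
    thus ?thesis by (simp add: T_def)
  qed
  have factor: "Abs_fps s = (fps_X - fps_const x) ^ 1 * G"
  proof (rule fps_ext)
    fix n
    have "T (Suc i) = T i + s (Suc i) * x ^ Suc i" for i by (simp add: T_def)
    thus "fps_nth (Abs_fps s) n = fps_nth ((fps_X - fps_const x) ^ 1 * G) n"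
      using x by (cases n) (simp_all add: left_diff_distrib Gn T_def field_simps)
  qed
  have lim: "(\<lambda>n. nrm (fps_nth G n * y ^ n)) \<longlonglongrightarrow> 0" for y
  proof -
    obtain w where w: "nrm y = w" and ny: "0 \<le> w" using nrm_nonneg by blast
    \<comment> \<open>The first bound gives \<open>\<epsilon> * r \<le> 1\<close>, so that a tail is
      estimated by its first term. The second makes the terms at \<open>y\<close> decay like
      \<open>(1 / 2) ^ n\<close>; the summand 1 covers \<open>y = 0\<close>.\<close>
    define \<epsilon> where "\<epsilon> = min (1 / r) (1 / (2 * (w + 1)))"
    have e0: "0 < \<epsilon>" using r ny by (auto simp: \<epsilon>_def)
    have er: "\<epsilon> * r \<le> 1"
      using mult_right_mono[of \<epsilon> "1 / r" r] r by (simp add: \<epsilon>_def)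
    have ey: "\<epsilon> * w \<le> 1 / 2"
    proof -
      have "\<epsilon> * (w + 1) \<le> 1 / (2 * (w + 1)) * (w + 1)"
        using ny by (intro mult_right_mono) (auto simp: \<epsilon>_def)
      also have "... = 1 / 2" using ny by (simp add: field_simps)
      finally show ?thesis using e0 by (simp add: distrib_left)
    qed
    obtain A where A: "0 \<le> A" "\<And>d. nrm (s d) \<le> A * \<epsilon> ^ d" using decay[OF e0] by blast
    have "nrm (T n) \<le> A * (\<epsilon> * r) ^ Suc n" for n
    proof (rule T_le)
      show "0 \<le> A * (\<epsilon> * r) ^ Suc n" using A(1) e0 r by simp
      fix d assume "d > n"
      have "nrm (s d * x ^ d) \<le> A * \<epsilon> ^ d * r ^ d"
        unfolding nrm_mult nrm_power r_def by (intro mult_right_mono A) simp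
      also have "... = A * (\<epsilon> * r) ^ d" by (simp add: power_mult_distrib)
      also have "... \<le> A * (\<epsilon> * r) ^ Suc n"
        using \<open>d > n\<close> A(1) e0 r er by (intro mult_left_mono power_decreasing) auto
      finally show "nrm (s d * x ^ d) \<le> A * (\<epsilon> * r) ^ Suc n" .
    qed
    hence "nrm (T n) / r ^ Suc n \<le> A * \<epsilon> ^ Suc n" for n
      using r by (simp add: pos_divide_le_eq power_mult_distrib mult_ac)
    hence G_le: "nrm (fps_nth G n) \<le> A * \<epsilon> ^ Suc n" for n
      unfolding Gn nrm_divide nrm_minus nrm_power r_def[symmetric] .
    have le: "nrm (fps_nth G n * y ^ n) \<le> (A * \<epsilon>) * (1 / 2) ^ n" for n
    proof -
      have "nrm (fps_nth G n * y ^ n) \<le> A * \<epsilon> ^ Suc n * w ^ n"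
        unfolding nrm_mult nrm_power w by (intro mult_right_mono G_le) (simp add: ny)
      also have "... = (A * \<epsilon>) * (\<epsilon> * w) ^ n" by (simp add: power_mult_distrib)
      also have "... \<le> (A * \<epsilon>) * (1 / 2) ^ n"
        using A(1) e0 ny ey by (intro mult_left_mono power_mono) auto
      finally show ?thesis .
    qed
    have "(\<lambda>n. (A * \<epsilon>) * (1 / 2) ^ n) \<longlonglongrightarrow> (A * \<epsilon>) * 0"
      by (intro tendsto_mult tendsto_const LIMSEQ_power_zero) simp
    hence lim0: "(\<lambda>n. (A * \<epsilon>) * (1 / 2) ^ n) \<longlonglongrightarrow> 0" by simp
    show ?thesis
      by (rule Lim_null_comparison[OF always_eventually lim0]) (use le in simp)
  qed
  have "entire_series G" unfolding entire_series_def using summable_nrm[OF lim] by blast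
  moreover have "eval_series G x \<noteq> 0"
  proof -
    have sums: "(\<lambda>n. fps_nth G n * x ^ n) sums eval_series G x"
      unfolding eval_series_def by (rule summable_sums[OF summable_nrm[OF lim]])
    have nG: "nrm (fps_nth G n * x ^ n) = nrm (T n) / r" for n
      using r by (simp add: Gn nrm_mult nrm_divide nrm_power r_def)
    have low: "nrm (\<Sum>d\<in>{..<n}. s d * x ^ d) \<le> m / 2" if "n \<le> k" for n
      by (rule nrm_sum_le) (use k(2) that small in auto)
    have "T k = (\<Sum>d\<in>{..<k}. s d * x ^ d) + s k * x ^ k" by (simp add: T_def flip: lessThan_Suc_atMost)
    hence Tk: "nrm (T k) = m" using nrm_add_eq[of "\<Sum>d\<in>{..<k}. s d * x ^ d" "s k * x ^ k"] low[of k] k by simp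
    have T_small: "nrm (T n) \<le> m / 2" if "n \<noteq> k" for n
    proof (cases "n < k")
      case True
      thus ?thesis using low[of "Suc n"] by (simp add: T_def flip: lessThan_Suc_atMost)
    next
      case False
      thus ?thesis using that k(2) small by (intro T_le) auto
    qed
    have "nrm (eval_series G x) = nrm (fps_nth G k * x ^ k)"
    proof (rule sums_nrm_dominant[OF sums, of "m / 2 / r"])
      show "0 \<le> m / 2 / r" using k(2) r by simp
      show "m / 2 / r < nrm (fps_nth G k * x ^ k)" unfolding nG Tk using k(2) r by (intro divide_strict_right_mono) auto
      show "nrm (fps_nth G n * x ^ n) \<le> m / 2 / r" if "n \<noteq> k" for n
        unfolding nG using T_small[OF that] r by (intro divide_right_mono) auto
    qed
    hence "0 < nrm (eval_series G x)" unfolding nG Tk using k(2) r by simp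
    thus ?thesis by (simp add: nrm_pos)
  qed
  ultimately show ?thesis unfolding has_zero_of_order_def using factor by blast
qed

section \<open>Zeros of series with strictly convex valuations\<close>

theorem zeros_simple_and_rational:
  fixes S :: "nat \<Rightarrow> 'a fps"
  defines "F \<equiv> Abs_fps (\<lambda>d. emb (to_ac (fps_to_fls (S d))))"
  assumes S0: "S 0 = 1" and supp: "\<And>d. S (Suc d) \<noteq> 0 \<Longrightarrow> S d \<noteq> 0"
    and conv: "\<And>d. S (Suc (Suc d)) \<noteq> 0 \<Longrightarrow>
      2 * subdegree (S (Suc d)) < subdegree (S (Suc (Suc d))) + subdegree (S d)"
    and eval: "eval_series F x = 0"
  shows "has_zero_of_order F x 1" and "x \<in> range (\<lambda>f. emb (to_ac f))"
proof -
  define s where "s d = of_fls (fps_to_fls (S d))" for d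
  have F: "F = Abs_fps s" by (simp add: F_def s_def[abs_def] of_fls_def)
  define b where "b d = nrm (s d)" for d
  have b: "b d = (if S d = 0 then 0 else (1 / 2) ^ subdegree (S d))" for d
    by (simp add: b_def s_def nrm_of_fls_fps)
  have b_nonneg: "0 \<le> b d" for d by (simp add: b_def)
  have b0: "b 0 = 1" by (simp add: b S0)
  have b_supp: "b (Suc d) = 0" if "b d = 0" for d
    using that supp[of d] by (auto simp: b split: if_splits)
  have b_conv: "2 * (b d * b (Suc (Suc d))) \<le> b (Suc d) ^ 2" for d
  proof (cases "S (Suc (Suc d)) = 0")
    case True
    thus ?thesis by (simp add: b)
  next
    case False
    hence nz: "S (Suc d) \<noteq> 0" "S d \<noteq> 0" using supp by blast+
    \<comment> \<open>A strict inequality of integers leaves a margin of one, which becomes the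
      factor 2 because \<open>t\<close> has absolute value \<open>1 / 2\<close>.\<close>
    have "2 * (1 / 2 :: real) ^ (subdegree (S d) + subdegree (S (Suc (Suc d)))) \<le> 2 * (1 / 2) ^ Suc (2 * subdegree (S (Suc d)))"
      using conv[OF False] by (intro mult_left_mono power_decreasing) auto
    thus ?thesis using nz False by (simp add: b power_add power_mult mult.commute flip: power_mult)
  qed
  have decay: "\<exists>A\<ge>0. \<forall>d. b d \<le> A * \<epsilon> ^ d" if "0 < \<epsilon>" for \<epsilon>
    using superexponential_decay[OF b_nonneg b0 b_conv b_supp that] by metis
  define r where "r = nrm x"
  have r: "0 \<le> r" by (simp add: r_def)
  define c where "c d = b d * r ^ d" for d
  have c: "nrm (s d * x ^ d) = c d" for d by (simp add: c_def b_def r_def nrm_mult nrm_power)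
  have lim: "c \<longlonglongrightarrow> 0"
  proof -
    define \<epsilon> where "\<epsilon> = 1 / (2 * (r + 1))"
    have e0: "0 < \<epsilon>" and er: "\<epsilon> * r \<le> 1 / 2" using r by (auto simp: \<epsilon>_def field_simps)
    obtain A where A: "0 \<le> A" "\<And>d. b d \<le> A * \<epsilon> ^ d" using decay[OF e0] by blast
    have le: "norm (c d) \<le> A * (1 / 2) ^ d" for d
    proof -
      have "c d \<le> A * \<epsilon> ^ d * r ^ d" unfolding c_def using r by (intro mult_right_mono A) simp
      also have "... = A * (\<epsilon> * r) ^ d" by (simp add: power_mult_distrib)
      also have "... \<le> A * (1 / 2) ^ d" using A(1) e0 r er by (intro mult_left_mono power_mono) auto
      finally show ?thesis using b_nonneg[of d] r by (simp add: c_def)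
    qed
    have "(\<lambda>d. A * (1 / 2) ^ d) \<longlonglongrightarrow> A * 0" by (intro tendsto_mult tendsto_const LIMSEQ_power_zero) simp
    hence lim0: "(\<lambda>d. A * (1 / 2) ^ d) \<longlonglongrightarrow> 0" by simp
    show ?thesis by (rule Lim_null_comparison[OF always_eventually lim0]) (use le in simp)
  qed
  have "summable (\<lambda>d. s d * x ^ d)" by (rule summable_nrm) (simp add: c lim)
  hence zero: "(\<lambda>d. s d * x ^ d) sums 0"
    using eval summable_sums[of "\<lambda>d. s d * x ^ d"] by (simp add: F eval_series_def)
  have c_nonneg: "0 \<le> c d" for d using b_nonneg r by (simp add: c_def)
  have c_conv: "2 * (c d * c (Suc (Suc d))) \<le> c (Suc d) ^ 2" for d
  proof -
    have "2 * (b d * b (Suc (Suc d))) * (r ^ Suc d) ^ 2 \<le> b (Suc d) ^ 2 * (r ^ Suc d) ^ 2"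
      using b_conv by (intro mult_right_mono) auto
    thus ?thesis by (simp add: c_def power2_eq_square mult_ac)
  qed
  have c_supp: "c (Suc d) = 0" if "c d = 0" for d
    using that b_supp by (auto simp: c_def)
  obtain k where k: "0 < c k" "c (Suc k) = c k" "\<And>d. d \<noteq> k \<Longrightarrow> d \<noteq> Suc k \<Longrightarrow> c d \<le> c k / 2"
  proof (rule unique_max_or_tie[OF c_nonneg _ c_conv c_supp lim])
    show "c 0 = 1" by (simp add: c_def b0)
  next
    fix k B assume "0 \<le> B" "B < c k" "\<And>d. d \<noteq> k \<Longrightarrow> c d \<le> B"
    hence "nrm 0 = nrm (s k * x ^ k)" by (intro sums_nrm_dominant[OF zero]) (auto simp: c)
    hence "c k = 0" by (simp add: c)
    hence False using \<open>0 \<le> B\<close> \<open>B < c k\<close> by simp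
    thus thesis ..
  next
    fix k assume "0 < c k" "c (Suc k) = c k" "\<And>d. d \<noteq> k \<Longrightarrow> d \<noteq> Suc k \<Longrightarrow> c d \<le> c k / 2"
    thus thesis by (rule that)
  qed
  have cSk: "c (Suc k) \<noteq> 0" using k by simp
  hence x: "x \<noteq> 0" by (auto simp: c_def r_def)
  show "has_zero_of_order F x 1"
    unfolding F
  proof (rule has_zero_of_order_1I[OF _ x zero c k(1)])
    show "\<exists>A\<ge>0. \<forall>d. nrm (s d) \<le> A * \<epsilon> ^ d" if "0 < \<epsilon>" for \<epsilon>
      using decay[OF that] unfolding b_def .
    show "nrm (s d * x ^ d) \<le> c k / 2" if "d \<noteq> k" "d \<noteq> Suc k" for d
      unfolding c by (rule k(3)[OF that])
  qed
  have r0: "0 < r" using x by (simp add: r_def nrm_pos)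
  have sk: "s k \<noteq> 0" "s (Suc k) \<noteq> 0"
    using k(1) cSk by (intro notI, simp add: c_def b_def)+
  \<comment> \<open>At \<open>\<xi>\<close> the terms \<open>k\<close> and \<open>Suc k\<close>
    cancel exactly. It lies in the base field and has the norm of \<open>x\<close>, so division by
    it moves the zero to norm 1 and, after normalisation by term \<open>k\<close>, turns the
    dominating coefficients into 1 and \<open>- 1\<close>.\<close>
  define \<xi> where "\<xi> = of_fls (- fps_to_fls (S k) / fps_to_fls (S (Suc k)))"
  have \<xi>: "\<xi> = - s k / s (Suc k)" by (simp add: \<xi>_def s_def of_fls_divide of_fls_minus)
  have "(b (Suc k) * r) * r ^ k = b k * r ^ k" using k(2) by (simp add: c_def mult_ac)
  hence "b k = b (Suc k) * r" using r0 by simp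
  hence n\<xi>: "nrm \<xi> = r" using sk by (simp add: \<xi> nrm_divide b_def)
  have \<xi>0: "\<xi> \<noteq> 0" using n\<xi> r0 by auto
  define e where "e d = s d * \<xi> ^ d / (s k * \<xi> ^ k)" for d
  have ne: "nrm (e d) = c d / c k" for d
    by (simp add: e_def nrm_divide nrm_mult nrm_power n\<xi> c_def b_def)
  have eE: "e d = of_fls (fps_to_fls (S d) * (- fps_to_fls (S k) / fps_to_fls (S (Suc k))) ^ d /
      (fps_to_fls (S k) * (- fps_to_fls (S k) / fps_to_fls (S (Suc k))) ^ k))" for d
    unfolding e_def of_fls_divide of_fls_mult of_fls_power s_def \<xi>_def ..
  have eR: "e d \<in> \<O>" for d
  proof -
    have "c d \<le> c k" using k(1) k(2) k(3)[of d] by (cases "d = k \<or> d = Suc k") auto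
    hence "nrm (e d) \<le> 1" unfolding ne using k(1) by simp
    thus ?thesis unfolding eE by (rule of_fls_in_\<O>)
  qed
  define u where "u = x / \<xi>"
  have "u \<in> \<O>"
  proof (rule zero_near_1_in_\<O>[of e k])
    show "e d \<in> \<O>" for d by (rule eR)
    show "e k = 1" using sk \<xi>0 by (simp add: e_def)
    have "s (Suc k) * \<xi> = - s k" using sk by (simp add: \<xi>)
    moreover have "e (Suc k) = (s (Suc k) * \<xi>) * \<xi> ^ k / (s k * \<xi> ^ k)" by (simp add: e_def mult_ac)
    ultimately show "e (Suc k) = - 1" using sk \<xi>0 by simp
    show "nrm (e d) \<le> 1 / 2" if "d \<noteq> k" "d \<noteq> Suc k" for d
      unfolding ne using k(3)[OF that] k(1) by (simp add: field_simps)
    have "(\<lambda>d. c d / c k) \<longlonglongrightarrow> 0 / c k" using k(1) by (intro tendsto_divide lim tendsto_const) simp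
    thus "(\<lambda>d. nrm (e d)) \<longlonglongrightarrow> 0" unfolding ne by simp
    show "nrm u = 1" using r0 by (simp add: u_def nrm_divide n\<xi> flip: r_def)
    have "(\<lambda>d. inverse (s k * \<xi> ^ k) * (s d * x ^ d)) sums (inverse (s k * \<xi> ^ k) * 0)"
      by (rule sums_nrm_cmult[OF zero])
    moreover have "inverse (s k * \<xi> ^ k) * (s d * x ^ d) = e d * u ^ d" for d
    proof -
      have "x ^ d = \<xi> ^ d * u ^ d" using \<xi>0 by (simp add: u_def power_divide)
      thus ?thesis by (simp only: e_def divide_inverse mult_ac)
    qed
    ultimately show "(\<lambda>d. e d * u ^ d) sums 0" by simp
  qed
  then obtain h where "u = of_fls (fps_to_fls h)" unfolding \<O>_def by blast
  hence "x = of_fls (- fps_to_fls (S k) / fps_to_fls (S (Suc k)) * fps_to_fls h)"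
    using \<xi>0 unfolding of_fls_mult \<xi>_def[symmetric] by (simp add: u_def field_simps)
  thus "x \<in> range (\<lambda>f. emb (to_ac f))" unfolding of_fls_def by blast
qed

end

theorem theorem3:
  fixes emb :: "'a::finite_field fls alg_closure \<Rightarrow> 'c::{field, complete_space}"
    and z :: int and M :: "nat \<Rightarrow> nat" and x :: 'c
  assumes "completed_alg_closure emb"
    and "M \<in> padic_ints CHAR('a)"
    and "eval_series (goss_zeta emb (z, M)) x = 0"
  shows "has_zero_of_order (goss_zeta emb (z, M)) x 1 \<and> x \<in> range (\<lambda>f. emb (to_ac f))"
proof -
  interpret completed_alg_closure emb by fact
  show ?thesis
    using zeros_simple_and_rational[of "\<lambda>d. goss_S d (z, M)" x]
      goss_S_0[OF assms(2)] goss_S_valuation[OF assms(2), of _ z] assms(3)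
    unfolding goss_zeta_def by blast
qed

end
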